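(* Let $(\mathbf X,Y)$ be a random vector with values in $\mathbb R^d\times[-L,L]$, $L<\infty$, with arbitrary distribution, let $\mu$ be the distribution of $\mathbf X$, let $m(\mathbf x)=E[Y\mid \mathbf X=\mathbf x]$, and let $\Delta\in\{0,1\}$ be the indicator that $Y$ is observed, with selection probability $\pi(\mathbf x,y)=E[\Delta\mid \mathbf X=\mathbf x,Y=y]=\big(1+\exp\{g(\mathbf x)+\gamma^* y\}\big)^{-1}$, where $g$ is an unknown function and $\gamma^*\in\mathbb R$ is the true unknown parameter. Suppose that $\inf_{\mathbf x,y}\pi(\mathbf x,y)=:\pi_{\min}>0$. Let $\widehat\gamma$ be any estimator of $\gamma^*$ based on the i.i.d. data $(\mathbf X_i,Y_i,\Delta_i)$, $i=1,\dots,n$, and let $\widehat m_{n,\widehat\gamma}(\mathbf x)$ be the kernel-type estimator $$\widehat m_{n,\widehat\gamma}(\mathbf x)=\widehat\eta_1(\mathbf x,0)+\frac{\widehat\eta_1(\mathbf x,\widehat\gamma)}{\widehat\eta_2(\mathbf x,\widehat\gamma)}\big(1-\widehat\eta_2(\mathbf x,0)\big),\qquad \widehat\eta_k(\mathbf x,t)=\frac{\sum_{i=1}^n\Delta_iY_i^{2-k}\exp\{tY_i\}\,\mathcal K((\mathbf x-\mathbf X_i)/h)}{\sum_{i=1}^n\mathcal K((\mathbf x-\mathbf X_i)/h)},\ k=1,2,\ t\in\mathbb R.$$ Suppose that the kernel $\mathcal K$ is regular and that its bandwidth $h=h_n>0$ satisfies $h\to0$ and $nh^d\to\infty$ as $n\to\infty$.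 Then for every $\epsilon>0$, every $1\le p<\infty$, any distribution of $(\mathbf X,Y)\in\mathbb R^d\times[-L,L]$, and $n$ large enough, $$P\left\{\int\big|\widehat m_{n,\widehat\gamma}(\mathbf x)-m(\mathbf x)\big|^p\,\mu(d\mathbf x)>\epsilon\right\}\le c_1e^{-c_2n}+c_3\,P\big\{|\widehat\gamma-\gamma^*|>C_0\big\},$$ where $c_1,c_2,c_3$ and $C_0$ are positive constants not depending on $n$; here $c_2$ also depends on $\epsilon$.
   Context: The response $Y$ may be missing: $\Delta=0$ if $Y$ is missing and $\Delta=1$ otherwise; $Y_i$ is unavailable when $\Delta_i=0$. The data $(\mathbf X_i,Y_i,\Delta_i)$, $i=1,\dots,n$, are i.i.d. copies of $(\mathbf X,Y,\Delta)$. A nonnegative kernel $\mathcal K:\mathbb R^d\to\mathbb R_+$ is called regular if there are real constants $b>0$ and $r>0$ such that $\mathcal K(\mathbf u)\ge b\,I\{\mathbf u\in S_{0,r}\}$ and $\int\sup_{\mathbf y\in\mathbf u+S_{0,r}}\mathcal K(\mathbf y)\,d\mathbf u<\infty$, where $S_{0,r}$ is the ball of radius $r$ centered at the origin.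
   Formalization: The constant C_0, like c_2, is allowed to depend on ε (c_1 and c_3 are not); with C_0 independent of ε the bound fails for some estimators. *)

theory Defs
  imports "HOL-Probability.Probability"
begin

(* f is a version of the regression function z \<mapsto> E[V | Z = z]. Such an f is only determined
   up to a null set of the distribution of Z. *)
definition cond_exp_given :: "'w measure \<Rightarrow> ('w \<Rightarrow> real) \<Rightarrow> ('w \<Rightarrow> 'b::topological_space) \<Rightarrow> ('b \<Rightarrow> real) \<Rightarrow> bool"
  where "cond_exp_given M V Z f \<longleftrightarrow>
    f \<in> borel_measurable borel \<and>
    (AE w in M. real_cond_exp M (vimage_algebra (space M) Z borel) V w = f (Z w))"

definition selection_prob :: "('a \<Rightarrow> real) \<Rightarrow> real \<Rightarrow> 'a \<Rightarrow> real \<Rightarrow> real"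
  where "selection_prob g \<gamma> x y = inverse (1 + exp (g x + \<gamma> * y))"

(* Borel measurability is the usual tacit assumption on kernels. The supremum and the integral are
   taken in ennreal, so they carry no boundedness or integrability side conditions. *)
definition regular_kernel :: "('a::euclidean_space \<Rightarrow> real) \<Rightarrow> bool"
  where "regular_kernel K \<longleftrightarrow>
    K \<in> borel_measurable borel \<and> (\<forall>u. 0 \<le> K u) \<and>
    (\<exists>b>0. \<exists>r>0.
      (\<forall>u. K u \<ge> b * indicator (cball 0 r) u) \<and>
      (\<integral>\<^sup>+ u. (SUP y \<in> (+) u ` cball 0 r. ennreal (K y)) \<partial>lborel) < \<infinity>)"

(* A sample of size n is a function z whose entries z i = (X, Y, Delta), i < n, are the
   observations, and k is 1 or 2. Quotients with denominator 0 are 0 (so 0/0 = 0). A value Y with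
   Delta = 0 does not influence the result. *)
definition eta_hat ::
  "('a::euclidean_space \<Rightarrow> real) \<Rightarrow> real \<Rightarrow> nat \<Rightarrow> (nat \<Rightarrow> 'a \<times> real \<times> real) \<Rightarrow> nat \<Rightarrow> 'a \<Rightarrow> real \<Rightarrow> real"
  where "eta_hat K h n z k x t =
    (\<Sum>i<n. case z i of (X, Y, \<Delta>) \<Rightarrow> \<Delta> * Y ^ (2 - k) * exp (t * Y) * K ((x - X) /\<^sub>R h)) /
    (\<Sum>i<n. case z i of (X, Y, \<Delta>) \<Rightarrow> K ((x - X) /\<^sub>R h))"

definition m_hat ::
  "('a::euclidean_space \<Rightarrow> real) \<Rightarrow> real \<Rightarrow> nat \<Rightarrow> (nat \<Rightarrow> 'a \<times> real \<times> real) \<Rightarrow> real \<Rightarrow> 'a \<Rightarrow> real"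
  where "m_hat K h n z \<gamma> x =
    eta_hat K h n z 1 x 0 +
    eta_hat K h n z 1 x \<gamma> / eta_hat K h n z 2 x \<gamma> * (1 - eta_hat K h n z 2 x 0)"

end

theory Submission
  imports Defs
begin

text \<open>
  Write \<open>\<eta>\<^sub>k(x,t)\<close> for the regression function of \<open>\<Delta> Y\<^bsup>2-k\<^esup> e\<^bsup>tY\<^esup>\<close> on \<open>X\<close>. The logistic form of the
  selection probability says that its odds factor: \<open>1 - \<pi>(x,y) = \<pi>(x,y) e\<^bsup>g(x)\<^esup> e\<^bsup>\<gamma>y\<^esup>\<close>. Hence the
  tilt \<open>e\<^bsup>\<gamma>Y\<^esup>\<close> turns averages over observed responses into averages over missing ones,
  up to the unknown factor \<open>e\<^bsup>g\<^esup>\<close>: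
  \<open>e\<^bsup>g\<^esup> \<eta>\<^sub>1(\<cdot>,\<gamma>) = m - \<eta>\<^sub>1(\<cdot>,0)\<close> and \<open>e\<^bsup>g\<^esup> \<eta>\<^sub>2(\<cdot>,\<gamma>) = 1 - \<eta>\<^sub>2(\<cdot>,0)\<close>. The factor cancels in the
  quotient, so that \<open>m = \<eta>\<^sub>1(\<cdot>,0) + \<eta>\<^sub>1(\<cdot>,\<gamma>) / \<eta>\<^sub>2(\<cdot>,\<gamma>) (1 - \<eta>\<^sub>2(\<cdot>,0))\<close> almost everywhere
  (\<open>regression_representation\<close>). The estimator is the same expression in the kernel estimates
  of the \<open>\<eta>\<^sub>k\<close>, evaluated at the estimated parameter. The quotient of estimates is a weighted mean of
  responses in \<open>[-L,L]\<close>; it therefore stays bounded and moves by at most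
  \<open>2L (e\<^bsup>\<bar>t-\<gamma>\<bar>L\<^esup> - 1)\<close> when \<open>\<gamma>\<close> is replaced by \<open>t\<close> (\<open>tilted_mean_perturbation\<close>). Together with
  the lower bound on \<open>\<eta>\<^sub>2(\<cdot>,\<gamma>)\<close> that positivity of the selection probability gives, the
  error at a point is at most a constant times the sum of the four errors of the kernel estimates,
  plus this perturbation (\<open>plug_in_error_bound\<close>). Everything is bounded, so the \<open>p\<close>-th
  power of the error is at most a constant times the error.

  It remains to bound the \<open>L\<^sup>1(\<mu>)\<close> error of a kernel regression estimate with bounded response, with
  exponentially small exceptional probability. Replacing the random denominator
  \<open>\<Sum> K((x - X\<^sub>i)/h)\<close> by its mean \<open>n \<kappa>(x)\<close> costs an error of the same kind, for the constant response
  \<open>1\<close> (\<open>quotient_vs_normalized\<close>). For the normalized estimate two facts are combined. Its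
  \<open>L\<^sup>1(\<mu>)\<close> error is a function of independent observations, and changing one of them moves it by
  \<open>O(1/n)\<close>, so it exceeds its mean by \<open>\<epsilon>\<close> with probability at most \<open>e\<^bsup>-cn\<^esup>\<close> only
  (\<open>bounded_differences_inequality\<close>). And its mean tends to \<open>0\<close>: the bias vanishes because
  integrable functions are close to uniformly continuous ones (\<open>bias_vanishes\<close>), and the
  stochastic part because \<open>n h\<^sup>d \<longlongrightarrow> \<infinity>\<close> (\<open>stochastic_part\<close>).

  All of this must hold for an arbitrary distribution \<open>\<mu>\<close>, which may have no density. What makes this
  possible is the covering inequality \<open>kernel_covering\<close>: the integral
  \<open>\<integral> K((x - z)/h) / \<kappa>(x) \<mu>(dx)\<close> is bounded by a constant that depends on the kernel only. It controls the
  influence of one observation, the bias, the mass of the weights far from \<open>z\<close>, and, applied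
  to the indicator of a ball, the variance term \<open>\<integral> 1/\<kappa> d\<mu>\<close>.
\<close>

section \<open>Concentration of functions of independent observations\<close>

text \<open>
  Integrate out one coordinate at a time. Given the others, the function varies by at most \<open>c\<close>
  around its conditional mean, so Hoeffding's lemma on an interval of length \<open>2c\<close> costs a factor
  \<open>e\<^bsup>s\<^sup>2c\<^sup>2/2\<^esup>\<close>; the conditional mean inherits the bounded differences in the remaining coordinates.
\<close>

lemma bounded_differences_mgf:
  fixes N :: "'z measure" and f :: "('i \<Rightarrow> 'z) \<Rightarrow> real"
  assumes "prob_space N" "finite I" "0 < s"
    and "f \<in> borel_measurable (PiM I (\<lambda>_. N))"
    and "\<And>z. z \<in> space (PiM I (\<lambda>_. N)) \<Longrightarrow> \<bar>f z\<bar> \<le> B"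
    and "\<And>z i y. z \<in> space (PiM I (\<lambda>_. N)) \<Longrightarrow> i \<in> I \<Longrightarrow> y \<in> space N \<Longrightarrow> \<bar>f (z(i := y)) - f z\<bar> \<le> c"
  shows "(\<integral>\<^sup>+z. ennreal (exp (s * (f z - integral\<^sup>L (PiM I (\<lambda>_. N)) f))) \<partial>PiM I (\<lambda>_. N))
    \<le> ennreal (exp (real (card I) * (s\<^sup>2 * c\<^sup>2 / 2)))"
  using assms(2,4,5,6)
proof (induction I arbitrary: f rule: finite_induct)
  case empty
  interpret prob_space "PiM {} (\<lambda>_. N)"
    by (intro prob_space_PiM assms)
  have "(\<integral>\<^sup>+z. ennreal (exp (s * (f z - integral\<^sup>L (PiM {} (\<lambda>_. N)) f))) \<partial>PiM {} (\<lambda>_. N)) = 1"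
    by (simp add: PiM_empty nn_integral_count_space_finite lebesgue_integral_count_space_finite)
  then show ?case by simp
next
  case (insert i I)
  let ?P = "PiM I (\<lambda>_. N)" and ?Q = "PiM (insert i I) (\<lambda>_. N)"
  interpret N: prob_space N by fact
  interpret product_sigma_finite "\<lambda>_. N" by standard
  interpret P: prob_space ?P by (intro prob_space_PiM assms)
  interpret Q: prob_space ?Q by (intro prob_space_PiM assms)
  note [measurable] = insert.prems(1)
  have upd: "x(i := y) \<in> space ?Q" if "x \<in> space ?P" "y \<in> space N" for x y
    using that by (auto simp: space_PiM PiE_def Pi_def extensional_def)
  have upd_meas: "(\<lambda>y. f (x(i := y))) \<in> borel_measurable N" if "x \<in> space ?P" for x
    using that by measurable
  define fb where "fb x = (\<integral>y. f (x(i := y)) \<partial>N)" for x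
  have intf: "integrable N (\<lambda>y. f (x(i := y)))" if "x \<in> space ?P" for x
    by (rule N.integrable_const_bound[where B = B])
      (use that upd upd_meas insert.prems(2) in auto)
  have intQ: "integrable ?Q f"
    by (rule Q.integrable_const_bound[where B = B]) (use insert.prems in auto)
  have fb_meas [measurable]: "fb \<in> borel_measurable ?P"
    unfolding fb_def by measurable
  have E: "integral\<^sup>L ?Q f = integral\<^sup>L ?P fb"
    unfolding fb_def by (rule product_integral_insert[OF insert.hyps(1,2) intQ])
  have fb_bound: "\<bar>fb x\<bar> \<le> B" if x: "x \<in> space ?P" for x
  proof -
    have "\<bar>fb x\<bar> \<le> (\<integral>y. \<bar>f (x(i := y))\<bar> \<partial>N)" unfolding fb_def by (rule integral_abs_bound)
    also have "\<dots> \<le> (\<integral>y. B \<partial>N)"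
      using insert.prems(2)[OF upd[OF x]]
      by (intro integral_mono integrable_abs intf x) (auto simp del: fun_upd_apply)
    finally show ?thesis by (simp add: N.prob_space)
  qed
  have fb_diff: "\<bar>fb (x(j := y)) - fb x\<bar> \<le> c" if x: "x \<in> space ?P" and j: "j \<in> I" and y: "y \<in> space N" for x j y
  proof -
    have ji: "j \<noteq> i" using insert.hyps j by auto
    have x': "x(j := y) \<in> space ?P"
      using x y j by (auto simp: space_PiM PiE_def Pi_def extensional_def)
    have "fb (x(j := y)) - fb x = (\<integral>t. f (x(j := y, i := t)) - f (x(i := t)) \<partial>N)"
      unfolding fb_def using intf[OF x] intf[OF x'] by simp
    also have "\<bar>\<dots>\<bar> \<le> (\<integral>t. \<bar>f (x(j := y, i := t)) - f (x(i := t))\<bar> \<partial>N)"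
      by (rule integral_abs_bound)
    also have "\<dots> \<le> (\<integral>t. c \<partial>N)"
    proof (intro integral_mono integrable_abs Bochner_Integration.integrable_diff intf x x')
      fix t assume t: "t \<in> space N"
      have "f (x(j := y, i := t)) = f ((x(i := t))(j := y))"
        using ji by (simp add: fun_upd_twist)
      then show "\<bar>f (x(j := y, i := t)) - f (x(i := t))\<bar> \<le> c"
        using insert.prems(3)[OF upd[OF x t], of j y] j y by (simp del: fun_upd_apply)
    qed simp
    finally show ?thesis by (simp add: N.prob_space)
  qed
  have inner: "(\<integral>\<^sup>+y. ennreal (exp (s * (f (x(i := y)) - integral\<^sup>L ?P fb))) \<partial>N)
      \<le> ennreal (exp (s\<^sup>2 * c\<^sup>2 / 2)) * ennreal (exp (s * (fb x - integral\<^sup>L ?P fb)))"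
    if x: "x \<in> space ?P" for x
  proof -
    have dev: "\<bar>f (x(i := y)) - fb x\<bar> \<le> c" if y: "y \<in> space N" for y
    proof -
      have "f (x(i := y)) - fb x = (\<integral>t. f (x(i := y)) - f (x(i := t)) \<partial>N)"
        unfolding fb_def using intf[OF x] by (simp add: N.prob_space)
      also have "\<bar>\<dots>\<bar> \<le> (\<integral>t. \<bar>f (x(i := y)) - f (x(i := t))\<bar> \<partial>N)"
        by (rule integral_abs_bound)
      also have "\<dots> \<le> (\<integral>t. c \<partial>N)"
      proof (intro integral_mono integrable_abs Bochner_Integration.integrable_diff intf x)
        fix t assume t: "t \<in> space N"
        show "\<bar>f (x(i := y)) - f (x(i := t))\<bar> \<le> c"
          using insert.prems(3)[OF upd[OF x t], of i y] y by (simp del: fun_upd_apply add: fun_upd_upd)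
      qed simp_all
      finally show ?thesis by (simp add: N.prob_space)
    qed
    interpret interval_bounded_random_variable N "\<lambda>y. f (x(i := y))" "fb x - c" "fb x + c"
    proof
      show "(\<lambda>y. f (x(i := y))) \<in> borel_measurable N" by (rule upd_meas[OF x])
      show "AE y in N. f (x(i := y)) \<in> {fb x - c..fb x + c}"
        by (rule AE_I2) (use dev in \<open>auto simp: abs_le_iff algebra_simps\<close>)
    qed
    have "(\<integral>\<^sup>+y. ennreal (exp (s * (f (x(i := y)) - integral\<^sup>L ?P fb))) \<partial>N)
        = (\<integral>\<^sup>+y. ennreal (exp (s * (f (x(i := y)) - fb x))) * ennreal (exp (s * (fb x - integral\<^sup>L ?P fb))) \<partial>N)"
      by (intro nn_integral_cong)
        (simp flip: ennreal_mult exp_add add: algebra_simps)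
    also have "\<dots> = (\<integral>\<^sup>+y. ennreal (exp (s * (f (x(i := y)) - fb x))) \<partial>N) * ennreal (exp (s * (fb x - integral\<^sup>L ?P fb)))"
      using upd_meas[OF x] by (intro nn_integral_multc) measurable
    also have "(\<integral>\<^sup>+y. ennreal (exp (s * (f (x(i := y)) - fb x))) \<partial>N) \<le> ennreal (exp (s\<^sup>2 * (fb x + c - (fb x - c))\<^sup>2 / 8))"
      using Hoeffdings_lemma_nn_integral[OF \<open>0 < s\<close>] unfolding fb_def[symmetric] .
    also have "s\<^sup>2 * (fb x + c - (fb x - c))\<^sup>2 / 8 = s\<^sup>2 * c\<^sup>2 / 2"
      by (simp add: power2_eq_square)
    finally show ?thesis by (simp del: fun_upd_apply add: mult_right_mono)
  qed
  have "(\<integral>\<^sup>+z. ennreal (exp (s * (f z - integral\<^sup>L ?Q f))) \<partial>?Q)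
      = (\<integral>\<^sup>+x. \<integral>\<^sup>+y. ennreal (exp (s * (f (x(i := y)) - integral\<^sup>L ?P fb))) \<partial>N \<partial>?P)"
    unfolding E by (rule product_nn_integral_insert[OF insert.hyps(1,2)]) measurable
  also have "\<dots> \<le> (\<integral>\<^sup>+x. ennreal (exp (s\<^sup>2 * c\<^sup>2 / 2)) * ennreal (exp (s * (fb x - integral\<^sup>L ?P fb))) \<partial>?P)"
    by (intro nn_integral_mono inner)
  also have "\<dots> = ennreal (exp (s\<^sup>2 * c\<^sup>2 / 2)) * (\<integral>\<^sup>+x. ennreal (exp (s * (fb x - integral\<^sup>L ?P fb))) \<partial>?P)"
    by (rule nn_integral_cmult) measurable
  also have "\<dots> \<le> ennreal (exp (s\<^sup>2 * c\<^sup>2 / 2)) * ennreal (exp (real (card I) * (s\<^sup>2 * c\<^sup>2 / 2)))"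
    by (intro mult_left_mono insert.IH fb_meas fb_bound fb_diff) auto
  also have "\<dots> = ennreal (exp (real (card (insert i I)) * (s\<^sup>2 * c\<^sup>2 / 2)))"
    using insert.hyps by (simp flip: ennreal_mult exp_add add: algebra_simps)
  finally show ?case .
qed

text \<open>
  McDiarmid's inequality, with a weaker constant in the exponent: Chernoff's bound at the
  minimizing \<open>s\<close>.
\<close>

theorem bounded_differences_inequality:
  fixes N :: "'z measure" and f :: "('i \<Rightarrow> 'z) \<Rightarrow> real"
  assumes "prob_space N" "finite I" "I \<noteq> {}" "0 < c" "0 < t"
    and [measurable]: "f \<in> borel_measurable (PiM I (\<lambda>_. N))"
    and bound: "\<And>z. z \<in> space (PiM I (\<lambda>_. N)) \<Longrightarrow> \<bar>f z\<bar> \<le> B"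
    and diff: "\<And>z i y. z \<in> space (PiM I (\<lambda>_. N)) \<Longrightarrow> i \<in> I \<Longrightarrow> y \<in> space N \<Longrightarrow> \<bar>f (z(i := y)) - f z\<bar> \<le> c"
  shows "measure (PiM I (\<lambda>_. N)) {z \<in> space (PiM I (\<lambda>_. N)). f z - integral\<^sup>L (PiM I (\<lambda>_. N)) f \<ge> t}
    \<le> exp (- t\<^sup>2 / (2 * real (card I) * c\<^sup>2))"
proof -
  let ?P = "PiM I (\<lambda>_. N)"
  interpret P: prob_space ?P by (intro prob_space_PiM assms)
  have card: "0 < real (card I)" using assms(2,3) by (simp add: card_gt_0_iff)
  define s where "s = t / (real (card I) * c\<^sup>2)"
  have s: "0 < s" unfolding s_def using assms card by simp
  have "ennreal (P.prob {z \<in> space ?P. f z - integral\<^sup>L ?P f \<ge> t})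
      = emeasure ?P {z \<in> space ?P. f z - integral\<^sup>L ?P f \<ge> t}"
    by (simp add: P.emeasure_eq_measure)
  also have "\<dots> \<le> ennreal (exp (- s * t)) * (\<integral>\<^sup>+z\<in>space ?P. exp (s * (f z - integral\<^sup>L ?P f)) \<partial>?P)"
    by (intro Chernoff_ineq_nn_integral_ge s) auto
  also have "(\<integral>\<^sup>+z\<in>space ?P. exp (s * (f z - integral\<^sup>L ?P f)) \<partial>?P)
      = (\<integral>\<^sup>+z. ennreal (exp (s * (f z - integral\<^sup>L ?P f))) \<partial>?P)"
    by (intro nn_integral_cong) simp
  also have "ennreal (exp (- s * t)) * \<dots> \<le> ennreal (exp (- s * t)) * ennreal (exp (real (card I) * (s\<^sup>2 * c\<^sup>2 / 2)))"
    by (rule mult_left_mono[OF bounded_differences_mgf[OF assms(1,2) s assms(6) bound diff]]) auto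
  also have "\<dots> = ennreal (exp (- s * t + real (card I) * (s\<^sup>2 * c\<^sup>2 / 2)))"
    by (simp flip: ennreal_mult exp_add)
  also have "- s * t + real (card I) * (s\<^sup>2 * c\<^sup>2 / 2) = - t\<^sup>2 / (2 * real (card I) * c\<^sup>2)"
    unfolding s_def using card \<open>0 < c\<close> by (simp add: field_simps power2_eq_square)
  finally show ?thesis by simp
qed

text \<open>
  The mixed terms vanish because each new summand has mean \<open>0\<close> given the earlier ones.
\<close>

lemma second_moment_iid_sum:
  fixes N :: "'z measure" and \<psi> :: "'z \<Rightarrow> real"
  assumes "prob_space N" "finite I"
    and [measurable]: "\<psi> \<in> borel_measurable N"
    and bound: "\<And>z. \<bar>\<psi> z\<bar> \<le> B"
    and mean: "(\<integral>z. \<psi> z \<partial>N) = 0"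
  shows "(\<integral>z. (\<Sum>i\<in>I. \<psi> (z i))\<^sup>2 \<partial>PiM I (\<lambda>_. N)) = real (card I) * (\<integral>z. (\<psi> z)\<^sup>2 \<partial>N)"
  using assms(2)
proof (induction I rule: finite_induct)
  case empty
  then show ?case by simp
next
  case (insert i I)
  let ?P = "PiM I (\<lambda>_. N)" and ?Q = "PiM (insert i I) (\<lambda>_. N)"
  interpret N: prob_space N by fact
  interpret product_sigma_finite "\<lambda>_. N" by standard
  interpret P: prob_space ?P by (intro prob_space_PiM assms)
  interpret Q: prob_space ?Q by (intro prob_space_PiM assms)
  have B: "0 \<le> B" using bound[of undefined] by linarith
  have sumb: "\<bar>\<Sum>j\<in>J. \<psi> (x j)\<bar> \<le> real (card J) * B" for J and x :: "'a \<Rightarrow> 'z"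
  proof -
    have "\<bar>\<Sum>j\<in>J. \<psi> (x j)\<bar> \<le> (\<Sum>j\<in>J. \<bar>\<psi> (x j)\<bar>)" by (rule sum_abs)
    also have "\<dots> \<le> real (card J) * B" by (rule sum_bounded_above) (rule bound)
    finally show ?thesis .
  qed
  have sq: "(\<Sum>j\<in>J. \<psi> (x j))\<^sup>2 \<le> (real (card J) * B)\<^sup>2" for J and x :: "'a \<Rightarrow> 'z"
    using sumb[of x J] by (simp add: abs_le_square_iff[symmetric])
  have int1: "integrable N \<psi>"
    by (rule N.integrable_const_bound[where B = B]) (use bound in auto)
  have int2: "integrable N (\<lambda>z. (\<psi> z)\<^sup>2)"
    by (rule N.integrable_const_bound[where B = "B\<^sup>2"]) (use bound B in \<open>auto simp: abs_le_square_iff[symmetric]\<close>)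
  have intP: "integrable ?P (\<lambda>z. (\<Sum>j\<in>I. \<psi> (z j))\<^sup>2)"
    by (rule P.integrable_const_bound[where B = "(real (card I) * B)\<^sup>2"]) (use sq in auto)
  have intQ: "integrable ?Q (\<lambda>z. (\<Sum>j\<in>insert i I. \<psi> (z j))\<^sup>2)"
    by (rule Q.integrable_const_bound[where B = "(real (card (insert i I)) * B)\<^sup>2"]) (use sq in auto)
  have upd: "(\<Sum>j\<in>I. \<psi> ((x(i := y)) j)) = (\<Sum>j\<in>I. \<psi> (x j))" for x y
    using insert.hyps by (intro sum.cong) auto
  have "(\<integral>z. (\<Sum>j\<in>insert i I. \<psi> (z j))\<^sup>2 \<partial>?Q)
      = (\<integral>x. \<integral>y. (\<Sum>j\<in>insert i I. \<psi> ((x(i := y)) j))\<^sup>2 \<partial>N \<partial>?P)"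
    by (rule product_integral_insert[OF insert.hyps(1,2) intQ])
  also have "\<dots> = (\<integral>x. \<integral>y. (\<psi> y)\<^sup>2 + (2 * (\<Sum>j\<in>I. \<psi> (x j))) * \<psi> y + (\<Sum>j\<in>I. \<psi> (x j))\<^sup>2 \<partial>N \<partial>?P)"
    unfolding sum.insert[OF insert.hyps] upd fun_upd_same
    by (simp add: power2_sum algebra_simps)
  also have "\<dots> = (\<integral>x. (\<integral>y. (\<psi> y)\<^sup>2 \<partial>N) + (\<Sum>j\<in>I. \<psi> (x j))\<^sup>2 \<partial>?P)"
    using int1 int2 by (intro Bochner_Integration.integral_cong refl) (simp add: mean N.prob_space)
  also have "\<dots> = (\<integral>y. (\<psi> y)\<^sup>2 \<partial>N) + real (card I) * (\<integral>z. (\<psi> z)\<^sup>2 \<partial>N)"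
    using intP by (simp add: P.prob_space insert.IH)
  finally show ?case using insert.hyps by (simp add: algebra_simps)
qed

section \<open>The covering inequality for kernels\<close>

lemma ennreal_inverse_antimono: "x \<le> y \<Longrightarrow> inverse y \<le> inverse (x::ennreal)"
  by (simp add: less_eq_ennreal.rep_eq inverse_ennreal.rep_eq ereal_inverse_antimono)

text \<open>
  Write \<open>1\<close> as the normalized volume of the ball of radius \<open>\<rho>\<close> around \<open>(x - z)/h\<close> and exchange the
  two integrals. For a fixed centre \<open>u\<close>, the points \<open>x\<close> with \<open>(x - z)/h\<close> in the ball around \<open>u\<close> form
  a set \<open>A\<close> of rescaled diameter at most \<open>2\<rho>\<close>. On \<open>A\<close> the numerator is at most \<open>W u\<close>, and
  the denominator is at least \<open>b \<mu>(A)\<close> because the kernel is at least \<open>b\<close> on differences of points of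
  \<open>A\<close>. The factor \<open>\<mu>(A)\<close> cancels, whatever \<open>\<mu>\<close> is. Allowing any numerator \<open>G\<close> lets the same bound
  serve for truncated kernels and for indicators of balls.
\<close>

lemma kernel_covering:
  fixes \<mu> :: "'a::euclidean_space measure" and K :: "'a \<Rightarrow> real" and G W :: "'a \<Rightarrow> ennreal"
  assumes "finite_measure \<mu>" and sets_\<mu> [measurable_cong]: "sets \<mu> = sets borel"
    and "0 < h" "0 < \<rho>" "0 < b"
    and K_meas [measurable]: "K \<in> borel_measurable borel"
    and K_lower: "\<And>u. norm u \<le> 2 * \<rho> \<Longrightarrow> b \<le> K u"
    and G_meas [measurable]: "G \<in> borel_measurable borel"
    and W_meas [measurable]: "W \<in> borel_measurable borel"
    and GW: "\<And>u y. norm (y - u) \<le> \<rho> \<Longrightarrow> G y \<le> W u"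
  shows "(\<integral>\<^sup>+x. G ((x - z) /\<^sub>R h) / (\<integral>\<^sup>+y. ennreal (K ((x - y) /\<^sub>R h)) \<partial>\<mu>) \<partial>\<mu>)
    \<le> (\<integral>\<^sup>+u. W u \<partial>lborel) / (ennreal b * emeasure lborel (cball (0::'a) \<rho>))"
proof -
  interpret finite_measure \<mu> by fact
  interpret pair_sigma_finite lborel \<mu> by standard
  have space_\<mu> [simp]: "space \<mu> = UNIV"
    using sets_eq_imp_space_eq[OF sets_\<mu>] by simp
  have [measurable]: "cball (0::'a) \<rho> \<in> sets borel" by simp
  define \<kappa> where "\<kappa> x = (\<integral>\<^sup>+y. ennreal (K ((x - y) /\<^sub>R h)) \<partial>\<mu>)" for x
  have [measurable]: "\<kappa> \<in> borel_measurable borel"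
    unfolding \<kappa>_def by measurable
  define v where "v = emeasure lborel (cball (0::'a) \<rho>)"
  have v: "v \<noteq> 0" "v \<noteq> \<infinity>"
    unfolding v_def using \<open>0 < \<rho>\<close> emeasure_lborel_cball_finite[of "0::'a" \<rho>]
      unit_ball_vol_pos[of "real DIM('a)"]
    by (auto simp: emeasure_cball simp del: unit_ball_vol_pos)
  have vshift: "(\<integral>\<^sup>+u. indicator (cball 0 \<rho>) (u - a) \<partial>lborel) = v" for a :: 'a
  proof -
    have "(\<integral>\<^sup>+u. indicator (cball 0 \<rho>) (u - a) \<partial>lborel) = (\<integral>\<^sup>+u. indicator (cball a \<rho>) u \<partial>lborel)"
      by (intro nn_integral_cong) (auto simp: indicator_def dist_norm norm_minus_commute)
    also have "\<dots> = emeasure lborel (cball a \<rho>)" by simp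
    also have "\<dots> = v" unfolding v_def using \<open>0 < \<rho>\<close> by (simp add: emeasure_cball)
    finally show ?thesis .
  qed
  let ?Q = "\<lambda>u x. indicator (cball 0 \<rho>) (u - (x - z) /\<^sub>R h) * (G ((x - z) /\<^sub>R h) / \<kappa> x) :: ennreal"
  have "(\<integral>\<^sup>+x. G ((x - z) /\<^sub>R h) / \<kappa> x \<partial>\<mu>) * v = (\<integral>\<^sup>+x. \<integral>\<^sup>+u. ?Q u x \<partial>lborel \<partial>\<mu>)"
  proof -
    have "(\<integral>\<^sup>+u. ?Q u x \<partial>lborel) = v * (G ((x - z) /\<^sub>R h) / \<kappa> x)" for x
    proof -
      have m: "(\<lambda>u. indicator (cball 0 \<rho>) (u - (x - z) /\<^sub>R h) :: ennreal) \<in> borel_measurable lborel"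
        by measurable
      show ?thesis by (simp only: nn_integral_multc[OF m] vshift)
    qed
    then show ?thesis
      by (subst nn_integral_multc[symmetric]) (measurable, simp add: mult.commute)
  qed
  also have "\<dots> = (\<integral>\<^sup>+u. \<integral>\<^sup>+x. ?Q u x \<partial>\<mu> \<partial>lborel)"
    by (rule Fubini') measurable
  also have "\<dots> \<le> (\<integral>\<^sup>+u. W u / b \<partial>lborel)"
  proof (intro nn_integral_mono)
    fix u :: 'a
    define A where "A = {x. norm (u - (x - z) /\<^sub>R h) \<le> \<rho>}"
    have A [measurable]: "A \<in> sets borel" unfolding A_def by measurable
    have "b * emeasure \<mu> A \<le> \<kappa> x" if x: "x \<in> A" for x
    proof -
      have "b * emeasure \<mu> A = (\<integral>\<^sup>+y. ennreal b * indicator A y \<partial>\<mu>)"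
        by (subst nn_integral_cmult_indicator) (use A sets_\<mu> in auto)
      also have "\<dots> \<le> \<kappa> x"
        unfolding \<kappa>_def
      proof (intro nn_integral_mono)
        fix y
        show "ennreal b * indicator A y \<le> ennreal (K ((x - y) /\<^sub>R h))"
        proof (cases "y \<in> A")
          case True
          have "(x - y) /\<^sub>R h = (u - (y - z) /\<^sub>R h) - (u - (x - z) /\<^sub>R h)"
            by (simp add: algebra_simps)
          then have "norm ((x - y) /\<^sub>R h) \<le> \<rho> + \<rho>"
            using True x norm_triangle_ineq4[of "u - (y - z) /\<^sub>R h" "u - (x - z) /\<^sub>R h"] unfolding A_def by force
          then show ?thesis using True K_lower[of "(x - y) /\<^sub>R h"] by (auto intro: ennreal_leI)
        qed simp
      qed
      finally show ?thesis .
    qed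
    note \<kappa>_lower = this
    have "(\<integral>\<^sup>+x. ?Q u x \<partial>\<mu>) \<le> (\<integral>\<^sup>+x. W u / (b * emeasure \<mu> A) * indicator A x \<partial>\<mu>)"
    proof (intro nn_integral_mono)
      fix x
      show "?Q u x \<le> W u / (b * emeasure \<mu> A) * indicator A x"
      proof (cases "x \<in> A")
        case True
        then have "G ((x - z) /\<^sub>R h) \<le> W u"
          by (intro GW) (simp add: A_def norm_minus_commute)
        then have "G ((x - z) /\<^sub>R h) / \<kappa> x \<le> W u / (b * emeasure \<mu> A)"
          unfolding divide_ennreal_def
          by (rule mult_mono) (use \<kappa>_lower[OF True] ennreal_inverse_antimono in auto)
        then show ?thesis using True by (simp add: A_def)
      qed (simp add: A_def)
    qed
    also have "\<dots> = W u / (b * emeasure \<mu> A) * emeasure \<mu> A"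
      by (subst nn_integral_cmult_indicator) (use A sets_\<mu> in auto)
    also have "\<dots> \<le> W u / b"
    proof (cases "emeasure \<mu> A = 0")
      case False
      have "W u / (b * emeasure \<mu> A) * emeasure \<mu> A = (W u / b) * (emeasure \<mu> A / emeasure \<mu> A)"
        using False \<open>0 < b\<close> by (simp add: divide_ennreal_def ennreal_inverse_mult less_top[symmetric] emeasure_finite mult_ac)
      also have "emeasure \<mu> A / emeasure \<mu> A = 1" using False by (simp add: less_top[symmetric] emeasure_finite)
      finally show ?thesis by simp
    qed simp
    finally show "(\<integral>\<^sup>+x. ?Q u x \<partial>\<mu>) \<le> W u / b" .
  qed
  finally have "(\<integral>\<^sup>+x. G ((x - z) /\<^sub>R h) / \<kappa> x \<partial>\<mu>) * v \<le> (\<integral>\<^sup>+u. W u / b \<partial>lborel)" .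
  also have "(\<integral>\<^sup>+u. W u / b \<partial>lborel) = (\<integral>\<^sup>+u. W u \<partial>lborel) / b"
    by (rule nn_integral_divide) simp
  finally have "(\<integral>\<^sup>+x. G ((x - z) /\<^sub>R h) / \<kappa> x \<partial>\<mu>) * v / v \<le> (\<integral>\<^sup>+u. W u \<partial>lborel) / b / v"
    by (rule divide_right_mono_ennreal)
  also have "(\<integral>\<^sup>+x. G ((x - z) /\<^sub>R h) / \<kappa> x \<partial>\<mu>) * v / v = (\<integral>\<^sup>+x. G ((x - z) /\<^sub>R h) / \<kappa> x \<partial>\<mu>)"
    using v by (simp add: ennreal_mult_divide_eq)
  also have "(\<integral>\<^sup>+u. W u \<partial>lborel) / b / v = (\<integral>\<^sup>+u. W u \<partial>lborel) / (b * v)"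
    using v \<open>0 < b\<close> by (simp add: divide_ennreal_def ennreal_inverse_mult less_top[symmetric] mult_ac)
  finally show ?thesis unfolding v_def \<kappa>_def .
qed

section \<open>Kernel weights relative to a probability distribution\<close>

text \<open>
  The consequences of regularity of a kernel that the analysis uses: the lower bound near the
  origin, on a ball of radius \<open>2\<rho>\<close> so that it covers differences of points of a ball of radius
  \<open>\<rho>\<close>, and a Borel measurable integrable majorant \<open>W\<close> of the kernel on balls of radius \<open>\<rho>\<close>.
\<close>

locale kernel_design = prob_space \<mu> for \<mu> :: "'a::euclidean_space measure" +
  fixes K :: "'a \<Rightarrow> real" and b \<rho> :: real and W :: "'a \<Rightarrow> ennreal"
  assumes sets_\<mu> [measurable_cong]: "sets \<mu> = sets borel"
    and K_meas [measurable]: "K \<in> borel_measurable borel"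
    and K_nonneg: "0 \<le> K u"
    and b_pos: "0 < b" and \<rho>_pos: "0 < \<rho>"
    and K_lower: "norm u \<le> 2 * \<rho> \<Longrightarrow> b \<le> K u"
    and W_meas [measurable]: "W \<in> borel_measurable borel"
    and W_integral: "(\<integral>\<^sup>+u. W u \<partial>lborel) < \<infinity>"
    and K_le_W: "norm (y - u) \<le> \<rho> \<Longrightarrow> ennreal (K y) \<le> W u"
begin

lemma space_\<mu> [simp]: "space \<mu> = UNIV"
  using sets_eq_imp_space_eq[OF sets_\<mu>] by simp

lemma cball_borel [measurable]: "cball (z::'a) r \<in> sets borel"
  by simp

lemma prob_UNIV [simp]: "prob UNIV = 1"
  using prob_space by simp

definition \<kappa> :: "real \<Rightarrow> 'a \<Rightarrow> real"
  where "\<kappa> h x = (\<integral>y. K ((x - y) /\<^sub>R h) \<partial>\<mu>)"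

text \<open>
  Normalizing by the mean \<open>\<kappa>\<close> of the kernel, a deterministic function, makes an average of weights
  linear in the observations. Where \<open>\<kappa>\<close> is \<open>0\<close> the weight is \<open>0\<close> by the convention on
  division; this happens on a null set of \<open>\<mu>\<close> only (\<open>AE_\<kappa>_pos\<close>).
\<close>

definition weight :: "real \<Rightarrow> 'a \<Rightarrow> 'a \<Rightarrow> real"
  where "weight h y x = K ((x - y) /\<^sub>R h) / \<kappa> h x"

definition vol :: ennreal
  where "vol = emeasure lborel (cball (0::'a) \<rho>)"

lemma vol: "vol \<noteq> 0" "vol \<noteq> \<infinity>" "vol \<noteq> \<top>"
  unfolding vol_def using \<rho>_pos emeasure_lborel_cball_finite[of "0::'a" \<rho>]
    unit_ball_vol_pos[of "real DIM('a)"]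
  by (auto simp: emeasure_cball simp del: unit_ball_vol_pos)

definition K_max :: real
  where "K_max = enn2real ((\<integral>\<^sup>+u. W u \<partial>lborel) / vol)"

text \<open>
  The value \<open>K y\<close> is below \<open>W\<close> on a whole ball of volume \<open>vol\<close>.
\<close>

lemma K_le_max: "K y \<le> K_max"
proof -
  have fin: "(\<integral>\<^sup>+u. W u \<partial>lborel) / vol < \<top>"
    using W_integral vol by (simp add: less_top[symmetric] ennreal_divide_eq_top_iff)
  have "ennreal (K y) * vol = (\<integral>\<^sup>+u. ennreal (K y) * indicator (cball y \<rho>) u \<partial>lborel)"
    unfolding vol_def using \<rho>_pos by (subst nn_integral_cmult_indicator) (simp_all add: emeasure_cball)
  also have "\<dots> \<le> (\<integral>\<^sup>+u. W u \<partial>lborel)"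
    by (intro nn_integral_mono) (auto simp: indicator_def dist_norm intro: K_le_W)
  finally have "ennreal (K y) * vol / vol \<le> (\<integral>\<^sup>+u. W u \<partial>lborel) / vol"
    by (rule divide_right_mono_ennreal)
  then have "ennreal (K y) \<le> ennreal K_max"
    unfolding K_max_def using vol fin by (simp add: ennreal_mult_divide_eq)
  then show ?thesis
    by (simp add: K_max_def)
qed

lemma K_max_nonneg: "0 \<le> K_max"
  by (simp add: K_max_def)

lemma abs_K_le: "\<bar>K y\<bar> \<le> K_max"
  using K_le_max[of y] K_nonneg[of y] by simp

lemma integrable_K: "integrable \<mu> (\<lambda>y. K ((x - y) /\<^sub>R h))"
  by (rule integrable_const_bound[where B = K_max]) (use abs_K_le in auto)

lemma \<kappa>_meas [measurable]: "\<kappa> h \<in> borel_measurable borel"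
  unfolding \<kappa>_def by measurable

lemma \<kappa>_nonneg: "0 \<le> \<kappa> h x"
  unfolding \<kappa>_def by (intro Bochner_Integration.integral_nonneg K_nonneg)

lemma nn_integral_K: "(\<integral>\<^sup>+y. ennreal (K ((x - y) /\<^sub>R h)) \<partial>\<mu>) = ennreal (\<kappa> h x)"
  unfolding \<kappa>_def by (intro nn_integral_eq_integral integrable_K) (simp add: K_nonneg)

lemma weight_meas [measurable (raw)]:
  assumes [measurable]: "f \<in> measurable M borel" "g \<in> measurable M borel"
  shows "(\<lambda>w. weight h (f w) (g w)) \<in> borel_measurable M"
  unfolding weight_def by measurable

lemma weight_nonneg: "0 \<le> weight h y x"
  unfolding weight_def by (intro divide_nonneg_nonneg K_nonneg \<kappa>_nonneg)

lemma weight_le_quotient: "ennreal (weight h y x) \<le> ennreal (K ((x - y) /\<^sub>R h)) / ennreal (\<kappa> h x)"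
  using \<kappa>_nonneg[of h x] K_nonneg[of "(x - y) /\<^sub>R h"]
  by (cases "\<kappa> h x = 0") (auto simp: weight_def divide_ennreal)

lemma covering:
  fixes G V :: "'a \<Rightarrow> ennreal"
  assumes "0 < h" "G \<in> borel_measurable borel" "V \<in> borel_measurable borel"
    and "\<And>u y. norm (y - u) \<le> \<rho> \<Longrightarrow> G y \<le> V u"
  shows "(\<integral>\<^sup>+x. G ((x - z) /\<^sub>R h) / ennreal (\<kappa> h x) \<partial>\<mu>) \<le> (\<integral>\<^sup>+u. V u \<partial>lborel) / (ennreal b * vol)"
  using kernel_covering[OF finite_measure_axioms sets_\<mu> assms(1) \<rho>_pos b_pos K_meas K_lower assms(2-4)]
  unfolding nn_integral_K vol_def .

text \<open>
  The bound for the total influence of one observation; it depends neither on \<open>\<mu>\<close>, nor on \<open>h\<close>, nor on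
  the position of the observation.
\<close>

definition cover :: real
  where "cover = enn2real ((\<integral>\<^sup>+u. W u \<partial>lborel) / (ennreal b * vol))"

lemma cover_nonneg: "0 \<le> cover"
  by (simp add: cover_def)

lemma bvol: "ennreal b * vol \<noteq> 0" "ennreal b * vol \<noteq> \<top>"
  using b_pos vol by (auto simp: ennreal_mult_eq_top_iff)

lemma nn_integral_weight: 
  assumes "0 < h"
  shows "(\<integral>\<^sup>+x. ennreal (weight h z x) \<partial>\<mu>) \<le> ennreal cover"
proof -
  have "(\<integral>\<^sup>+x. ennreal (weight h z x) \<partial>\<mu>) \<le> (\<integral>\<^sup>+x. ennreal (K ((x - z) /\<^sub>R h)) / ennreal (\<kappa> h x) \<partial>\<mu>)"
    by (intro nn_integral_mono weight_le_quotient)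
  also have "\<dots> \<le> (\<integral>\<^sup>+u. W u \<partial>lborel) / (ennreal b * vol)"
    by (rule covering[OF assms]) (simp_all add: K_le_W)
  also have "\<dots> = ennreal cover"
    unfolding cover_def using W_integral bvol
    by (subst ennreal_enn2real) (auto simp: less_top[symmetric] ennreal_divide_eq_top_iff)
  finally show ?thesis .
qed

lemma integrable_weight:
  assumes "0 < h"
  shows "integrable \<mu> (weight h z)" "(\<integral>x. weight h z x \<partial>\<mu>) \<le> cover"
proof -
  have m: "weight h z \<in> borel_measurable \<mu>"
    by measurable
  show "integrable \<mu> (weight h z)"
    using nn_integral_weight[OF assms, of z] m
    by (intro integrableI_nonneg) (auto simp: weight_nonneg intro: le_less_trans)
  then show "(\<integral>x. weight h z x \<partial>\<mu>) \<le> cover"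
    using nn_integral_weight[OF assms, of z] cover_nonneg
    by (subst (asm) nn_integral_eq_integral) (auto simp: weight_nonneg)
qed

text \<open>
  The covering inequality with the indicator of a ball of radius \<open>R/h\<close> in place of the kernel: the
  majorant is the indicator of a ball of radius \<open>R/h + \<rho>\<close>, whose volume is of order
  \<open>h\<^bsup>-d\<^esup>\<close>.
\<close>

lemma nn_integral_inverse_\<kappa>:
  assumes "0 < R"
  shows "\<exists>C\<ge>0. \<forall>h. 0 < h \<longrightarrow> h \<le> 1 \<longrightarrow>
    (\<integral>\<^sup>+x. indicator (cball 0 R) x / ennreal (\<kappa> h x) \<partial>\<mu>) \<le> ennreal (C / h ^ DIM('a))"
proof -
  define c where "c = enn2real (ennreal b * vol)"
  have c: "0 < c" "ennreal b * vol = ennreal c"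
    unfolding c_def using bvol by (auto simp: enn2real_positive_iff zero_less_iff_neq_zero less_top)
  define C where "C = unit_ball_vol DIM('a) * (R + \<rho>) ^ DIM('a) / c"
  have "(\<integral>\<^sup>+x. indicator (cball 0 R) x / ennreal (\<kappa> h x) \<partial>\<mu>) \<le> ennreal (C / h ^ DIM('a))"
    if h: "0 < h" "h \<le> 1" for h
  proof -
    let ?G = "indicator (cball 0 (R / h)) :: 'a \<Rightarrow> ennreal"
      and ?V = "indicator (cball 0 (R / h + \<rho>)) :: 'a \<Rightarrow> ennreal"
    have "(\<integral>\<^sup>+x. indicator (cball 0 R) x / ennreal (\<kappa> h x) \<partial>\<mu>)
        = (\<integral>\<^sup>+x. ?G ((x - 0) /\<^sub>R h) / ennreal (\<kappa> h x) \<partial>\<mu>)"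
      using h by (intro nn_integral_cong) (auto simp: indicator_def field_simps)
    also have "\<dots> \<le> (\<integral>\<^sup>+u. ?V u \<partial>lborel) / (ennreal b * vol)"
    proof (rule covering[OF h(1)])
      fix u y :: 'a assume "norm (y - u) \<le> \<rho>"
      then show "?G y \<le> ?V u"
        using norm_triangle_ineq2[of u y] by (auto simp: indicator_def norm_minus_commute)
    qed measurable
    also have "(\<integral>\<^sup>+u. ?V u \<partial>lborel) = ennreal (unit_ball_vol DIM('a) * (R / h + \<rho>) ^ DIM('a))"
      using assms h \<rho>_pos by (simp add: emeasure_cball)
    also have "\<dots> / (ennreal b * vol) = ennreal (unit_ball_vol DIM('a) * (R / h + \<rho>) ^ DIM('a) / c)"
      unfolding c(2) using assms h \<rho>_pos c(1) by (subst divide_ennreal) (auto intro!: mult_nonneg_nonneg)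
    also have "\<dots> \<le> ennreal (C / h ^ DIM('a))"
    proof (rule ennreal_leI)
      have "R / h + \<rho> \<le> (R + \<rho>) / h"
        using h \<rho>_pos by (simp add: field_simps)
      then have "(R / h + \<rho>) ^ DIM('a) \<le> ((R + \<rho>) / h) ^ DIM('a)"
        using assms h \<rho>_pos by (intro power_mono) auto
      then have "unit_ball_vol DIM('a) * (R / h + \<rho>) ^ DIM('a) / c \<le> unit_ball_vol DIM('a) * ((R + \<rho>) / h) ^ DIM('a) / c"
        using c(1) by (intro divide_right_mono mult_left_mono) auto
      then show "unit_ball_vol DIM('a) * (R / h + \<rho>) ^ DIM('a) / c \<le> C / h ^ DIM('a)"
        by (simp add: C_def power_divide mult_ac)
    qed
    finally show ?thesis .
  qed
  moreover have "0 \<le> C" using c assms \<rho>_pos by (simp add: C_def)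
  ultimately show ?thesis by blast
qed

text \<open>
  A finite integral of \<open>1/\<kappa>\<close> over every ball excludes that \<open>\<kappa>\<close> vanishes on a set of positive
  measure.
\<close>

lemma AE_\<kappa>_pos:
  assumes "0 < h" "h \<le> 1"
  shows "AE x in \<mu>. 0 < \<kappa> h x"
proof -
  have "AE x in \<mu>. x \<in> cball 0 (real (Suc n)) \<longrightarrow> 0 < \<kappa> h x" for n
  proof -
    obtain C where C: "\<And>h. 0 < h \<Longrightarrow> h \<le> 1 \<Longrightarrow>
      (\<integral>\<^sup>+x. indicator (cball 0 (real (Suc n))) x / ennreal (\<kappa> h x) \<partial>\<mu>) \<le> ennreal (C / h ^ DIM('a))"
      using nn_integral_inverse_\<kappa>[of "real (Suc n)"] by auto
    have "AE x in \<mu>. (indicator (cball 0 (real (Suc n))) x / ennreal (\<kappa> h x) :: ennreal) \<noteq> \<infinity>"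
      by (rule nn_integral_PInf_AE) (measurable, use C[OF assms] in \<open>auto simp: top_unique\<close>)
    then show ?thesis
    proof eventually_elim
      case (elim x)
      then show ?case
        using \<kappa>_nonneg[of h x] by (cases "\<kappa> h x = 0") (auto simp: ennreal_divide_eq_top_iff indicator_def)
    qed
  qed
  then have "AE x in \<mu>. \<forall>n. x \<in> cball 0 (real (Suc n)) \<longrightarrow> 0 < \<kappa> h x"
    by (subst AE_all_countable) blast
  then show ?thesis
  proof eventually_elim
    case (elim x)
    obtain n where "norm x \<le> real n" using real_arch_simple by blast
    then have "x \<in> cball 0 (real (Suc n))" by simp
    then show ?case using elim by blast
  qed
qed

lemma nn_integral_weight_snd:
  assumes "0 < \<kappa> h x"
  shows "(\<integral>\<^sup>+y. ennreal (weight h y x) \<partial>\<mu>) = 1"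
proof -
  have "(\<integral>\<^sup>+y. ennreal (weight h y x) \<partial>\<mu>) = (\<integral>\<^sup>+y. ennreal (K ((x - y) /\<^sub>R h)) / ennreal (\<kappa> h x) \<partial>\<mu>)"
    using assms by (intro nn_integral_cong) (simp add: weight_def divide_ennreal K_nonneg)
  also have "\<dots> = ennreal (\<kappa> h x) / ennreal (\<kappa> h x)"
    by (subst nn_integral_divide) (auto simp: nn_integral_K)
  finally show ?thesis using assms by simp
qed

text \<open>
  The covering inequality for the kernel restricted to \<open>\<bar>u\<bar> > \<delta>/h\<close>. Its majorant is the
  part of \<open>W\<close> outside a ball of radius \<open>\<delta>/h - \<rho>\<close>, and the integral of that part tends to \<open>0\<close>.
\<close>

lemma weight_concentrates:
  assumes "0 < \<delta>" "0 < \<eta>"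
  shows "\<exists>h\<^sub>0>0. \<forall>h z. 0 < h \<longrightarrow> h < h\<^sub>0 \<longrightarrow>
    (\<integral>\<^sup>+x. indicator {x. \<delta> < norm (x - z)} x * ennreal (weight h z x) \<partial>\<mu>) \<le> ennreal \<eta>"
proof -
  have "(\<lambda>n. \<integral>\<^sup>+u. W u * indicator {u. real n < norm u} u \<partial>lborel) \<longlonglongrightarrow> (\<integral>\<^sup>+(u::'a). 0 \<partial>lborel)"
  proof (rule nn_integral_dominated_convergence[where w = W and u' = "\<lambda>_. 0"])
    show "AE u in lborel. (\<lambda>n. W u * indicator {u. real n < norm u} u) \<longlonglongrightarrow> 0"
    proof (rule AE_I2)
      fix u :: 'a
      obtain m where m: "norm u \<le> real m" using real_arch_simple by blast
      have "eventually (\<lambda>n. W u * indicator {u. real n < norm u} u = 0) sequentially"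
        using eventually_ge_at_top[of m] by eventually_elim (use m in \<open>auto simp: indicator_def\<close>)
      then show "(\<lambda>n. W u * indicator {u. real n < norm u} u) \<longlonglongrightarrow> 0"
        by (rule tendsto_eventually)
    qed
  qed (use W_integral in \<open>auto simp: indicator_def\<close>)
  then have "(\<lambda>n. (\<integral>\<^sup>+u. W u * indicator {u. real n < norm u} u \<partial>lborel)) \<longlonglongrightarrow> 0"
    by simp
  moreover have "0 < ennreal \<eta> * (ennreal b * vol)"
    using assms bvol by (simp add: ennreal_zero_less_mult_iff zero_less_iff_neq_zero)
  ultimately have "eventually (\<lambda>n. (\<integral>\<^sup>+u. W u * indicator {u. real n < norm u} u \<partial>lborel) < ennreal \<eta> * (ennreal b * vol)) sequentially"
    by (rule order_tendstoD(2))
  then obtain n where n: "(\<integral>\<^sup>+u. W u * indicator {u. real n < norm u} u \<partial>lborel) < ennreal \<eta> * (ennreal b * vol)"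
    by (auto simp: eventually_sequentially)
  \<comment> \<open>Chosen such that \<open>\<delta>/h - \<rho> > n\<close> for all \<open>h < h\<^sub>0\<close>.\<close>
  define h\<^sub>0 where "h\<^sub>0 = \<delta> / (real n + \<rho>)"
  have "(\<integral>\<^sup>+x. indicator {x. \<delta> < norm (x - z)} x * ennreal (weight h z x) \<partial>\<mu>) \<le> ennreal \<eta>"
    if h: "0 < h" "h < h\<^sub>0" for h z
  proof -
    let ?G = "\<lambda>u. indicator {u. \<delta> / h < norm u} u * ennreal (K u)"
    have large: "real n + \<rho> < \<delta> / h"
      using h \<rho>_pos unfolding h\<^sub>0_def by (simp add: field_simps)
    have "(\<integral>\<^sup>+x. indicator {x. \<delta> < norm (x - z)} x * ennreal (weight h z x) \<partial>\<mu>)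
        \<le> (\<integral>\<^sup>+x. ?G ((x - z) /\<^sub>R h) / ennreal (\<kappa> h x) \<partial>\<mu>)"
    proof (intro nn_integral_mono)
      fix x
      have scale: "\<delta> / h < norm ((x - z) /\<^sub>R h) \<longleftrightarrow> \<delta> < norm (x - z)"
        using h unfolding norm_scaleR by (simp add: divide_less_cancel inverse_eq_divide)
      show "indicator {x. \<delta> < norm (x - z)} x * ennreal (weight h z x) \<le> ?G ((x - z) /\<^sub>R h) / ennreal (\<kappa> h x)"
        using h weight_le_quotient[of h z x] scale by (auto simp: indicator_def)
    qed
    also have "\<dots> \<le> (\<integral>\<^sup>+u. W u * indicator {u. real n < norm u} u \<partial>lborel) / (ennreal b * vol)"
    proof (rule covering[OF h(1)])
      fix u y :: 'a assume yu: "norm (y - u) \<le> \<rho>"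
      then show "?G y \<le> W u * indicator {u. real n < norm u} u"
        using K_le_W[OF yu] norm_triangle_ineq2[of y u] large by (auto simp: indicator_def)
    qed measurable
    also have "\<dots> \<le> ennreal \<eta> * (ennreal b * vol) / (ennreal b * vol)"
      using n by (intro divide_right_mono_ennreal) simp
    also have "\<dots> = ennreal \<eta>"
      using bvol by (simp add: ennreal_mult_divide_eq)
    finally show ?thesis .
  qed
  moreover have "0 < h\<^sub>0" using assms \<rho>_pos by (simp add: h\<^sub>0_def add_nonneg_pos)
  ultimately show ?thesis by blast
qed

end

section \<open>Regular kernels\<close>

text \<open>
  The supremum over closed balls in the definition of regularity may fail to be Borel measurable. The
  supremum over open balls of the same radius is lower semicontinuous, hence measurable, and
  smaller, so it can serve as the majorant \<open>W\<close>.
\<close>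

lemma regular_kernel_design:
  fixes K :: "'a::euclidean_space \<Rightarrow> real"
  assumes "regular_kernel K" "prob_space \<mu>" "sets \<mu> = sets borel"
  shows "\<exists>b \<rho> W. kernel_design \<mu> K b \<rho> W"
proof -
  interpret prob_space \<mu> by fact
  obtain b r where K [measurable]: "K \<in> borel_measurable borel" "\<And>u. 0 \<le> K u"
    and b: "0 < b" and r: "0 < r" and lower: "\<And>u. K u \<ge> b * indicator (cball 0 r) u"
    and int: "(\<integral>\<^sup>+ u. (SUP y \<in> (+) u ` cball 0 r. ennreal (K y)) \<partial>lborel) < \<infinity>"
    using assms(1) unfolding regular_kernel_def by blast
  define W where "W u = (SUP y\<in>ball u r. ennreal (K y))" for u
  have W_meas: "W \<in> borel_measurable borel"
  proof (rule borel_measurableI_greater)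
    fix t
    have "{u \<in> space borel. t < W u} = (\<Union>y\<in>{y. t < ennreal (K y)}. ball y r)"
      by (auto simp: W_def less_SUP_iff dist_commute)
    moreover have "open (\<Union>y\<in>{y. t < ennreal (K y)}. ball y r)" by blast
    ultimately show "{u \<in> space borel. t < W u} \<in> sets borel" by simp
  qed
  have "(\<integral>\<^sup>+u. W u \<partial>lborel) \<le> (\<integral>\<^sup>+ u. (SUP y \<in> (+) u ` cball 0 r. ennreal (K y)) \<partial>lborel)"
    unfolding W_def
  proof (intro nn_integral_mono SUP_subset_mono)
    fix u :: 'a
    show "ball u r \<subseteq> (+) u ` cball 0 r"
    proof
      fix y assume "y \<in> ball u r"
      then show "y \<in> (+) u ` cball 0 r"
        by (intro image_eqI[of _ _ "y - u"]) (auto simp: dist_norm norm_minus_commute)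
    qed
  qed simp
  then have W_int: "(\<integral>\<^sup>+u. W u \<partial>lborel) < \<infinity>" using int by (rule le_less_trans)
  have "kernel_design \<mu> K b (r / 2) W"
  proof
    fix u :: 'a assume "norm u \<le> 2 * (r / 2)"
    then show "b \<le> K u" using lower[of u] by simp
  next
    fix y u :: 'a assume "norm (y - u) \<le> r / 2"
    then have "y \<in> ball u r" using r by (simp add: dist_norm norm_minus_commute)
    then show "ennreal (K y) \<le> W u" unfolding W_def by (intro SUP_upper)
  qed (use K b r assms(3) W_meas W_int in auto)
  then show ?thesis by blast
qed

section \<open>Approximation of integrable functions\<close>

text \<open>
  The functions \<open>max 0 (1 - n d(x,C))\<close> are Lipschitz continuous and decrease to the indicator of
  \<open>C\<close>. For empty \<open>C\<close> the distance is \<open>0\<close> by convention, and they do not.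
\<close>

lemma indicator_compact_approx:
  fixes \<mu> :: "'a::euclidean_space measure"
  assumes "finite_measure \<mu>" and sets_\<mu> [measurable_cong]: "sets \<mu> = sets borel"
    and C: "compact C" "C \<noteq> {}" and e: "0 < e"
  shows "\<exists>g. uniformly_continuous_on UNIV g \<and> (\<forall>x. \<bar>g x\<bar> \<le> 1) \<and> (\<integral>\<^sup>+x. ennreal \<bar>indicator C x - g x\<bar> \<partial>\<mu>) < ennreal e"
proof -
  interpret finite_measure \<mu> by fact
  have space_\<mu> [simp]: "space \<mu> = UNIV"
    using sets_eq_imp_space_eq[OF sets_\<mu>] by simp
  have "closed C" using C(1) by (rule compact_imp_closed)
  then have C' [measurable]: "C \<in> sets borel" by (rule borel_closed)
  define g where "g n x = max 0 (1 - real n * infdist x C)" for n x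
  have [measurable]: "g n \<in> borel_measurable borel" for n
    unfolding g_def by (intro borel_measurable_continuous_onI continuous_intros)
  have uc: "uniformly_continuous_on UNIV (g n)" for n
    unfolding uniformly_continuous_on_def
  proof (intro allI impI)
    fix d :: real assume d: "0 < d"
    show "\<exists>\<delta>>0. \<forall>x\<in>UNIV. \<forall>x'\<in>UNIV. dist x' x < \<delta> \<longrightarrow> dist (g n x') (g n x) < d"
    proof (intro exI[of _ "d / (real n + 1)"] conjI ballI impI)
      fix x x' :: 'a assume "dist x' x < d / (real n + 1)"
      then have x: "(real n + 1) * dist x' x < d" by (simp add: field_simps)
      have "\<bar>infdist x' C - infdist x C\<bar> \<le> dist x' x" by (rule infdist_triangle_abs)
      then have "real n * \<bar>infdist x' C - infdist x C\<bar> \<le> real n * dist x' x"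
        by (rule mult_left_mono) simp
      also have "\<dots> < d" using x zero_le_dist[of x' x] by (simp only: distrib_right mult_1)
      finally have "\<bar>real n * infdist x' C - real n * infdist x C\<bar> < d"
        by (simp add: right_diff_distrib[symmetric] abs_mult)
      then show "dist (g n x') (g n x) < d"
        unfolding g_def dist_real_def by linarith
    qed (use d in simp)
  qed
  have b: "0 \<le> g n x" "g n x \<le> 1" for n x
    unfolding g_def using infdist_nonneg[of x C] by auto
  have "(\<lambda>n. \<integral>\<^sup>+x. ennreal \<bar>indicator C x - g n x\<bar> \<partial>\<mu>) \<longlonglongrightarrow> (\<integral>\<^sup>+(x::'a). 0 \<partial>\<mu>)"
  proof (rule nn_integral_dominated_convergence[where w = "\<lambda>_. 1" and u' = "\<lambda>_. 0"])
    show "AE x in \<mu>. ennreal \<bar>indicator C x - g n x\<bar> \<le> 1" for n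
      using b[of n] by (intro AE_I2) (auto simp: indicator_def ennreal_le_1)
    show "AE x in \<mu>. (\<lambda>n. ennreal \<bar>indicator C x - g n x\<bar>) \<longlonglongrightarrow> 0"
    proof (rule AE_I2)
      fix x
      show "(\<lambda>n. ennreal \<bar>indicator C x - g n x\<bar>) \<longlonglongrightarrow> 0"
      proof (cases "x \<in> C")
        case True
        then show ?thesis by (simp add: g_def)
      next
        case False
        then have pos: "0 < infdist x C"
          using \<open>closed C\<close> C(2) by (simp add: infdist_pos_not_in_closed)
        obtain m where m: "1 / infdist x C \<le> real m" using real_arch_simple by blast
        have "eventually (\<lambda>n. ennreal \<bar>indicator C x - g n x\<bar> = 0) sequentially"
          using eventually_ge_at_top[of m]
        proof eventually_elim
          case (elim n)
          then have "1 / infdist x C \<le> real n" using m by linarith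
          then have "1 \<le> real n * infdist x C" using pos by (simp add: field_simps)
          then show ?case using False by (simp add: g_def)
        qed
        then show ?thesis by (rule tendsto_eventually)
      qed
    qed
  qed (use emeasure_finite[of UNIV] in \<open>auto simp: less_top[symmetric]\<close>)
  then have "(\<lambda>n. \<integral>\<^sup>+x. ennreal \<bar>indicator C x - g n x\<bar> \<partial>\<mu>) \<longlonglongrightarrow> 0" by simp
  then have "eventually (\<lambda>n. (\<integral>\<^sup>+x. ennreal \<bar>indicator C x - g n x\<bar> \<partial>\<mu>) < ennreal e) sequentially"
    using e by (intro order_tendstoD(2)) auto
  then obtain n where "(\<integral>\<^sup>+x. ennreal \<bar>indicator C x - g n x\<bar> \<partial>\<mu>) < ennreal e"
    by (auto simp: eventually_sequentially)
  then show ?thesis using uc b by (intro exI[of _ "g n"]) (auto simp: abs_of_nonneg)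
qed

text \<open>
  Indicators are approximated by inner regularity from indicators of compact sets; the class of
  approximable functions is closed under addition and under dominated limits.
\<close>

lemma L1_approx_uniformly_continuous:
  fixes \<mu> :: "'a::euclidean_space measure" and f :: "'a \<Rightarrow> real"
  assumes "finite_measure \<mu>" and sets_\<mu> [measurable_cong]: "sets \<mu> = sets borel"
    and "integrable \<mu> f" and e: "0 < e"
  shows "\<exists>g B. uniformly_continuous_on UNIV g \<and> (\<forall>x. \<bar>g x\<bar> \<le> B) \<and> (\<integral>\<^sup>+x. ennreal \<bar>f x - g x\<bar> \<partial>\<mu>) < ennreal e"
proof -
  let ?d = "\<lambda>f g. \<integral>\<^sup>+x. ennreal \<bar>f x - g x\<bar> \<partial>\<mu>"
  interpret finite_measure \<mu> by fact
  have space_\<mu> [simp]: "space \<mu> = UNIV"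
    using sets_eq_imp_space_eq[OF sets_\<mu>] by simp
  have meas: "g \<in> borel_measurable \<mu>" if "uniformly_continuous_on UNIV g" for g :: "'a \<Rightarrow> real"
    using borel_measurable_continuous_onI[OF uniformly_continuous_imp_continuous[OF that]] by measurable
  have tri: "?d f g < ennreal e"
    if "f \<in> borel_measurable \<mu>" "k \<in> borel_measurable \<mu>" "g \<in> borel_measurable \<mu>"
      and "?d f k < ennreal (e / 2)"
      and "?d k g < ennreal (e / 2)" and "0 < e"
    for f k g :: "'a \<Rightarrow> real" and e
  proof -
    note [measurable] = that(1-3)
    have "?d f g \<le> (\<integral>\<^sup>+x. ennreal \<bar>f x - k x\<bar> + ennreal \<bar>k x - g x\<bar> \<partial>\<mu>)"
      by (intro nn_integral_mono) (simp flip: ennreal_plus)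
    also have "\<dots> = ?d f k + ?d k g"
      by (rule nn_integral_add) measurable
    also have "\<dots> < ennreal (e / 2) + ennreal (e / 2)"
      by (rule add_strict_mono) fact+
    also have "\<dots> = ennreal e" using \<open>0 < e\<close> by (simp flip: ennreal_plus)
    finally show ?thesis .
  qed
  define P where "P f \<longleftrightarrow> (\<forall>e>0. \<exists>g B. uniformly_continuous_on UNIV g \<and> (\<forall>x. \<bar>g x\<bar> \<le> B) \<and>
     ?d f g < ennreal e)" for f :: "'a \<Rightarrow> real"
  have "P f"
    using assms(3)
  proof (induction rule: integrable_induct)
    case (base A c)
    have A [measurable]: "A \<in> sets borel" using base sets_\<mu> by simp
    show ?case
      unfolding P_def
    proof (intro allI impI)
      fix e :: real assume e: "0 < e"
      define e' where "e' = e / 2 / (\<bar>c\<bar> + 1)"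
      have e': "0 < e'" using e by (simp add: e'_def)
      have ce': "\<bar>c\<bar> * e' < e / 2" using e by (simp add: e'_def field_simps)
      have cmult: "(\<integral>\<^sup>+x. ennreal \<bar>f x *\<^sub>R c - k x *\<^sub>R c\<bar> \<partial>\<mu>) < ennreal (e / 2)"
        if "f \<in> borel_measurable \<mu>" "k \<in> borel_measurable \<mu>" "?d f k < ennreal e'" for f k :: "'a \<Rightarrow> real"
      proof -
        note [measurable] = that(1,2)
        have "(\<integral>\<^sup>+x. ennreal \<bar>f x *\<^sub>R c - k x *\<^sub>R c\<bar> \<partial>\<mu>) = (\<integral>\<^sup>+x. ennreal \<bar>c\<bar> * ennreal \<bar>f x - k x\<bar> \<partial>\<mu>)"
          by (intro nn_integral_cong) (simp flip: ennreal_mult abs_mult add: algebra_simps)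
        also have "\<dots> = ennreal \<bar>c\<bar> * ?d f k"
          by (rule nn_integral_cmult) measurable
        also have "\<dots> \<le> ennreal \<bar>c\<bar> * ennreal e'"
          using that(3) by (intro mult_left_mono) auto
        also have "\<dots> < ennreal (e / 2)" using ce' e e' by (simp flip: ennreal_mult add: ennreal_lessI)
        finally show ?thesis .
      qed
      have "\<exists>C. compact C \<and> C \<subseteq> A \<and> measure \<mu> A < measure \<mu> C + e'"
      proof (cases "measure \<mu> A = 0")
        case True
        then show ?thesis using e' by (intro exI[of _ "{}"]) simp
      next
        case False
        have SUP: "emeasure \<mu> A = (SUP K \<in> {K. K \<subseteq> A \<and> compact K}. emeasure \<mu> K)"
          by (rule inner_regular) (use sets_\<mu> emeasure_finite A in auto)
        have "0 < measure \<mu> A" using False by (simp add: zero_less_measure_iff)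
        then have "ennreal (measure \<mu> A - e') < emeasure \<mu> A"
          using e' by (simp add: emeasure_eq_measure ennreal_lessI)
        then obtain C where C: "C \<subseteq> A" "compact C" "ennreal (measure \<mu> A - e') < emeasure \<mu> C"
          unfolding SUP by (auto simp: less_SUP_iff)
        have "measure \<mu> A - e' < measure \<mu> C"
          using C(3) unfolding emeasure_eq_measure by (rule contrapos_pp) (simp add: not_less ennreal_leI)
        then show ?thesis using C by (intro exI[of _ C]) simp
      qed
      then obtain C where C: "compact C" "C \<subseteq> A" "measure \<mu> A < measure \<mu> C + e'" by blast
      have C' [measurable]: "C \<in> sets borel" using C(1) by (intro borel_closed compact_imp_closed)
      have AC: "?d (indicator A) (indicator C) < ennreal e'"
      proof -
        have "?d (indicator A) (indicator C) = (\<integral>\<^sup>+x. indicator (A - C) x \<partial>\<mu>)"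
          using C(2) by (intro nn_integral_cong) (auto simp: indicator_def)
        also have "\<dots> = emeasure \<mu> (A - C)" using sets_\<mu> by simp
        also have "\<dots> = ennreal (measure \<mu> A - measure \<mu> C)"
          using C(2) sets_\<mu> by (simp add: emeasure_eq_measure finite_measure_Diff)
        also have "\<dots> < ennreal e'"
          using C(3) e' by (intro ennreal_lessI) auto
        finally show ?thesis .
      qed
      show "\<exists>g B. uniformly_continuous_on UNIV g \<and> (\<forall>x. \<bar>g x\<bar> \<le> B) \<and>
          (\<integral>\<^sup>+x. ennreal \<bar>indicator A x *\<^sub>R c - g x\<bar> \<partial>\<mu>) < ennreal e"
      proof -
        obtain k where k: "uniformly_continuous_on UNIV k" "\<And>x. \<bar>k x\<bar> \<le> 1" 
          "?d (indicator C) k < ennreal e'"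
        proof (cases "C = {}")
          case True
          then show ?thesis using that[of "\<lambda>_. 0"] e' by (simp add: uniformly_continuous_on_const)
        next
          case False
          then show ?thesis using that indicator_compact_approx[OF assms(1) sets_\<mu> C(1) False e'] by blast
        qed
        note [measurable] = meas[OF k(1)]
        show ?thesis
        proof (intro exI[of _ "\<lambda>x. k x *\<^sub>R c"] exI[of _ "\<bar>c\<bar>"] conjI allI)
          have "uniformly_continuous_on UNIV (\<lambda>x. c *\<^sub>R k x)"
            by (rule uniformly_continuous_on_cmul) (rule k)
          then show "uniformly_continuous_on UNIV (\<lambda>x. k x *\<^sub>R c)" by (simp add: mult.commute)
          show "\<bar>k x *\<^sub>R c\<bar> \<le> \<bar>c\<bar>" for x
            using mult_right_mono[OF k(2)[of x], of "\<bar>c\<bar>"] by (simp add: abs_mult)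
          show "(\<integral>\<^sup>+x. ennreal \<bar>indicator A x *\<^sub>R c - k x *\<^sub>R c\<bar> \<partial>\<mu>) < ennreal e"
            by (rule tri[where k = "\<lambda>x. indicator C x *\<^sub>R c"])
              (measurable, use cmult[OF _ _ AC] cmult[OF _ _ k(3)] e in auto)
        qed
      qed
    qed
  next
    case (add f g)
    show ?case
      unfolding P_def
    proof (intro allI impI)
      fix e :: real assume e: "0 < e"
      then have e2: "0 < e / 2" by simp
      obtain f' B where f': "uniformly_continuous_on UNIV f'" "\<And>x. \<bar>f' x\<bar> \<le> B" "?d f f' < ennreal (e / 2)"
        using add.IH(1) e2 unfolding P_def by blast
      obtain g' D where g': "uniformly_continuous_on UNIV g'" "\<And>x. \<bar>g' x\<bar> \<le> D" "?d g g' < ennreal (e / 2)"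
        using add.IH(2) e2 unfolding P_def by blast
      note [measurable] = meas[OF f'(1)] meas[OF g'(1)] borel_measurable_integrable[OF add.hyps(1)] borel_measurable_integrable[OF add.hyps(2)]
      show "\<exists>k B. uniformly_continuous_on UNIV k \<and> (\<forall>x. \<bar>k x\<bar> \<le> B) \<and>
          (\<integral>\<^sup>+x. ennreal \<bar>f x + g x - k x\<bar> \<partial>\<mu>) < ennreal e"
      proof (intro exI[of _ "\<lambda>x. f' x + g' x"] exI[of _ "B + D"] conjI allI)
        show "uniformly_continuous_on UNIV (\<lambda>x. f' x + g' x)"
          by (intro uniformly_continuous_on_add f' g')
        show "\<bar>f' x + g' x\<bar> \<le> B + D" for x using f'(2)[of x] g'(2)[of x] by linarith
        show "(\<integral>\<^sup>+x. ennreal \<bar>f x + g x - (f' x + g' x)\<bar> \<partial>\<mu>) < ennreal e"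
        proof (rule tri[where k = "\<lambda>x. f x + g' x"])
          have "(\<integral>\<^sup>+x. ennreal \<bar>f x + g x - (f x + g' x)\<bar> \<partial>\<mu>) = ?d g g'" by simp
          then show "(\<integral>\<^sup>+x. ennreal \<bar>f x + g x - (f x + g' x)\<bar> \<partial>\<mu>) < ennreal (e / 2)" using g' by simp
          have "(\<integral>\<^sup>+x. ennreal \<bar>f x + g' x - (f' x + g' x)\<bar> \<partial>\<mu>) = ?d f f'" by simp
          then show "(\<integral>\<^sup>+x. ennreal \<bar>f x + g' x - (f' x + g' x)\<bar> \<partial>\<mu>) < ennreal (e / 2)" using f' by simp
        qed (use e in measurable)
      qed
    qed
  next
    case (lim f s)
    note [measurable] = borel_measurable_integrable[OF lim.hyps(1)] borel_measurable_integrable[OF lim.hyps(4)]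
    show ?case
      unfolding P_def
    proof (intro allI impI)
      fix e :: real assume e: "0 < e"
      have "(\<lambda>n. \<integral>\<^sup>+x. norm (f x - s n x) \<partial>\<mu>) \<longlonglongrightarrow> 0"
      proof (rule nn_integral_dominated_convergence_norm[where w = "\<lambda>x. 2 * norm (f x)"])
        have "(\<integral>\<^sup>+x. ennreal (norm (2 * f x)) \<partial>\<mu>) < \<infinity>"
          using integrable_mult_right[OF lim.hyps(4), of 2] by (simp only: integrable_iff_bounded)
        then show "(\<integral>\<^sup>+x. ennreal (2 * norm (f x)) \<partial>\<mu>) < \<infinity>" by (simp add: abs_mult)
      qed (use lim.hyps(2,3) in \<open>auto intro!: AE_I2\<close>)
      then have "eventually (\<lambda>n. (\<integral>\<^sup>+x. norm (f x - s n x) \<partial>\<mu>) < ennreal (e / 2)) sequentially"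
        using e by (intro order_tendstoD(2)) auto
      then obtain n where n: "(\<integral>\<^sup>+x. norm (f x - s n x) \<partial>\<mu>) < ennreal (e / 2)"
        by (auto simp: eventually_sequentially)
      obtain g B where g: "uniformly_continuous_on UNIV g" "\<And>x. \<bar>g x\<bar> \<le> B" "?d (s n) g < ennreal (e / 2)"
        using lim.IH[of n] e unfolding P_def by (meson half_gt_zero)
      note [measurable] = meas[OF g(1)]
      have "?d f g < ennreal e"
        by (rule tri[where k = "s n"]) (use n g e in \<open>simp_all add: real_norm_def\<close>)
      then show "\<exists>g B. uniformly_continuous_on UNIV g \<and> (\<forall>x. \<bar>g x\<bar> \<le> B) \<and> ?d f g < ennreal e"
        using g by blast
    qed
  qed
  then show ?thesis using e unfolding P_def by blast
qed

section \<open>Bias of kernel smoothing\<close>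

context kernel_design
begin

text \<open>
  For a bounded uniformly continuous \<open>g\<close> in place of \<open>f\<close>, near points contribute the modulus of
  continuity and far points little by \<open>weight_concentrates\<close>. Replacing \<open>f\<close> by \<open>g\<close> costs the
  \<open>L\<^sup>1(\<mu>)\<close> distance of the two, once with the factor \<open>1\<close> (weights integrate to \<open>1\<close> in the variable \<open>y\<close>)
  and once with the factor \<open>cover\<close> (they integrate to at most \<open>cover\<close> in the variable \<open>x\<close>).
\<close>

lemma bias_vanishes:
  fixes f :: "'a \<Rightarrow> real"
  assumes [measurable]: "f \<in> borel_measurable borel" and f_bound: "\<And>x. \<bar>f x\<bar> \<le> B" and "0 < \<eta>"
  shows "\<exists>h\<^sub>0>0. \<forall>h. 0 < h \<longrightarrow> h < h\<^sub>0 \<longrightarrow>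
    (\<integral>\<^sup>+x. \<integral>\<^sup>+y. ennreal (\<bar>f x - f y\<bar> * weight h y x) \<partial>\<mu> \<partial>\<mu>) \<le> ennreal \<eta>"
proof -
  interpret pair_sigma_finite \<mu> \<mu> by standard
  define \<eta>' where "\<eta>' = \<eta> / (2 * (2 + cover))"
  have \<eta>': "0 < \<eta>'" using \<open>0 < \<eta>\<close> cover_nonneg by (simp add: \<eta>'_def)
  have "integrable \<mu> f"
    by (rule integrable_const_bound[where B = B]) (use f_bound in auto)
  from L1_approx_uniformly_continuous[OF finite_measure_axioms sets_\<mu> this \<eta>']
  obtain g D where g: "uniformly_continuous_on UNIV g" "\<And>x. \<bar>g x\<bar> \<le> D"
    "(\<integral>\<^sup>+x. ennreal \<bar>f x - g x\<bar> \<partial>\<mu>) < ennreal \<eta>'" by blast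
  have [measurable]: "g \<in> borel_measurable borel"
    using borel_measurable_continuous_onI[OF uniformly_continuous_imp_continuous[OF g(1)]] .
  have D: "0 \<le> D" using g(2)[of 0] by linarith
  obtain \<delta> where \<delta>: "0 < \<delta>" "\<And>x y. dist x y < \<delta> \<Longrightarrow> dist (g x) (g y) < \<eta>'"
    using uniformly_continuous_onE[OF g(1) \<eta>'] by (metis UNIV_I)
  define \<eta>'' where "\<eta>'' = \<eta> / (2 * (2 * D + 1))"
  have \<eta>'': "0 < \<eta>''" using \<open>0 < \<eta>\<close> D by (simp add: \<eta>''_def)
  obtain h\<^sub>0 where h\<^sub>0: "0 < h\<^sub>0" "\<And>h z. 0 < h \<Longrightarrow> h < h\<^sub>0 \<Longrightarrow>
    (\<integral>\<^sup>+x. indicator {x. \<delta> / 2 < norm (x - z)} x * ennreal (weight h z x) \<partial>\<mu>) \<le> ennreal \<eta>''"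
    using weight_concentrates[of "\<delta> / 2" \<eta>''] \<delta>(1) \<eta>'' by auto
  have "(\<integral>\<^sup>+x. \<integral>\<^sup>+y. ennreal (\<bar>f x - f y\<bar> * weight h y x) \<partial>\<mu> \<partial>\<mu>) \<le> ennreal \<eta>"
    if h: "0 < h" "h < min h\<^sub>0 1" for h
  proof -
    let ?w = "\<lambda>y x. ennreal (weight h y x)"
    let ?far = "\<lambda>y x. indicator {x. \<delta> / 2 < norm (x - y)} x :: ennreal"
    have row: "AE x in \<mu>. (\<integral>\<^sup>+y. ?w y x \<partial>\<mu>) = 1"
      using AE_\<kappa>_pos[OF h(1)] h by (auto intro: nn_integral_weight_snd elim: eventually_mono)
    have col: "(\<integral>\<^sup>+x. ?w y x \<partial>\<mu>) \<le> ennreal cover" for y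
      by (rule nn_integral_weight[OF h(1)])
    have pt: "ennreal (\<bar>f x - f y\<bar> * weight h y x) \<le>
        (ennreal \<bar>f x - g x\<bar> + ennreal \<eta>') * ?w y x + (ennreal \<bar>f y - g y\<bar> * ?w y x + ennreal (2 * D) * (?far y x * ?w y x))" for x y
    proof -
      have gg: "\<bar>g x - g y\<bar> \<le> \<eta>' + 2 * D * indicator {x. \<delta> / 2 < norm (x - y)} x"
      proof (cases "\<delta> / 2 < norm (x - y)")
        case True
        then show ?thesis using g(2)[of x] g(2)[of y] \<eta>' by (simp add: abs_le_iff)
      next
        case False
        then have "dist x y < \<delta>" using \<delta>(1) by (simp add: dist_norm)
        then show ?thesis using \<delta>(2)[of x y] False by (simp add: dist_real_def)
      qed
      have "\<bar>f x - f y\<bar> \<le> \<bar>f x - g x\<bar> + \<eta>' + \<bar>f y - g y\<bar> + 2 * D * indicator {x. \<delta> / 2 < norm (x - y)} x"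
        using gg by (simp only: abs_le_iff) linarith
      then have "\<bar>f x - f y\<bar> * weight h y x \<le> (\<bar>f x - g x\<bar> + \<eta>' + \<bar>f y - g y\<bar> + 2 * D * indicator {x. \<delta> / 2 < norm (x - y)} x) * weight h y x"
        by (rule mult_right_mono[OF _ weight_nonneg])
      then have "ennreal (\<bar>f x - f y\<bar> * weight h y x) \<le> ennreal \<dots>"
        by (rule ennreal_leI)
      also have "\<dots> = (ennreal \<bar>f x - g x\<bar> + ennreal \<eta>') * ?w y x + (ennreal \<bar>f y - g y\<bar> * ?w y x + ennreal (2 * D) * (?far y x * ?w y x))"
        using \<eta>' D weight_nonneg[of h y x]
        by (simp add: ennreal_mult ennreal_plus algebra_simps ennreal_indicator[symmetric])
      finally show ?thesis .
    qed
    have "(\<integral>\<^sup>+x. \<integral>\<^sup>+y. ennreal (\<bar>f x - f y\<bar> * weight h y x) \<partial>\<mu> \<partial>\<mu>) \<le>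
      (\<integral>\<^sup>+x. \<integral>\<^sup>+y. (ennreal \<bar>f x - g x\<bar> + ennreal \<eta>') * ?w y x + (ennreal \<bar>f y - g y\<bar> * ?w y x + ennreal (2 * D) * (?far y x * ?w y x)) \<partial>\<mu> \<partial>\<mu>)"
      by (intro nn_integral_mono pt)
    also have "\<dots> = (\<integral>\<^sup>+x. \<integral>\<^sup>+y. (ennreal \<bar>f x - g x\<bar> + ennreal \<eta>') * ?w y x \<partial>\<mu> \<partial>\<mu>) +
      (\<integral>\<^sup>+x. \<integral>\<^sup>+y. ennreal \<bar>f y - g y\<bar> * ?w y x + ennreal (2 * D) * (?far y x * ?w y x) \<partial>\<mu> \<partial>\<mu>)"
      by (simp add: nn_integral_add)
    also have "(\<integral>\<^sup>+x. \<integral>\<^sup>+y. (ennreal \<bar>f x - g x\<bar> + ennreal \<eta>') * ?w y x \<partial>\<mu> \<partial>\<mu>)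
        = (\<integral>\<^sup>+x. (ennreal \<bar>f x - g x\<bar> + ennreal \<eta>') \<partial>\<mu>)"
      using row by (intro nn_integral_cong_AE) (auto simp: nn_integral_cmult elim!: eventually_mono)
    also have "\<dots> = (\<integral>\<^sup>+x. ennreal \<bar>f x - g x\<bar> \<partial>\<mu>) + ennreal \<eta>'"
      by (simp add: nn_integral_add emeasure_space_1[simplified])
    also have "\<dots> \<le> ennreal \<eta>' + ennreal \<eta>'" using g(3) by (intro add_right_mono) simp
    also have "(\<integral>\<^sup>+x. \<integral>\<^sup>+y. ennreal \<bar>f y - g y\<bar> * ?w y x + ennreal (2 * D) * (?far y x * ?w y x) \<partial>\<mu> \<partial>\<mu>)
      = (\<integral>\<^sup>+y. \<integral>\<^sup>+x. ennreal \<bar>f y - g y\<bar> * ?w y x + ennreal (2 * D) * (?far y x * ?w y x) \<partial>\<mu> \<partial>\<mu>)"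
      by (rule Fubini'[symmetric]) measurable
    also have "\<dots> \<le> (\<integral>\<^sup>+y. ennreal \<bar>f y - g y\<bar> * ennreal cover + ennreal (2 * D) * ennreal \<eta>'' \<partial>\<mu>)"
    proof (intro nn_integral_mono)
      fix y
      have "(\<integral>\<^sup>+x. ennreal \<bar>f y - g y\<bar> * ?w y x + ennreal (2 * D) * (?far y x * ?w y x) \<partial>\<mu>)
        = ennreal \<bar>f y - g y\<bar> * (\<integral>\<^sup>+x. ?w y x \<partial>\<mu>) + ennreal (2 * D) * (\<integral>\<^sup>+x. ?far y x * ?w y x \<partial>\<mu>)"
        by (simp add: nn_integral_add nn_integral_cmult)
      also have "\<dots> \<le> ennreal \<bar>f y - g y\<bar> * ennreal cover + ennreal (2 * D) * ennreal \<eta>''"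
        using h by (intro add_mono mult_left_mono col h\<^sub>0(2)) auto
      finally show "(\<integral>\<^sup>+x. ennreal \<bar>f y - g y\<bar> * ?w y x + ennreal (2 * D) * (?far y x * ?w y x) \<partial>\<mu>) \<le> \<dots>" .
    qed
    also have "\<dots> = (\<integral>\<^sup>+y. ennreal \<bar>f y - g y\<bar> \<partial>\<mu>) * ennreal cover + ennreal (2 * D) * ennreal \<eta>''"
      by (simp add: nn_integral_add nn_integral_multc emeasure_space_1[simplified])
    also have "\<dots> \<le> ennreal \<eta>' * ennreal cover + ennreal (2 * D) * ennreal \<eta>''"
      using g(3) by (intro add_right_mono mult_right_mono) auto
    also have "ennreal \<eta>' + ennreal \<eta>' + (ennreal \<eta>' * ennreal cover + ennreal (2 * D) * ennreal \<eta>'')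
      = ennreal (\<eta>' * (2 + cover) + 2 * D * \<eta>'')"
      using \<eta>' \<eta>'' D cover_nonneg by (simp flip: ennreal_mult ennreal_plus add: algebra_simps)
    also have "\<dots> \<le> ennreal \<eta>"
    proof (rule ennreal_leI)
      have "\<eta> / (2 * c) * c = \<eta> / 2" if "c \<noteq> 0" for c
        using that by simp
      from this[of "2 + cover"] have "\<eta>' * (2 + cover) = \<eta> / 2"
        using cover_nonneg by (simp add: \<eta>'_def add_nonneg_eq_0_iff)
      moreover have "(2 * D + 1) * \<eta>'' = \<eta> / 2" using D by (simp add: \<eta>''_def field_simps)
      then have "2 * D * \<eta>'' \<le> \<eta> / 2" using \<eta>'' by (simp add: distrib_right)
      ultimately show "\<eta>' * (2 + cover) + 2 * D * \<eta>'' \<le> \<eta>" by linarith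
    qed
    finally show ?thesis by (simp add: add_left_mono add_right_mono)
  qed
  then show ?thesis using h\<^sub>0(1) by (intro exI[of _ "min h\<^sub>0 1"]) auto
qed

end

section \<open>Exponential bounds for kernel regression\<close>

text \<open>
  The function \<open>f\<close> is a version of \<open>z \<mapsto> E[V | Z = z]\<close>, characterized through integrals against
  bounded test functions rather than through a conditional expectation on a sub-\<open>\<sigma>\<close>-algebra. This form
  passes to image measures without change.
\<close>

definition regression_of :: "'w measure \<Rightarrow> ('w \<Rightarrow> 'a::topological_space) \<Rightarrow> ('w \<Rightarrow> real) \<Rightarrow> ('a \<Rightarrow> real) \<Rightarrow> bool"
  where "regression_of M Z V f \<longleftrightarrow>
    (\<forall>u C. u \<in> borel_measurable borel \<longrightarrow> (\<forall>x. \<bar>u x\<bar> \<le> C) \<longrightarrow>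
      (\<integral>w. V w * u (Z w) \<partial>M) = (\<integral>w. f (Z w) * u (Z w) \<partial>M))"

lemma regression_ofD:
  assumes "regression_of M Z V f" "u \<in> borel_measurable borel" "\<And>x. \<bar>u x\<bar> \<le> C"
  shows "(\<integral>w. V w * u (Z w) \<partial>M) = (\<integral>w. f (Z w) * u (Z w) \<partial>M)"
  using assms unfolding regression_of_def by blast

lemma regression_of_indicator:
  assumes "regression_of M Z V f" "S \<in> sets borel"
  shows "(\<integral>w. V w * indicator S (Z w) \<partial>M) = (\<integral>w. f (Z w) * indicator S (Z w) \<partial>M)"
  using regression_ofD[OF assms(1), of "indicator S" 1] assms(2) by simp

lemma regression_of_cong_AE:
  fixes Z :: "'w \<Rightarrow> 'a::topological_space"
  assumes "regression_of M Z V f" and [measurable]: "Z \<in> borel_measurable M"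
    "V \<in> borel_measurable M" "V' \<in> borel_measurable M" and eq: "AE w in M. V w = V' w"
  shows "regression_of M Z V' f"
  unfolding regression_of_def
proof (intro allI impI)
  fix u :: "'a \<Rightarrow> real" and C assume [measurable]: "u \<in> borel_measurable borel" and u: "\<forall>x. \<bar>u x\<bar> \<le> C"
  have "(\<integral>w. V' w * u (Z w) \<partial>M) = (\<integral>w. V w * u (Z w) \<partial>M)"
    by (rule integral_cong_AE) (measurable, use eq in \<open>auto elim!: eventually_mono\<close>)
  also have "\<dots> = (\<integral>w. f (Z w) * u (Z w) \<partial>M)"
    using u by (intro regression_ofD[OF assms(1)]) auto
  finally show "(\<integral>w. V' w * u (Z w) \<partial>M) = (\<integral>w. f (Z w) * u (Z w) \<partial>M)" .
qed

text \<open>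
  An observation \<open>z\<close> has design point \<open>\<xi> z\<close> and response \<open>\<phi> z\<close>, and \<open>f\<close> is a version of the
  regression function of \<open>\<phi>\<close> on \<open>\<xi>\<close>. The response is a function of an abstract observation, so that
  one sample can be used with several responses.
\<close>

locale regression_design = N: prob_space N + kernel_design "distr N borel \<xi>" K b \<rho> W
  for N :: "'z measure" and \<xi> :: "'z \<Rightarrow> 'a::euclidean_space" and K b \<rho> W +
  fixes \<phi> :: "'z \<Rightarrow> real" and f :: "'a \<Rightarrow> real" and B :: real
  assumes \<xi>_meas [measurable]: "\<xi> \<in> borel_measurable N"
    and \<phi>_meas [measurable]: "\<phi> \<in> borel_measurable N"
    and f_meas [measurable]: "f \<in> borel_measurable borel"
    and \<phi>_bound: "\<bar>\<phi> z\<bar> \<le> B" and f_bound: "\<bar>f x\<bar> \<le> B"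
    and regression: "regression_of N \<xi> \<phi> f"
begin

abbreviation \<mu> :: "'a measure" where "\<mu> \<equiv> distr N borel \<xi>"

abbreviation sample :: "nat \<Rightarrow> (nat \<Rightarrow> 'z) measure" where "sample n \<equiv> PiM {..<n} (\<lambda>_. N)"

text \<open>
  The kernel regression estimate with the denominator replaced by its mean.
\<close>

definition fit :: "real \<Rightarrow> nat \<Rightarrow> (nat \<Rightarrow> 'z) \<Rightarrow> 'a \<Rightarrow> real"
  where "fit h n z x = (\<Sum>i<n. \<phi> (z i) * weight h (\<xi> (z i)) x) / real n"

definition L1_error :: "real \<Rightarrow> nat \<Rightarrow> (nat \<Rightarrow> 'z) \<Rightarrow> real"
  where "L1_error h n z = (\<integral>x. \<bar>fit h n z x - f x\<bar> \<partial>\<mu>)"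

definition mean_fit :: "real \<Rightarrow> 'a \<Rightarrow> real"
  where "mean_fit h x = (\<integral>z. \<phi> z * weight h (\<xi> z) x \<partial>N)"

lemma B_nonneg: "0 \<le> B"
  using f_bound[of 0] by linarith

lemma sample_prob: "prob_space (sample n)"
  by (intro prob_space_PiM N.prob_space_axioms)

lemma fit_meas [measurable]: "(\<lambda>p. fit h n (fst p) (snd p)) \<in> borel_measurable (sample n \<Otimes>\<^sub>M borel)"
  unfolding fit_def by measurable

lemma fit_meas_snd [measurable]: "fit h n z \<in> borel_measurable borel"
  unfolding fit_def by measurable

lemma fit_meas_fst [measurable]: "(\<lambda>z. fit h n z x) \<in> borel_measurable (sample n)"
  unfolding fit_def by measurable

lemma integrable_f: "integrable \<mu> f"
  by (rule integrable_const_bound[where B = B]) (use f_bound in auto)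

lemma integrable_fit: "0 < h \<Longrightarrow> integrable \<mu> (fit h n z)"
  unfolding fit_def
  by (intro integrable_divide_zero Bochner_Integration.integrable_sum integrable_mult_right integrable_weight impI)

lemma integrable_error: "0 < h \<Longrightarrow> integrable \<mu> (\<lambda>x. \<bar>fit h n z x - f x\<bar>)"
  by (intro integrable_abs Bochner_Integration.integrable_diff integrable_fit integrable_f)

lemma L1_error_nonneg: "0 \<le> L1_error h n z"
  unfolding L1_error_def by (intro Bochner_Integration.integral_nonneg) simp

lemma nn_integral_error:
  "0 < h \<Longrightarrow> (\<integral>\<^sup>+x. ennreal \<bar>fit h n z x - f x\<bar> \<partial>\<mu>) = ennreal (L1_error h n z)"
  unfolding L1_error_def by (intro nn_integral_eq_integral integrable_error) auto

lemma L1_error_meas [measurable]: "L1_error h n \<in> borel_measurable (sample n)"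
  unfolding L1_error_def by measurable

lemma abs_fit_le: "\<bar>fit h n z x\<bar> \<le> (\<Sum>i<n. B * weight h (\<xi> (z i)) x) / real n"
proof -
  have "\<bar>fit h n z x\<bar> \<le> (\<Sum>i<n. \<bar>\<phi> (z i) * weight h (\<xi> (z i)) x\<bar>) / real n"
    unfolding fit_def abs_divide by (auto intro!: divide_right_mono)
  also have "\<dots> \<le> (\<Sum>i<n. B * weight h (\<xi> (z i)) x) / real n"
    by (intro divide_right_mono sum_mono)
      (auto simp: abs_mult weight_nonneg intro!: mult_right_mono \<phi>_bound)
  finally show ?thesis .
qed

lemma L1_error_le:
  assumes h: "0 < h"
  shows "L1_error h n z \<le> B * cover + B"
proof (cases "n = 0")
  case True
  have "L1_error h n z = (\<integral>x. \<bar>f x\<bar> \<partial>\<mu>)" by (simp add: L1_error_def fit_def True)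
  also have "\<dots> \<le> (\<integral>x. B \<partial>\<mu>)"
    by (intro integral_mono integrable_abs integrable_f) (auto simp: f_bound)
  also have "\<dots> \<le> B * cover + B" using B_nonneg cover_nonneg by (simp add: prob_space)
  finally show ?thesis .
next
  case False
  have "L1_error h n z \<le> (\<integral>x. (\<Sum>i<n. B * weight h (\<xi> (z i)) x) / real n + B \<partial>\<mu>)"
    unfolding L1_error_def
  proof (intro integral_mono integrable_error h Bochner_Integration.integrable_add integrable_divide_zero
      Bochner_Integration.integrable_sum integrable_mult_right integrable_weight impI)
    fix x
    show "\<bar>fit h n z x - f x\<bar> \<le> (\<Sum>i<n. B * weight h (\<xi> (z i)) x) / real n + B"
      using abs_fit_le[of h n z x] f_bound[of x] by linarith
  qed simp
  also have "\<dots> = (\<Sum>i<n. B * (\<integral>x. weight h (\<xi> (z i)) x \<partial>\<mu>)) / real n + B"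
    using integrable_weight(1)[OF h] by (simp add: prob_space Bochner_Integration.integral_sum)
  also have "\<dots> \<le> (\<Sum>i<n. B * cover) / real n + B"
    using integrable_weight(2)[OF h] B_nonneg by (intro add_right_mono divide_right_mono sum_mono mult_left_mono) auto
  also have "\<dots> = B * cover + B" using False by simp
  finally show ?thesis .
qed

text \<open>
  Only the \<open>i\<close>-th summand changes, and each of its two values has \<open>L\<^sup>1(\<mu>)\<close> norm at most
  \<open>B cover / n\<close>.
\<close>

lemma L1_error_bounded_differences:
  assumes h: "0 < h" and i: "i < n"
  shows "\<bar>L1_error h n (z(i := y)) - L1_error h n z\<bar> \<le> 2 * B * cover / real n"
proof -
  have diff: "fit h n (z(i := y)) x - fit h n z x
      = (\<phi> y * weight h (\<xi> y) x - \<phi> (z i) * weight h (\<xi> (z i)) x) / real n" for x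
  proof -
    have "(\<Sum>j<n. \<phi> ((z(i := y)) j) * weight h (\<xi> ((z(i := y)) j)) x)
        = \<phi> y * weight h (\<xi> y) x + (\<Sum>j\<in>{..<n} - {i}. \<phi> (z j) * weight h (\<xi> (z j)) x)"
      using i by (subst sum.remove[of _ i]) auto
    moreover have "(\<Sum>j<n. \<phi> (z j) * weight h (\<xi> (z j)) x)
        = \<phi> (z i) * weight h (\<xi> (z i)) x + (\<Sum>j\<in>{..<n} - {i}. \<phi> (z j) * weight h (\<xi> (z j)) x)"
      using i by (subst sum.remove[of _ i]) auto
    ultimately show ?thesis unfolding fit_def by (simp add: diff_divide_distrib[symmetric])
  qed
  have "\<bar>L1_error h n (z(i := y)) - L1_error h n z\<bar>
      = \<bar>\<integral>x. \<bar>fit h n (z(i := y)) x - f x\<bar> - \<bar>fit h n z x - f x\<bar> \<partial>\<mu>\<bar>"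
    unfolding L1_error_def
      Bochner_Integration.integral_diff[OF integrable_error[OF h] integrable_error[OF h]] ..
  also have "\<dots> \<le> (\<integral>x. \<bar>\<bar>fit h n (z(i := y)) x - f x\<bar> - \<bar>fit h n z x - f x\<bar>\<bar> \<partial>\<mu>)"
    by (rule integral_abs_bound)
  also have "\<dots> \<le> (\<integral>x. (B * weight h (\<xi> y) x + B * weight h (\<xi> (z i)) x) / real n \<partial>\<mu>)"
  proof (intro integral_mono integrable_abs Bochner_Integration.integrable_diff integrable_fit integrable_f h
      Bochner_Integration.integrable_add integrable_divide_zero integrable_mult_right integrable_weight impI)
    fix x
    have "\<bar>\<bar>fit h n (z(i := y)) x - f x\<bar> - \<bar>fit h n z x - f x\<bar>\<bar> \<le> \<bar>fit h n (z(i := y)) x - fit h n z x\<bar>"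
      by linarith
    also have "\<dots> = \<bar>\<phi> y * weight h (\<xi> y) x - \<phi> (z i) * weight h (\<xi> (z i)) x\<bar> / real n"
      unfolding diff by (simp add: abs_divide)
    also have "\<dots> \<le> (\<bar>\<phi> y * weight h (\<xi> y) x\<bar> + \<bar>\<phi> (z i) * weight h (\<xi> (z i)) x\<bar>) / real n"
      by (intro divide_right_mono) auto
    also have "\<dots> \<le> (B * weight h (\<xi> y) x + B * weight h (\<xi> (z i)) x) / real n"
      by (intro divide_right_mono add_mono)
        (auto simp: abs_mult weight_nonneg intro!: mult_right_mono \<phi>_bound)
    finally show "\<bar>\<bar>fit h n (z(i := y)) x - f x\<bar> - \<bar>fit h n z x - f x\<bar>\<bar> \<le> \<dots>" .
  qed
  also have "\<dots> = (B * (\<integral>x. weight h (\<xi> y) x \<partial>\<mu>) + B * (\<integral>x. weight h (\<xi> (z i)) x \<partial>\<mu>)) / real n"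
    using integrable_weight(1)[OF h] by simp
  also have "\<dots> \<le> (B * cover + B * cover) / real n"
    using integrable_weight(2)[OF h] B_nonneg by (intro divide_right_mono add_mono mult_left_mono) auto
  finally show ?thesis by simp
qed

lemma L1_error_concentration:
  assumes h: "0 < h" and n: "0 < n" and t: "0 < t"
  shows "measure (sample n) {z \<in> space (sample n). t \<le> L1_error h n z - integral\<^sup>L (sample n) (L1_error h n)}
    \<le> exp (- t\<^sup>2 / (2 * (2 * B * cover + 1)\<^sup>2) * real n)"
proof -
  \<comment> \<open>The summand \<open>1\<close> keeps \<open>c\<close> positive if \<open>B cover = 0\<close>.\<close>
  define c where "c = (2 * B * cover + 1) / real n"
  have c0: "0 < 2 * B * cover + 1" using B_nonneg cover_nonneg by (simp add: add_nonneg_pos)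
  have c: "0 < c" using c0 n by (simp add: c_def)
  have "measure (sample n) {z \<in> space (sample n). t \<le> L1_error h n z - integral\<^sup>L (sample n) (L1_error h n)}
      \<le> exp (- t\<^sup>2 / (2 * real (card {..<n}) * c\<^sup>2))"
  proof (rule bounded_differences_inequality[OF N.prob_space_axioms _ _ c t L1_error_meas])
    show "\<bar>L1_error h n z\<bar> \<le> B * cover + B" for z
      using L1_error_nonneg L1_error_le[OF h] by simp
    show "\<bar>L1_error h n (z(i := y)) - L1_error h n z\<bar> \<le> c" if "i \<in> {..<n}" for z i y
      using L1_error_bounded_differences[OF h, of i n z y] that n
      by (simp add: c_def add_divide_distrib) (smt (verit) divide_nonneg_nonneg of_nat_0_le_iff)
  qed (use n in auto)
  also have "- t\<^sup>2 / (2 * real (card {..<n}) * c\<^sup>2) = - t\<^sup>2 / (2 * (2 * B * cover + 1)\<^sup>2) * real n"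
    using n c0 by (simp add: c_def power_divide power2_eq_square)
  finally show ?thesis .
qed

lemma weight_le:
  assumes "0 < \<kappa> h x"
  shows "weight h y x \<le> K_max / \<kappa> h x"
  unfolding weight_def using assms by (intro divide_right_mono K_le_max) auto

lemma mean_fit_eq:
  assumes "0 < \<kappa> h x"
  shows "mean_fit h x = (\<integral>y. f y * weight h y x \<partial>\<mu>)"
proof -
  have [measurable]: "(\<lambda>y. weight h y x) \<in> borel_measurable borel" by measurable
  have "mean_fit h x = (\<integral>z. f (\<xi> z) * weight h (\<xi> z) x \<partial>N)"
    unfolding mean_fit_def
    by (rule regression_ofD[OF regression, where C = "K_max / \<kappa> h x"]) (use weight_le[OF assms] weight_nonneg in auto)
  also have "\<dots> = (\<integral>y. f y * weight h y x \<partial>\<mu>)"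
    by (rule integral_distr[symmetric]) measurable
  finally show ?thesis .
qed

lemma integrable_weight_fst:
  assumes "0 < \<kappa> h x"
  shows "integrable \<mu> (\<lambda>y. weight h y x)" "(\<integral>y. weight h y x \<partial>\<mu>) = 1"
proof -
  show i: "integrable \<mu> (\<lambda>y. weight h y x)"
    by (rule integrable_const_bound[where B = "K_max / \<kappa> h x"])
      (use weight_le[OF assms] weight_nonneg in auto)
  have "ennreal (\<integral>y. weight h y x \<partial>\<mu>) = 1"
    unfolding nn_integral_weight_snd[OF assms, symmetric]
    by (rule nn_integral_eq_integral[symmetric, OF i]) (simp add: weight_nonneg)
  then show "(\<integral>y. weight h y x \<partial>\<mu>) = 1"
    by (metis enn2real_1 enn2real_ennreal integral_nonneg_AE AE_I2 weight_nonneg)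
qed

lemma weight_observation:
  assumes \<kappa>: "0 < \<kappa> h x"
  shows "integrable N (\<lambda>z. weight h (\<xi> z) x)" "(\<integral>z. weight h (\<xi> z) x \<partial>N) = 1"
  using integrable_weight_fst[OF \<kappa>] by (simp_all add: integrable_distr_eq integral_distr)

lemma bias_bound:
  assumes \<kappa>: "0 < \<kappa> h x"
  shows "ennreal \<bar>mean_fit h x - f x\<bar> \<le> (\<integral>\<^sup>+y. ennreal (\<bar>f x - f y\<bar> * weight h y x) \<partial>\<mu>)"
proof -
  note w = integrable_weight_fst[OF \<kappa>]
  have fw: "integrable \<mu> (\<lambda>y. f y * weight h y x)"
  proof (rule Bochner_Integration.integrable_bound[OF integrable_mult_right[OF w(1), of B]])
    show "AE y in \<mu>. norm (f y * weight h y x) \<le> norm (B * weight h y x)"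
      using f_bound B_nonneg by (intro AE_I2) (auto simp: abs_mult weight_nonneg intro!: mult_right_mono)
  qed measurable
  have "mean_fit h x - f x = (\<integral>y. f y * weight h y x \<partial>\<mu>) - f x * (\<integral>y. weight h y x \<partial>\<mu>)"
    using mean_fit_eq[OF \<kappa>] w by simp
  also have "\<dots> = (\<integral>y. (f y - f x) * weight h y x \<partial>\<mu>)"
    using fw w(1) by (simp add: left_diff_distrib)
  finally have "\<bar>mean_fit h x - f x\<bar> = \<bar>\<integral>y. (f y - f x) * weight h y x \<partial>\<mu>\<bar>" by simp
  also have "ennreal \<dots> \<le> (\<integral>\<^sup>+y. norm ((f y - f x) * weight h y x) \<partial>\<mu>)"
    using integral_norm_bound_ennreal[of \<mu> "\<lambda>y. (f y - f x) * weight h y x"] fw w(1)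
    by (simp add: left_diff_distrib)
  also have "\<dots> = (\<integral>\<^sup>+y. ennreal (\<bar>f x - f y\<bar> * weight h y x) \<partial>\<mu>)"
    by (intro nn_integral_cong) (simp add: abs_mult weight_nonneg abs_minus_commute)
  finally show ?thesis .
qed

lemma mean_fit_meas [measurable]: "mean_fit h \<in> borel_measurable borel"
  unfolding mean_fit_def by measurable

text \<open>
  The second moment of one summand is at most \<open>B\<^sup>2\<close> times that of the weight, and the square of
  the weight is at most \<open>K_max / \<kappa>\<close> times the weight, whose mean is \<open>1\<close>.
\<close>

lemma variance_bound:
  assumes \<kappa>: "0 < \<kappa> h x" and n: "0 < n"
  shows "(\<integral>z. (fit h n z x - mean_fit h x)\<^sup>2 \<partial>sample n) \<le> B\<^sup>2 * K_max / (real n * \<kappa> h x)"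
proof -
  interpret S: prob_space "sample n" by (rule sample_prob)
  define D where "D = K_max / \<kappa> h x"
  have D: "0 \<le> D" using \<kappa> K_max_nonneg by (simp add: D_def)
  let ?v = "\<lambda>z. \<phi> z * weight h (\<xi> z) x"
  have wD: "0 \<le> weight h y x" "weight h y x \<le> D" for y
    using weight_le[OF \<kappa>] weight_nonneg by (auto simp: D_def)
  have vb: "\<bar>?v z\<bar> \<le> B * D" for z
    using wD[of "\<xi> z"] \<phi>_bound[of z] B_nonneg by (simp add: abs_mult mult_mono)
  have iv: "integrable N ?v"
    by (rule N.integrable_const_bound[where B = "B * D"]) (use vb in auto)
  have iv2: "integrable N (\<lambda>z. (?v z)\<^sup>2)"
    by (rule N.integrable_const_bound[where B = "(B * D)\<^sup>2"])
      (use vb B_nonneg D in \<open>auto simp: abs_le_square_iff[symmetric] abs_mult\<close>)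
  have "\<bar>mean_fit h x\<bar> \<le> (\<integral>z. \<bar>?v z\<bar> \<partial>N)" unfolding mean_fit_def by (rule integral_abs_bound)
  also have "\<dots> \<le> (\<integral>z. B * D \<partial>N)"
    by (intro integral_mono integrable_abs iv) (use vb in auto)
  finally have Ab: "\<bar>mean_fit h x\<bar> \<le> B * D" by (simp add: N.prob_space)
  have "(\<integral>z. (fit h n z x - mean_fit h x)\<^sup>2 \<partial>sample n) = (\<integral>z. (\<Sum>i<n. ?v (z i) - mean_fit h x)\<^sup>2 / (real n)\<^sup>2 \<partial>sample n)"
  proof (intro Bochner_Integration.integral_cong refl)
    fix z
    have "fit h n z x - mean_fit h x = (\<Sum>i<n. ?v (z i) - mean_fit h x) / real n"
      using n unfolding fit_def by (simp add: sum_subtractf field_simps)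
    then show "(fit h n z x - mean_fit h x)\<^sup>2 = (\<Sum>i<n. ?v (z i) - mean_fit h x)\<^sup>2 / (real n)\<^sup>2"
      by (simp add: power_divide)
  qed
  also have "\<dots> = (\<integral>z. (\<Sum>i<n. ?v (z i) - mean_fit h x)\<^sup>2 \<partial>sample n) / (real n)\<^sup>2" by simp
  also have "(\<integral>z. (\<Sum>i<n. ?v (z i) - mean_fit h x)\<^sup>2 \<partial>sample n) = real (card {..<n}) * (\<integral>z. (?v z - mean_fit h x)\<^sup>2 \<partial>N)"
  proof (rule second_moment_iid_sum[OF N.prob_space_axioms])
    show "\<bar>?v z - mean_fit h x\<bar> \<le> 2 * (B * D)" for z using vb[of z] Ab by linarith
    show "(\<integral>z. ?v z - mean_fit h x \<partial>N) = 0" using iv by (simp add: mean_fit_def N.prob_space)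
  qed (use iv in auto)
  also have "(\<integral>z. (?v z - mean_fit h x)\<^sup>2 \<partial>N) = (\<integral>z. (?v z)\<^sup>2 \<partial>N) - (mean_fit h x)\<^sup>2"
  proof -
    have "(\<integral>z. (?v z - mean_fit h x)\<^sup>2 \<partial>N) = (\<integral>z. (?v z)\<^sup>2 - 2 * mean_fit h x * ?v z + (mean_fit h x)\<^sup>2 \<partial>N)"
      by (intro Bochner_Integration.integral_cong refl) (simp add: power2_diff algebra_simps)
    also have "\<dots> = (\<integral>z. (?v z)\<^sup>2 \<partial>N) - 2 * mean_fit h x * mean_fit h x + (mean_fit h x)\<^sup>2"
      using iv iv2 by (simp add: N.prob_space mean_fit_def)
    finally show ?thesis by (simp add: power2_eq_square)
  qed
  also have "real (card {..<n}) * ((\<integral>z. (?v z)\<^sup>2 \<partial>N) - (mean_fit h x)\<^sup>2) / (real n)\<^sup>2 \<le> real n * (\<integral>z. (?v z)\<^sup>2 \<partial>N) / (real n)\<^sup>2"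
    by (intro divide_right_mono) (simp_all add: right_diff_distrib)
  also have "(\<integral>z. (?v z)\<^sup>2 \<partial>N) \<le> (\<integral>z. B\<^sup>2 * D * weight h (\<xi> z) x \<partial>N)"
  proof (intro integral_mono iv2)
    show "integrable N (\<lambda>z. B\<^sup>2 * D * weight h (\<xi> z) x)"
      by (intro integrable_mult_right weight_observation \<kappa>)
    fix z
    have "(\<phi> z)\<^sup>2 \<le> B\<^sup>2" using \<phi>_bound[of z] B_nonneg by (simp add: abs_le_square_iff[symmetric])
    moreover have "(weight h (\<xi> z) x)\<^sup>2 \<le> D * weight h (\<xi> z) x"
      using wD[of "\<xi> z"] by (simp add: power2_eq_square mult_right_mono)
    ultimately show "(?v z)\<^sup>2 \<le> B\<^sup>2 * D * weight h (\<xi> z) x"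
      using D wD[of "\<xi> z"] by (simp only: power_mult_distrib mult.assoc) (intro mult_mono, auto)
  qed
  also have "\<dots> = B\<^sup>2 * D"
    using weight_observation(2)[OF \<kappa>] by simp
  also have "real n * (B\<^sup>2 * D) / (real n)\<^sup>2 = B\<^sup>2 * K_max / (real n * \<kappa> h x)"
    using n by (simp add: D_def power2_eq_square mult_ac)
  finally show ?thesis using n by (auto simp: divide_right_mono mult_left_mono)
qed

end

context regression_design
begin

lemma integral_sample_component:
  assumes "i < n" and [measurable]: "g \<in> borel_measurable N"
  shows "(\<integral>z. g (z i) \<partial>sample n) = (\<integral>z. (g z :: real) \<partial>N)"
proof -
  interpret product_prob_space "\<lambda>_. N" "{..<n}" by standard
  have "(\<integral>z. g z \<partial>N) = (\<integral>z. g z \<partial>distr (sample n) N (\<lambda>z. z i))"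
    using PiM_component[of i] assms(1) by simp
  also have "\<dots> = (\<integral>z. g (z i) \<partial>sample n)"
    using assms(1) by (intro integral_distr) measurable
  finally show ?thesis ..
qed

text \<open>
  From \<open>\<bar>t\<bar> \<le> s/2 + t\<^sup>2/(2s)\<close>. Compared with Cauchy--Schwarz this bound is linear in \<open>1/\<kappa>\<close>, so it
  can be integrated against \<open>\<mu>\<close> with \<open>nn_integral_inverse_\<kappa>\<close>.
\<close>

lemma mean_deviation_le_variance:
  assumes \<kappa>: "0 < \<kappa> h x" and n: "0 < n" and s: "0 < s"
  shows "(\<integral>\<^sup>+z. ennreal \<bar>fit h n z x - mean_fit h x\<bar> \<partial>sample n)
    \<le> ennreal (s / 2) + ennreal (B\<^sup>2 * K_max / (2 * s * real n)) / ennreal (\<kappa> h x)"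
proof -
  let ?E = "\<integral>\<^sup>+z. ennreal \<bar>fit h n z x - mean_fit h x\<bar> \<partial>sample n"
  interpret S: prob_space "sample n" by (rule sample_prob)
  have T: "\<bar>fit h n z x\<bar> \<le> B * (K_max / \<kappa> h x)" for z
  proof -
    have "\<bar>fit h n z x\<bar> \<le> (\<Sum>i<n. B * weight h (\<xi> (z i)) x) / real n" by (rule abs_fit_le)
    also have "\<dots> \<le> (\<Sum>i<n. B * (K_max / \<kappa> h x)) / real n"
      by (intro divide_right_mono sum_mono mult_left_mono weight_le[OF \<kappa>] B_nonneg) simp
    finally show ?thesis using n by simp
  qed
  have iT2: "integrable (sample n) (\<lambda>z. (fit h n z x - mean_fit h x)\<^sup>2)"
  proof (rule S.integrable_const_bound[where B = "(B * (K_max / \<kappa> h x) + \<bar>mean_fit h x\<bar>)\<^sup>2"])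
    show "AE z in sample n. norm ((fit h n z x - mean_fit h x)\<^sup>2) \<le> (B * (K_max / \<kappa> h x) + \<bar>mean_fit h x\<bar>)\<^sup>2"
    proof (rule AE_I2)
      fix z
      have "\<bar>fit h n z x - mean_fit h x\<bar> \<le> \<bar>B * (K_max / \<kappa> h x) + \<bar>mean_fit h x\<bar>\<bar>" using T[of z] by linarith
      then show "norm ((fit h n z x - mean_fit h x)\<^sup>2) \<le> (B * (K_max / \<kappa> h x) + \<bar>mean_fit h x\<bar>)\<^sup>2"
        by (simp add: abs_le_square_iff[symmetric])
    qed
  qed measurable
  have "(?E) \<le> (\<integral>\<^sup>+z. ennreal (s / 2 + (fit h n z x - mean_fit h x)\<^sup>2 / (2 * s)) \<partial>sample n)"
  proof (intro nn_integral_mono ennreal_leI)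
    fix z
    have "0 \<le> (s - \<bar>fit h n z x - mean_fit h x\<bar>)\<^sup>2" by simp
    then have "2 * s * \<bar>fit h n z x - mean_fit h x\<bar> \<le> s\<^sup>2 + (fit h n z x - mean_fit h x)\<^sup>2" by (simp add: power2_diff)
    then show "\<bar>fit h n z x - mean_fit h x\<bar> \<le> s / 2 + (fit h n z x - mean_fit h x)\<^sup>2 / (2 * s)"
      using s by (simp add: field_simps power2_eq_square)
  qed
  also have "\<dots> = ennreal (\<integral>z. s / 2 + (fit h n z x - mean_fit h x)\<^sup>2 / (2 * s) \<partial>sample n)"
    using s iT2 by (intro nn_integral_eq_integral) auto
  also have "(\<integral>z. s / 2 + (fit h n z x - mean_fit h x)\<^sup>2 / (2 * s) \<partial>sample n)
      = s / 2 + (\<integral>z. (fit h n z x - mean_fit h x)\<^sup>2 \<partial>sample n) / (2 * s)"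
    using iT2 by (simp add: S.prob_space)
  also have "\<dots> \<le> s / 2 + (B\<^sup>2 * K_max / (real n * \<kappa> h x)) / (2 * s)"
    using s by (intro add_left_mono divide_right_mono variance_bound[OF \<kappa> n]) auto
  also have "\<dots> = s / 2 + (B\<^sup>2 * K_max / (2 * s * real n)) / \<kappa> h x"
    by (simp add: mult_ac)
  also have "ennreal \<dots> = ennreal (s / 2) + ennreal (B\<^sup>2 * K_max / (2 * s * real n)) / ennreal (\<kappa> h x)"
    using s \<kappa> K_max_nonneg by (simp add: divide_ennreal flip: ennreal_plus)
  finally show ?thesis by (simp add: ennreal_leI)
qed

text \<open>
  This bound without the factor \<open>1/\<kappa>\<close> serves outside a large ball, where \<open>1/\<kappa>\<close> need
  not be integrable.
\<close>

lemma mean_deviation_le_bound: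
  assumes \<kappa>: "0 < \<kappa> h x" and n: "0 < n"
  shows "(\<integral>\<^sup>+z. ennreal \<bar>fit h n z x - mean_fit h x\<bar> \<partial>sample n) \<le> ennreal (2 * B)"
proof -
  let ?E = "\<integral>\<^sup>+z. ennreal \<bar>fit h n z x - mean_fit h x\<bar> \<partial>sample n"
  interpret S: prob_space "sample n" by (rule sample_prob)
  have wD: "0 \<le> weight h y x" "weight h y x \<le> K_max / \<kappa> h x" for y
    using weight_le[OF \<kappa>] weight_nonneg by auto
  have iwn: "integrable (sample n) (\<lambda>z. weight h (\<xi> (z i)) x)" if "i < n" for i
    by (rule S.integrable_const_bound[where B = "K_max / \<kappa> h x"]) (use wD that in \<open>auto intro!: AE_I2\<close>)
  have "\<bar>mean_fit h x\<bar> \<le> (\<integral>z. \<bar>\<phi> z * weight h (\<xi> z) x\<bar> \<partial>N)" unfolding mean_fit_def by (rule integral_abs_bound)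
  also have "\<dots> \<le> (\<integral>z. B * weight h (\<xi> z) x \<partial>N)"
    by (rule integral_mono_AE') (use weight_observation(1)[OF \<kappa>] wD \<phi>_bound B_nonneg in \<open>auto simp: abs_mult intro!: mult_right_mono AE_I2\<close>)
  finally have A: "\<bar>mean_fit h x\<bar> \<le> B" using weight_observation(2)[OF \<kappa>] by simp
  have "(?E)
      \<le> (\<integral>\<^sup>+z. ennreal ((\<Sum>i<n. B * weight h (\<xi> (z i)) x) / real n + B) \<partial>sample n)"
  proof (intro nn_integral_mono ennreal_leI)
    fix z
    show "\<bar>fit h n z x - mean_fit h x\<bar> \<le> (\<Sum>i<n. B * weight h (\<xi> (z i)) x) / real n + B"
      using abs_fit_le[of h n z x] A by linarith
  qed
  also have "\<dots> = ennreal (\<integral>z. (\<Sum>i<n. B * weight h (\<xi> (z i)) x) / real n + B \<partial>sample n)"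
    using iwn wD B_nonneg
    by (intro nn_integral_eq_integral Bochner_Integration.integrable_add integrable_divide_zero impI
        Bochner_Integration.integrable_sum integrable_mult_right)
      (auto intro!: AE_I2 add_nonneg_nonneg divide_nonneg_nonneg sum_nonneg mult_nonneg_nonneg)
  also have "(\<integral>z. (\<Sum>i<n. B * weight h (\<xi> (z i)) x) / real n + B \<partial>sample n)
      = (\<Sum>i<n. B * (\<integral>z. weight h (\<xi> (z i)) x \<partial>sample n)) / real n + B"
  proof -
    have "integrable (sample n) (\<lambda>z. \<Sum>i<n. B * weight h (\<xi> (z i)) x)"
      by (intro Bochner_Integration.integrable_sum integrable_mult_right iwn) simp
    moreover have "(\<integral>z. (\<Sum>i<n. B * weight h (\<xi> (z i)) x) \<partial>sample n)
        = (\<Sum>i<n. \<integral>z. B * weight h (\<xi> (z i)) x \<partial>sample n)"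
      by (intro Bochner_Integration.integral_sum integrable_mult_right iwn) simp
    ultimately show ?thesis by (simp add: S.prob_space)
  qed
  also have "\<dots> = (\<Sum>i<n. B * 1) / real n + B"
    using integral_sample_component[of _ n "\<lambda>z. weight h (\<xi> z) x"] weight_observation(2)[OF \<kappa>] by simp
  also have "\<dots> = 2 * B" using n by simp
  finally show ?thesis .
qed

lemma stochastic_part:
  assumes h: "0 < h" "h \<le> 1" and n: "0 < n" and s: "0 < s"
  shows "(\<integral>\<^sup>+x. \<integral>\<^sup>+z. ennreal \<bar>fit h n z x - mean_fit h x\<bar> \<partial>sample n \<partial>\<mu>)
    \<le> ennreal (s / 2)
      + ennreal (B\<^sup>2 * K_max / (2 * s * real n)) * (\<integral>\<^sup>+x. indicator (cball 0 R) x / ennreal (\<kappa> h x) \<partial>\<mu>)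
      + ennreal (2 * B) * emeasure \<mu> (- cball 0 R)"
proof -
  let ?E = "\<lambda>x. \<integral>\<^sup>+z. ennreal \<bar>fit h n z x - mean_fit h x\<bar> \<partial>sample n"
  have [measurable]: "- cball (0::'a) R \<in> sets borel" by simp
  let ?c = "ennreal (B\<^sup>2 * K_max / (2 * s * real n))"
  have "(\<integral>\<^sup>+x. ?E x \<partial>\<mu>)
      \<le> (\<integral>\<^sup>+x. ennreal (s / 2) + ?c * (indicator (cball 0 R) x / ennreal (\<kappa> h x)) + ennreal (2 * B) * indicator (- cball 0 R) x \<partial>\<mu>)"
  proof (intro nn_integral_mono_AE)
    show "AE x in \<mu>. (?E x) \<le>
      ennreal (s / 2) + ?c * (indicator (cball 0 R) x / ennreal (\<kappa> h x)) + ennreal (2 * B) * indicator (- cball 0 R) x"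
      using AE_\<kappa>_pos[OF h]
    proof eventually_elim
      case (elim x)
      show ?case
      proof (cases "x \<in> cball 0 R")
        case True
        have "(?E x) \<le> ennreal (s / 2) + ?c / ennreal (\<kappa> h x)"
          by (rule mean_deviation_le_variance[OF elim n s])
        then show ?thesis using True by (simp add: ennreal_times_divide)
      next
        case False
        have "(?E x) \<le> ennreal (2 * B)"
          by (rule mean_deviation_le_bound[OF elim n])
        also have "\<dots> \<le> ennreal (s / 2) + \<dots>" by simp
        finally show ?thesis using False by simp
      qed
    qed
  qed
  also have "\<dots> = (\<integral>\<^sup>+x. ennreal (s / 2) + ?c * (indicator (cball 0 R) x / ennreal (\<kappa> h x)) \<partial>\<mu>) + (\<integral>\<^sup>+x. ennreal (2 * B) * indicator (- cball 0 R) x \<partial>\<mu>)"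
    by (rule nn_integral_add) measurable
  also have "(\<integral>\<^sup>+x. ennreal (s / 2) + ?c * (indicator (cball 0 R) x / ennreal (\<kappa> h x)) \<partial>\<mu>)
      = (\<integral>\<^sup>+x. ennreal (s / 2) \<partial>\<mu>) + (\<integral>\<^sup>+x. ?c * (indicator (cball 0 R) x / ennreal (\<kappa> h x)) \<partial>\<mu>)"
    by (rule nn_integral_add) measurable
  also have "(\<integral>\<^sup>+x. ennreal (s / 2) \<partial>\<mu>) = ennreal (s / 2)"
    using emeasure_space_1 by simp
  also have "(\<integral>\<^sup>+x. ?c * (indicator (cball 0 R) x / ennreal (\<kappa> h x)) \<partial>\<mu>) = ?c * (\<integral>\<^sup>+x. indicator (cball 0 R) x / ennreal (\<kappa> h x) \<partial>\<mu>)"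
    by (rule nn_integral_cmult) measurable
  also have "(\<integral>\<^sup>+x. ennreal (2 * B) * indicator (- cball 0 R) x \<partial>\<mu>) = ennreal (2 * B) * emeasure \<mu> (- cball 0 R)"
    by (rule nn_integral_cmult_indicator) simp
  finally show ?thesis .
qed

lemma mean_error_le:
  assumes h: "0 < h" "h \<le> 1"
  shows "(\<integral>\<^sup>+z. ennreal (L1_error h n z) \<partial>sample n)
    \<le> (\<integral>\<^sup>+x. \<integral>\<^sup>+z. ennreal \<bar>fit h n z x - mean_fit h x\<bar> \<partial>sample n \<partial>\<mu>)
      + (\<integral>\<^sup>+x. \<integral>\<^sup>+y. ennreal (\<bar>f x - f y\<bar> * weight h y x) \<partial>\<mu> \<partial>\<mu>)"
proof -
  interpret S: prob_space "sample n" by (rule sample_prob)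
  interpret pair_sigma_finite "sample n" \<mu> by standard
  have "(\<integral>\<^sup>+z. ennreal (L1_error h n z) \<partial>sample n) = (\<integral>\<^sup>+z. \<integral>\<^sup>+x. ennreal \<bar>fit h n z x - f x\<bar> \<partial>\<mu> \<partial>sample n)"
    using nn_integral_error[OF h(1)] by simp
  also have "\<dots> \<le> (\<integral>\<^sup>+z. (\<integral>\<^sup>+x. ennreal \<bar>fit h n z x - mean_fit h x\<bar> \<partial>\<mu>) + (\<integral>\<^sup>+x. ennreal \<bar>mean_fit h x - f x\<bar> \<partial>\<mu>) \<partial>sample n)"
  proof (intro nn_integral_mono)
    fix z
    have "(\<integral>\<^sup>+x. ennreal \<bar>fit h n z x - f x\<bar> \<partial>\<mu>) \<le> (\<integral>\<^sup>+x. ennreal \<bar>fit h n z x - mean_fit h x\<bar> + ennreal \<bar>mean_fit h x - f x\<bar> \<partial>\<mu>)"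
      by (intro nn_integral_mono) (simp flip: ennreal_plus)
    also have "\<dots> = (\<integral>\<^sup>+x. ennreal \<bar>fit h n z x - mean_fit h x\<bar> \<partial>\<mu>) + (\<integral>\<^sup>+x. ennreal \<bar>mean_fit h x - f x\<bar> \<partial>\<mu>)"
      by (rule nn_integral_add) measurable
    finally show "(\<integral>\<^sup>+x. ennreal \<bar>fit h n z x - f x\<bar> \<partial>\<mu>) \<le> \<dots>" .
  qed
  also have "\<dots> = (\<integral>\<^sup>+z. \<integral>\<^sup>+x. ennreal \<bar>fit h n z x - mean_fit h x\<bar> \<partial>\<mu> \<partial>sample n) + (\<integral>\<^sup>+x. ennreal \<bar>mean_fit h x - f x\<bar> \<partial>\<mu>)"
    by (subst nn_integral_add) (measurable, simp add: S.emeasure_space_1)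
  also have "(\<integral>\<^sup>+z. \<integral>\<^sup>+x. ennreal \<bar>fit h n z x - mean_fit h x\<bar> \<partial>\<mu> \<partial>sample n)
      = (\<integral>\<^sup>+x. \<integral>\<^sup>+z. ennreal \<bar>fit h n z x - mean_fit h x\<bar> \<partial>sample n \<partial>\<mu>)"
    by (rule Fubini'[symmetric]) measurable
  also have "(\<integral>\<^sup>+x. ennreal \<bar>mean_fit h x - f x\<bar> \<partial>\<mu>) \<le> (\<integral>\<^sup>+x. \<integral>\<^sup>+y. ennreal (\<bar>f x - f y\<bar> * weight h y x) \<partial>\<mu> \<partial>\<mu>)"
    by (intro nn_integral_mono_AE eventually_mono[OF AE_\<kappa>_pos[OF h]] bias_bound)
  finally show ?thesis by (simp add: add_left_mono)
qed

lemma tail_vanishes: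
  assumes "0 < \<eta>"
  shows "\<exists>R>0. emeasure \<mu> (- cball 0 R) \<le> ennreal \<eta>"
proof -
  have "(\<lambda>n. measure \<mu> (- cball 0 (real n))) \<longlonglongrightarrow> measure \<mu> (\<Inter>n. - cball 0 (real n))"
    by (intro finite_Lim_measure_decseq) (auto simp: decseq_def)
  moreover have "(\<Inter>n. - cball 0 (real n)) = ({} :: 'a set)"
    using real_arch_simple by (fastforce simp: not_le[symmetric])
  ultimately have "(\<lambda>n. measure \<mu> (- cball 0 (real n))) \<longlonglongrightarrow> 0" by simp
  then have "eventually (\<lambda>n. measure \<mu> (- cball 0 (real n)) < \<eta> \<and> 0 < n) sequentially"
    by (intro eventually_conj order_tendstoD(2)[OF _ assms] eventually_gt_at_top)
  then obtain n where "measure \<mu> (- cball 0 (real n)) < \<eta>" "0 < n"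
    by (auto simp: eventually_sequentially)
  then show ?thesis
    by (intro exI[of _ "real n"]) (simp add: emeasure_eq_measure ennreal_leI)
qed

lemma mean_error_vanishes:
  assumes h_pos: "\<And>n. 0 < h n" and h0: "h \<longlonglongrightarrow> 0"
    and nh: "filterlim (\<lambda>n. real n * h n ^ DIM('a)) at_top sequentially"
    and \<eta>: "0 < \<eta>"
  shows "\<forall>\<^sub>F n in sequentially. integral\<^sup>L (sample n) (L1_error (h n) n) \<le> \<eta>"
proof -
  \<comment> \<open>Four contributions of at most \<open>\<eta>/4\<close> each: \<open>s/2\<close>, the variance term, the complement of the
    ball of radius \<open>R\<close>, and the bias.\<close>
  define s where "s = \<eta> / 2"
  have s: "0 < s" using \<eta> by (simp add: s_def)
  obtain R where R: "0 < R" "emeasure \<mu> (- cball 0 R) \<le> ennreal (\<eta> / 4 / (2 * B + 1))"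
    using tail_vanishes[of "\<eta> / 4 / (2 * B + 1)"] \<eta> B_nonneg by auto
  obtain C where C: "0 \<le> C" "\<And>h. 0 < h \<Longrightarrow> h \<le> 1 \<Longrightarrow>
      (\<integral>\<^sup>+x. indicator (cball 0 R) x / ennreal (\<kappa> h x) \<partial>\<mu>) \<le> ennreal (C / h ^ DIM('a))"
    using nn_integral_inverse_\<kappa>[OF R(1)] by auto
  obtain h\<^sub>0 where h\<^sub>0: "0 < h\<^sub>0" "\<And>h. 0 < h \<Longrightarrow> h < h\<^sub>0 \<Longrightarrow>
      (\<integral>\<^sup>+x. \<integral>\<^sup>+y. ennreal (\<bar>f x - f y\<bar> * weight h y x) \<partial>\<mu> \<partial>\<mu>) \<le> ennreal (\<eta> / 4)"
    using bias_vanishes[OF f_meas f_bound, of "\<eta> / 4"] \<eta> by auto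
  define c where "c = B\<^sup>2 * K_max / (2 * s) * C"
  have c: "0 \<le> c" using s K_max_nonneg C by (simp add: c_def)
  have "\<forall>\<^sub>F n in sequentially. h n < min h\<^sub>0 1"
    by (rule order_tendstoD(2)[OF h0]) (use h\<^sub>0 in simp)
  moreover have "\<forall>\<^sub>F n in sequentially. 4 * c / \<eta> \<le> real n * h n ^ DIM('a)"
    using nh unfolding filterlim_at_top by blast
  ultimately show ?thesis
    using eventually_gt_at_top[of 0]
  proof eventually_elim
    case (elim n)
    interpret S: prob_space "sample n" by (rule sample_prob)
    have h: "0 < h n" "h n \<le> 1" "h n < h\<^sub>0" using elim h_pos by auto
    have d: "0 < real n * h n ^ DIM('a)" using h elim by simp
    have "ennreal (integral\<^sup>L (sample n) (L1_error (h n) n)) = (\<integral>\<^sup>+z. ennreal (L1_error (h n) n z) \<partial>sample n)"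
    proof (rule nn_integral_eq_integral[symmetric])
      show "integrable (sample n) (L1_error (h n) n)"
        by (rule S.integrable_const_bound[where B = "B * cover + B"])
          (use L1_error_nonneg L1_error_le[OF h(1)] in auto)
    qed (simp add: L1_error_nonneg)
    also have "\<dots> \<le> (\<integral>\<^sup>+x. \<integral>\<^sup>+z. ennreal \<bar>fit (h n) n z x - mean_fit (h n) x\<bar> \<partial>sample n \<partial>\<mu>)
      + (\<integral>\<^sup>+x. \<integral>\<^sup>+y. ennreal (\<bar>f x - f y\<bar> * weight (h n) y x) \<partial>\<mu> \<partial>\<mu>)"
      by (rule mean_error_le[OF h(1,2)])
    also have "\<dots> \<le> (ennreal (s / 2)
      + ennreal (B\<^sup>2 * K_max / (2 * s * real n)) * (\<integral>\<^sup>+x. indicator (cball 0 R) x / ennreal (\<kappa> (h n) x) \<partial>\<mu>)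
      + ennreal (2 * B) * emeasure \<mu> (- cball 0 R)) + ennreal (\<eta> / 4)"
      by (intro add_mono stochastic_part h\<^sub>0(2)) (use h elim s in auto)
    also have "\<dots> \<le> (ennreal (s / 2)
      + ennreal (B\<^sup>2 * K_max / (2 * s * real n)) * ennreal (C / h n ^ DIM('a))
      + ennreal (2 * B) * ennreal (\<eta> / 4 / (2 * B + 1))) + ennreal (\<eta> / 4)"
      by (intro add_mono mult_left_mono C(2) R(2) h order_refl) auto
    also have "\<dots> = ennreal (s / 2 + (B\<^sup>2 * K_max / (2 * s * real n)) * (C / h n ^ DIM('a))
      + 2 * B * (\<eta> / 4 / (2 * B + 1)) + \<eta> / 4)"
    proof -
      have "ennreal a + ennreal t * ennreal r + ennreal q * ennreal v + ennreal w = ennreal (a + t * r + q * v + w)"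
        if "0 \<le> a" "0 \<le> t" "0 \<le> r" "0 \<le> q" "0 \<le> v" "0 \<le> w" for a t r q v w
        using that by (simp add: ennreal_mult ennreal_plus)
      then show ?thesis using s K_max_nonneg C(1) h B_nonneg \<eta> by simp
    qed
    also have "\<dots> \<le> ennreal \<eta>"
    proof (rule ennreal_leI)
      have "(B\<^sup>2 * K_max / (2 * s * real n)) * (C / h n ^ DIM('a)) = c / (real n * h n ^ DIM('a))"
        by (simp add: c_def)
      also have "\<dots> \<le> \<eta> / 4"
        using elim(2) d \<eta> by (simp add: field_simps)
      finally have 1: "(B\<^sup>2 * K_max / (2 * s * real n)) * (C / h n ^ DIM('a)) \<le> \<eta> / 4" .
      have "2 * B * (\<eta> / 4 / (2 * B + 1)) \<le> \<eta> / 4"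
        using B_nonneg \<eta> by (simp add: field_simps)
      moreover have "s / 2 = \<eta> / 4" by (simp add: s_def)
      ultimately show "s / 2 + (B\<^sup>2 * K_max / (2 * s * real n)) * (C / h n ^ DIM('a))
        + 2 * B * (\<eta> / 4 / (2 * B + 1)) + \<eta> / 4 \<le> \<eta>"
        using 1 by linarith
    qed
    finally show "integral\<^sup>L (sample n) (L1_error (h n) n) \<le> \<eta>"
      using \<eta> by simp
  qed
qed

text \<open>
  The mean error is eventually below \<open>\<epsilon>/2\<close>, so an error of at least \<open>\<epsilon>\<close> is a deviation of at
  least \<open>\<epsilon>/2\<close> from the mean.
\<close>

theorem L1_error_exponential_bound:
  assumes h_pos: "\<And>n. 0 < h n" and h0: "h \<longlonglongrightarrow> 0"
    and nh: "filterlim (\<lambda>n. real n * h n ^ DIM('a)) at_top sequentially"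
    and \<epsilon>: "0 < \<epsilon>"
  shows "\<exists>c>0. \<forall>\<^sub>F n in sequentially.
    measure (sample n) {z \<in> space (sample n). \<epsilon> \<le> L1_error (h n) n z} \<le> exp (- c * real n)"
proof -
  define c where "c = (\<epsilon> / 2)\<^sup>2 / (2 * (2 * B * cover + 1)\<^sup>2)"
  have "0 < 2 * B * cover + 1" using B_nonneg cover_nonneg by (simp add: add_nonneg_pos)
  then have c: "0 < c" using \<epsilon> by (simp add: c_def)
  have "\<forall>\<^sub>F n in sequentially. integral\<^sup>L (sample n) (L1_error (h n) n) \<le> \<epsilon> / 2"
    using mean_error_vanishes[OF h_pos h0 nh, of "\<epsilon> / 2"] \<epsilon> by simp
  then have "\<forall>\<^sub>F n in sequentially.
    measure (sample n) {z \<in> space (sample n). \<epsilon> \<le> L1_error (h n) n z} \<le> exp (- c * real n)"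
    using eventually_gt_at_top[of 0]
  proof eventually_elim
    case (elim n)
    interpret S: prob_space "sample n" by (rule sample_prob)
    have "measure (sample n) {z \<in> space (sample n). \<epsilon> \<le> L1_error (h n) n z}
        \<le> measure (sample n) {z \<in> space (sample n). \<epsilon> / 2 \<le> L1_error (h n) n z - integral\<^sup>L (sample n) (L1_error (h n) n)}"
      by (intro S.finite_measure_mono) (use elim in auto)
    also have "\<dots> \<le> exp (- (\<epsilon> / 2)\<^sup>2 / (2 * (2 * B * cover + 1)\<^sup>2) * real n)"
      by (rule L1_error_concentration) (use h_pos elim \<epsilon> in auto)
    finally show ?case by (simp add: c_def)
  qed
  then show ?thesis using c by blast
qed

end

lemma (in prob_space) iid_sample_distr:
  assumes indep: "indep_vars (\<lambda>_. borel) Zs UNIV"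
    and same: "\<And>i. distr M borel (Zs i) = N" and n: "0 < n"
  shows "(\<lambda>w. \<lambda>i\<in>{..<n::nat}. Zs i w) \<in> measurable M (PiM {..<n} (\<lambda>_. N))"
    "distr M (PiM {..<n} (\<lambda>_. N)) (\<lambda>w. \<lambda>i\<in>{..<n}. Zs i w) = PiM {..<n} (\<lambda>_. N)"
proof -
  have rv: "random_variable borel (Zs i)" for i
    using indep by (simp add: indep_vars_def)
  have sets_N: "sets N = sets borel" using same[of 0] by auto
  have PiM_eq: "sets (PiM {..<n} (\<lambda>_. N)) = sets (PiM {..<n} (\<lambda>_. borel))"
    by (intro sets_PiM_cong) (simp_all add: sets_N)
  have "(\<lambda>w. \<lambda>i\<in>{..<n}. Zs i w) \<in> measurable M (PiM {..<n} (\<lambda>_. borel))"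
    by (rule measurable_restrict) (rule rv)
  then show "(\<lambda>w. \<lambda>i\<in>{..<n}. Zs i w) \<in> measurable M (PiM {..<n} (\<lambda>_. N))"
    by (simp cong: measurable_cong_sets add: measurable_cong_sets[OF refl PiM_eq])
  have "indep_vars (\<lambda>_. borel) Zs {..<n}" by (rule indep_vars_subset[OF indep]) simp
  then have "distr M (PiM {..<n} (\<lambda>_. borel)) (\<lambda>w. \<lambda>i\<in>{..<n}. Zs i w) = PiM {..<n} (\<lambda>i. distr M borel (Zs i))"
    using n by (subst (asm) indep_vars_iff_distr_eq_PiM) (auto simp: rv)
  then show "distr M (PiM {..<n} (\<lambda>_. N)) (\<lambda>w. \<lambda>i\<in>{..<n}. Zs i w) = PiM {..<n} (\<lambda>_. N)"
    unfolding same by (metis distr_cong PiM_eq)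
qed

text \<open>
  The exponential bound carried over from the product measure to the probability space on which the
  observations are defined.
\<close>

lemma (in prob_space) iid_L1_error_exponential_bound:
  fixes \<xi> :: "'z::topological_space \<Rightarrow> 'b::euclidean_space" and h :: "nat \<Rightarrow> real"
  assumes indep: "indep_vars (\<lambda>_. borel) Zs UNIV" and same: "\<And>i. distr M borel (Zs i) = N"
    and design: "regression_design N \<xi> K b \<rho> W \<phi> f B"
    and h: "\<And>n. 0 < h n" "h \<longlonglongrightarrow> 0" "filterlim (\<lambda>n. real n * h n ^ DIM('b)) at_top sequentially"
    and e: "0 < e"
  defines "bad \<equiv> \<lambda>n. {w \<in> space M. e \<le> regression_design.L1_error N \<xi> K \<phi> f (h n) n (\<lambda>i\<in>{..<n}. Zs i w)}"
  shows "\<exists>c>0. \<forall>\<^sub>F n in sequentially. bad n \<in> sets M \<and> measure M (bad n) \<le> exp (- c * real n)"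
proof -
  interpret R: regression_design N \<xi> K b \<rho> W \<phi> f B by (rule design)
  obtain c where "0 < c" and c: "\<forall>\<^sub>F n in sequentially.
      measure (R.sample n) {z \<in> space (R.sample n). e \<le> R.L1_error (h n) n z} \<le> exp (- c * real n)"
    using R.L1_error_exponential_bound[OF h e] by blast
  from c eventually_gt_at_top[of 0]
  have "\<forall>\<^sub>F n in sequentially. bad n \<in> sets M \<and> measure M (bad n) \<le> exp (- c * real n)"
  proof eventually_elim
    case (elim n)
    let ?Z = "\<lambda>w. \<lambda>i\<in>{..<n}. Zs i w"
    note [measurable] = iid_sample_distr(1)[OF indep same elim(2)]
    have bad: "bad n = ?Z -` {z \<in> space (R.sample n). e \<le> R.L1_error (h n) n z} \<inter> space M"
      using measurable_space[OF iid_sample_distr(1)[OF indep same elim(2)]] by (auto simp: bad_def)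
    have "measure M (bad n)
        = measure (distr M (R.sample n) ?Z) {z \<in> space (R.sample n). e \<le> R.L1_error (h n) n z}"
      unfolding bad by (rule measure_distr[symmetric]) measurable
    then show ?case
      using elim(1) unfolding iid_sample_distr(2)[OF indep same elim(2)] by (simp add: bad_def)
  qed
  then show ?thesis using \<open>0 < c\<close> by blast
qed

section \<open>Conditional expectations as regression functions\<close>

text \<open>
  After adding \<open>B\<close> to make the response nonnegative, its integrals over the sets \<open>\<xi> \<in> S\<close> form a
  measure in \<open>S\<close> that is absolutely continuous with respect to the distribution of \<open>\<xi>\<close>; the
  regression function is the Radon--Nikodym density minus \<open>B\<close>. The density lies in \<open>[0,2B]\<close>
  almost everywhere only, so it is clipped to make the bound hold at every point.
\<close>

lemma regression_function_exists:
  fixes N :: "'z measure" and \<xi> :: "'z \<Rightarrow> 'a::euclidean_space" and \<phi> :: "'z \<Rightarrow> real"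
  assumes "prob_space N" and [measurable]: "\<xi> \<in> borel_measurable N" "\<phi> \<in> borel_measurable N"
    and \<phi>_bound: "\<And>z. \<bar>\<phi> z\<bar> \<le> B"
  shows "\<exists>f\<in>borel_measurable borel. (\<forall>x. \<bar>f x\<bar> \<le> B) \<and> regression_of N \<xi> \<phi> f"
proof -
  interpret N: prob_space N by fact
  define \<mu> where "\<mu> = distr N borel \<xi>"
  interpret \<mu>: prob_space \<mu> unfolding \<mu>_def by (rule N.prob_space_distr) measurable
  have [measurable_cong]: "sets \<mu> = sets borel" by (simp add: \<mu>_def)
  have space_\<mu> [simp]: "space \<mu> = UNIV" by (simp add: \<mu>_def)
  have B: "0 \<le> B" using \<phi>_bound[of undefined] by linarith
  have pos: "0 \<le> \<phi> z + B" "\<phi> z + B \<le> 2 * B" for z using \<phi>_bound[of z] by (auto simp: abs_le_iff)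
  define \<nu> where "\<nu> = distr (density N (\<lambda>z. ennreal (\<phi> z + B))) borel \<xi>"
  have ac: "absolutely_continuous \<mu> \<nu>"
    unfolding absolutely_continuous_def
  proof
    fix S assume "S \<in> null_sets \<mu>"
    then have S: "S \<in> sets borel" "emeasure N (\<xi> -` S \<inter> space N) = 0"
      by (auto simp: null_sets_def \<mu>_def emeasure_distr)
    then have "AE z in N. \<xi> z \<notin> S"
      by (intro AE_I[where N = "\<xi> -` S \<inter> space N"]) auto
    then have "emeasure \<nu> S = 0"
      using S(1) by (subst \<nu>_def, subst emeasure_distr)
        (auto simp: emeasure_density nn_integral_0_iff_AE intro!: measurable_sets[of \<xi> N borel] elim!: eventually_mono)
    then show "S \<in> null_sets \<nu>" using S(1) by (auto simp: null_sets_def \<nu>_def)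
  qed
  obtain d where d [measurable]: "d \<in> borel_measurable \<mu>" and d_eq: "density \<mu> d = \<nu>"
    using \<mu>.Radon_Nikodym[OF ac] by (auto simp: \<nu>_def \<mu>_def)
  define g where "g x = enn2real (d x)" for x
  have [measurable]: "g \<in> borel_measurable borel" unfolding g_def by measurable
  have total: "(\<integral>\<^sup>+x. d x \<partial>\<mu>) < \<infinity>"
  proof -
    have "(\<integral>\<^sup>+x. d x \<partial>\<mu>) = emeasure \<nu> UNIV"
      unfolding d_eq[symmetric] by (simp add: emeasure_density)
    also have "\<dots> = (\<integral>\<^sup>+z. ennreal (\<phi> z + B) \<partial>N)"
      by (simp add: \<nu>_def emeasure_distr emeasure_density nn_integral_set_ennreal) 
    also have "\<dots> \<le> (\<integral>\<^sup>+z. ennreal (2 * B) \<partial>N)" using pos by (intro nn_integral_mono ennreal_leI) auto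
    also have "\<dots> < \<infinity>" by (simp add: N.emeasure_space_1)
    finally show ?thesis .
  qed
  have dg: "AE x in \<mu>. d x = ennreal (g x)"
    using nn_integral_PInf_AE[OF d] total by (auto simp: g_def less_top elim!: eventually_mono)
  have dens: "density \<mu> (\<lambda>x. ennreal (g x)) = \<nu>"
    unfolding d_eq[symmetric] by (rule density_cong[symmetric]) (use dg in auto)
  have E: "(\<integral>x. g x * u x \<partial>\<mu>) = (\<integral>z. (\<phi> z + B) * u (\<xi> z) \<partial>N)" if [measurable]: "u \<in> borel_measurable borel" for u :: "'a \<Rightarrow> real"
  proof -
    have "(\<integral>x. g x * u x \<partial>\<mu>) = (\<integral>x. u x \<partial>\<nu>)"
      unfolding dens[symmetric] by (subst integral_density) (auto simp: g_def)
    also have "\<dots> = (\<integral>z. u (\<xi> z) \<partial>density N (\<lambda>z. ennreal (\<phi> z + B)))"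
      unfolding \<nu>_def by (rule integral_distr) auto
    also have "\<dots> = (\<integral>z. (\<phi> z + B) * u (\<xi> z) \<partial>N)"
      by (subst integral_density) (auto simp: pos)
    finally show ?thesis .
  qed
  have g_int: "integrable \<mu> g"
  proof (rule integrableI_nonneg)
    have "(\<integral>\<^sup>+x. ennreal (g x) \<partial>\<mu>) = (\<integral>\<^sup>+x. d x \<partial>\<mu>)"
      using dg by (intro nn_integral_cong_AE) (auto elim!: eventually_mono)
    then show "(\<integral>\<^sup>+x. ennreal (g x) \<partial>\<mu>) < \<infinity>" using total by simp
  qed (auto simp: g_def)
  have "AE x in \<mu>. g x \<in> {0..2 * B}"
  proof (rule \<mu>.averaging_theorem[OF g_int])
    fix S assume S: "S \<in> sets \<mu>" and mS: "0 < measure \<mu> S"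
    have S' [measurable]: "S \<in> sets borel" using S by (simp add: \<mu>_def)
    have iS: "integrable N (\<lambda>z. indicator S (\<xi> z) :: real)"
      by (rule N.integrable_const_bound[where B = 1]) auto
    have "(\<integral>x\<in>S. g x \<partial>\<mu>) = (\<integral>x. g x * indicator S x \<partial>\<mu>)"
      unfolding set_lebesgue_integral_def by (simp add: mult.commute)
    also have "\<dots> = (\<integral>z. (\<phi> z + B) * indicator S (\<xi> z) \<partial>N)" by (rule E) measurable
    also have "\<dots> \<le> (\<integral>z. 2 * B * indicator S (\<xi> z) \<partial>N)"
      by (rule integral_mono_AE') (use iS pos B in \<open>auto intro!: AE_I2 mult_right_mono\<close>)
    also have "\<dots> = 2 * B * (\<integral>x. indicator S x \<partial>\<mu>)"
      unfolding \<mu>_def by (subst integral_distr) auto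
    also have "\<dots> = 2 * B * measure \<mu> S" using S by simp
    finally have "(\<integral>x\<in>S. g x \<partial>\<mu>) \<le> 2 * B * measure \<mu> S" .
    moreover have "0 \<le> (\<integral>x\<in>S. g x \<partial>\<mu>)"
      unfolding set_lebesgue_integral_def by (intro Bochner_Integration.integral_nonneg) (auto simp: g_def)
    ultimately show "(1 / measure \<mu> S) *\<^sub>R (\<integral>x\<in>S. g x \<partial>\<mu>) \<in> {0..2 * B}"
      using mS by (simp add: field_simps)
  qed simp
  then have gB: "AE x in \<mu>. max (- B) (min B (g x - B)) = g x - B"
    by eventually_elim auto
  define f where "f x = max (- B) (min B (g x - B))" for x
  have f_meas [measurable]: "f \<in> borel_measurable borel" unfolding f_def by measurable
  have f_bound: "\<bar>f x\<bar> \<le> B" for x using B by (auto simp: f_def abs_le_iff)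
  have "(\<integral>z. \<phi> z * u (\<xi> z) \<partial>N) = (\<integral>z. f (\<xi> z) * u (\<xi> z) \<partial>N)"
    if [measurable]: "u \<in> borel_measurable borel" and u: "\<And>x. \<bar>u x\<bar> \<le> C" for u :: "'a \<Rightarrow> real" and C
  proof -
    have C: "0 \<le> C" using u[of 0] by linarith
    have i1: "integrable N (\<lambda>z. u (\<xi> z))"
      by (rule N.integrable_const_bound[where B = C]) (use u in auto)
    have i2: "integrable N (\<lambda>z. \<phi> z * u (\<xi> z))"
      by (rule N.integrable_const_bound[where B = "B * C"])
        (use u \<phi>_bound B C in \<open>auto simp: abs_mult intro!: mult_mono AE_I2\<close>)
    have i3: "integrable \<mu> u"
      by (rule \<mu>.integrable_const_bound[where B = C]) (use u in auto)
    have i4: "integrable \<mu> (\<lambda>x. g x * u x)"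
    proof (rule Bochner_Integration.integrable_bound[OF integrable_mult_right[OF g_int, of C]])
      show "AE x in \<mu>. norm (g x * u x) \<le> norm (C * g x)"
        using u C by (intro AE_I2) (simp add: abs_mult mult.commute[of C] mult_left_mono)
    qed measurable
    have "(\<integral>z. \<phi> z * u (\<xi> z) \<partial>N) = (\<integral>z. (\<phi> z + B) * u (\<xi> z) \<partial>N) - B * (\<integral>z. u (\<xi> z) \<partial>N)"
      using i1 i2 by (simp add: distrib_right)
    also have "\<dots> = (\<integral>x. g x * u x \<partial>\<mu>) - B * (\<integral>x. u x \<partial>\<mu>)"
      using E[of u] by (simp add: \<mu>_def integral_distr)
    also have "\<dots> = (\<integral>x. (g x - B) * u x \<partial>\<mu>)"
      using i3 i4 by (simp add: left_diff_distrib)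
    also have "\<dots> = (\<integral>x. f x * u x \<partial>\<mu>)"
      by (rule integral_cong_AE) (use gB in \<open>auto simp: f_def elim!: eventually_mono\<close>)
    also have "\<dots> = (\<integral>z. f (\<xi> z) * u (\<xi> z) \<partial>N)"
      unfolding \<mu>_def by (rule integral_distr) measurable
    finally show ?thesis .
  qed
  then have "regression_of N \<xi> \<phi> f" unfolding regression_of_def by blast
  then show ?thesis using f_meas f_bound by blast
qed

text \<open>
  The defining property of conditional expectation, with test functions of the form \<open>u \<circ> Z\<close>.
\<close>

lemma cond_exp_given_integral:
  fixes Z :: "'w \<Rightarrow> 'b::topological_space"
  assumes "prob_space M" "cond_exp_given M V Z f" "integrable M V"
    and Z [measurable]: "Z \<in> borel_measurable M"
    and u [measurable]: "u \<in> borel_measurable borel" and u_bound: "\<And>z. \<bar>u z\<bar> \<le> C"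
  shows "integrable M (\<lambda>w. f (Z w))"
    "(\<integral>w. V w * u (Z w) \<partial>M) = (\<integral>w. f (Z w) * u (Z w) \<partial>M)"
proof -
  interpret prob_space M by fact
  let ?F = "vimage_algebra (space M) Z borel"
  have sub: "subalgebra M ?F"
    unfolding subalgebra_def
    by (auto simp: sets_vimage_algebra2 intro!: measurable_sets[OF Z])
  interpret finite_measure_subalgebra M ?F by standard (rule sub)
  have [measurable]: "V \<in> borel_measurable M" "f \<in> borel_measurable borel"
    using assms(2,3) by (auto simp: cond_exp_given_def)
  have ae: "AE w in M. real_cond_exp M ?F V w = f (Z w)"
    using assms(2) by (simp add: cond_exp_given_def)
  have uF: "(\<lambda>w. u (Z w)) \<in> borel_measurable ?F"
    by (rule measurable_compose[OF measurable_vimage_algebra1 u]) auto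
  have iVu: "integrable M (\<lambda>w. u (Z w) * V w)"
    by (rule Bochner_Integration.integrable_bound[OF integrable_mult_right[OF assms(3), of C]])
      (use u_bound in \<open>auto simp: abs_mult intro!: mult_right_mono AE_I2 intro: order_trans[OF _ abs_ge_self]\<close>)
  have "integrable M (real_cond_exp M ?F V)" by (rule real_cond_exp_int(1)[OF assms(3)])
  then show "integrable M (\<lambda>w. f (Z w))"
    by (rule integrable_cong_AE_imp) (use ae in \<open>auto elim!: eventually_mono\<close>)
  have "(\<integral>w. V w * u (Z w) \<partial>M) = (\<integral>w. u (Z w) * V w \<partial>M)" by (simp add: mult.commute)
  also have "\<dots> = (\<integral>w. u (Z w) * real_cond_exp M ?F V w \<partial>M)"
    by (rule real_cond_exp_intg(2)[symmetric, OF iVu uF]) measurable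
  also have "\<dots> = (\<integral>w. f (Z w) * u (Z w) \<partial>M)"
    by (rule integral_cong_AE) (use ae in \<open>auto elim!: eventually_mono\<close>)
  finally show "(\<integral>w. V w * u (Z w) \<partial>M) = (\<integral>w. f (Z w) * u (Z w) \<partial>M)" .
qed

lemma cond_exp_given_regression_of:
  fixes Z :: "'w \<Rightarrow> 'b::topological_space"
  assumes "prob_space M" "cond_exp_given M V Z f" "integrable M V" "Z \<in> borel_measurable M"
  shows "regression_of M Z V f"
  unfolding regression_of_def using cond_exp_given_integral(2)[OF assms] by blast

lemma regression_of_distr:
  fixes \<xi> :: "'z \<Rightarrow> 'a::topological_space"
  assumes [measurable]: "Z \<in> measurable M N" "\<xi> \<in> borel_measurable N" "\<phi> \<in> borel_measurable N" "f \<in> borel_measurable borel"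
  shows "regression_of (distr M N Z) \<xi> \<phi> f \<longleftrightarrow> regression_of M (\<lambda>w. \<xi> (Z w)) (\<lambda>w. \<phi> (Z w)) f"
proof -
  have "(\<integral>z. \<phi> z * u (\<xi> z) \<partial>distr M N Z) = (\<integral>w. \<phi> (Z w) * u (\<xi> (Z w)) \<partial>M)"
    "(\<integral>z. f (\<xi> z) * u (\<xi> z) \<partial>distr M N Z) = (\<integral>w. f (\<xi> (Z w)) * u (\<xi> (Z w)) \<partial>M)"
    if [measurable]: "u \<in> borel_measurable borel" for u :: "'a \<Rightarrow> real"
    by (rule integral_distr; measurable)+
  then show ?thesis unfolding regression_of_def by simp
qed

text \<open>
  This is how regression functions are identified: they are determined by their integrals over
  the events \<open>X \<in> S\<close>.
\<close>

lemma AE_distr_eq_of_integrals: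
  fixes X :: "'w \<Rightarrow> 'a::topological_space" and f f' :: "'a \<Rightarrow> real"
  assumes [measurable]: "X \<in> borel_measurable M" "f \<in> borel_measurable borel" "f' \<in> borel_measurable borel"
    and "integrable M (\<lambda>w. f (X w))" "integrable M (\<lambda>w. f' (X w))"
    and eq: "\<And>S. S \<in> sets borel \<Longrightarrow> (\<integral>w. f (X w) * indicator S (X w) \<partial>M) = (\<integral>w. f' (X w) * indicator S (X w) \<partial>M)"
  shows "AE x in distr M borel X. f x = f' x"
proof (rule density_unique_real)
  show "integrable (distr M borel X) f" "integrable (distr M borel X) f'"
    using assms by (simp_all add: integrable_distr_eq)
  fix S assume "S \<in> sets (distr M borel X)"
  then have S [measurable]: "S \<in> sets borel" by simp
  have "(\<integral>x\<in>S. r x \<partial>distr M borel X) = (\<integral>w. r (X w) * indicator S (X w) \<partial>M)"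
    if [measurable]: "r \<in> borel_measurable borel" for r :: "'a \<Rightarrow> real"
    unfolding set_lebesgue_integral_def by (subst integral_distr) (auto simp: mult.commute)
  then show "(\<integral>x\<in>S. f x \<partial>distr M borel X) = (\<integral>x\<in>S. f' x \<partial>distr M borel X)"
    using eq[OF S] by simp
qed

section \<open>Perturbation of the estimator at one point\<close>

lemma weighted_mean_bound:
  fixes a y :: "nat \<Rightarrow> real"
  assumes a: "\<And>i. i \<in> I \<Longrightarrow> 0 \<le> a i" and y: "\<And>i. i \<in> I \<Longrightarrow> \<bar>y i\<bar> \<le> L"
  shows "\<bar>\<Sum>i\<in>I. a i * y i\<bar> \<le> L * (\<Sum>i\<in>I. a i)"
proof -
  have "\<bar>\<Sum>i\<in>I. a i * y i\<bar> \<le> (\<Sum>i\<in>I. \<bar>a i * y i\<bar>)" by (rule sum_abs)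
  also have "\<dots> \<le> (\<Sum>i\<in>I. L * a i)"
    using a y by (intro sum_mono) (simp add: abs_mult mult.commute[of L] mult_left_mono)
  finally show ?thesis by (simp add: sum_distrib_left)
qed

lemma exp_tilt_bound:
  fixes y t u L :: real
  assumes "\<bar>y\<bar> \<le> L"
  shows "\<bar>exp (t * y) - exp (u * y)\<bar> \<le> (exp (\<bar>t - u\<bar> * L) - 1) * exp (t * y)"
proof -
  define v where "v = (u - t) * y"
  have v: "\<bar>v\<bar> \<le> \<bar>t - u\<bar> * L"
    using mult_left_mono[OF assms, of "\<bar>u - t\<bar>"] by (simp add: v_def abs_mult abs_minus_commute)
  have "exp (u * y) = exp (t * y) * exp v"
    by (simp add: v_def exp_add[symmetric] algebra_simps)
  then have "exp (t * y) - exp (u * y) = exp (t * y) * - (exp v - 1)" by (simp add: right_diff_distrib)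
  then have "\<bar>exp (t * y) - exp (u * y)\<bar> = exp (t * y) * \<bar>exp v - 1\<bar>"
    by (simp only: abs_mult abs_minus_cancel abs_exp_cancel)
  also have "\<bar>exp v - 1\<bar> \<le> exp \<bar>v\<bar> - 1"
  proof (cases "0 \<le> v")
    case False
    have "2 * 1 \<le> exp v + exp (- v)"
      using exp_ge_add_one_self[of v] exp_ge_add_one_self[of "- v"] by linarith
    then show ?thesis using False by (simp add: abs_if)
  qed simp
  also have "\<dots> \<le> exp (\<bar>t - u\<bar> * L) - 1" using v by simp
  finally show ?thesis by (simp add: mult.commute mult_left_mono)
qed

text \<open>
  Passing from the tilt \<open>e\<^bsup>ty\<^esup>\<close> to \<open>e\<^bsup>uy\<^esup>\<close> changes each summand by at most the fraction
  \<open>\<delta> = e\<^bsup>\<bar>t-u\<bar>L\<^esup> - 1\<close> of the summand at \<open>t\<close>. Numerator and denominator thus move by at most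
  \<open>L \<delta> s(t)\<close> and \<open>\<delta> s(t)\<close>, and the common factor \<open>s(t)\<close> cancels in the quotient, so that no
  lower bound on it enters. If \<open>s\<close> vanishes at one parameter, all weights are \<open>0\<close> and both
  quotients are \<open>0\<close>.
\<close>

lemma tilted_mean_perturbation:
  fixes a y :: "nat \<Rightarrow> real" and t u L :: real
  assumes fin: "finite I" and a: "\<And>i. i \<in> I \<Longrightarrow> 0 \<le> a i" and y: "\<And>i. i \<in> I \<Longrightarrow> \<bar>y i\<bar> \<le> L"
    and L: "0 \<le> L"
  defines "s \<equiv> \<lambda>t. \<Sum>i\<in>I. a i * exp (t * y i)" and "r \<equiv> \<lambda>t. \<Sum>i\<in>I. a i * y i * exp (t * y i)"
  shows "\<bar>r t\<bar> \<le> L * s t" "\<bar>r t / s t - r u / s u\<bar> \<le> 2 * L * (exp (\<bar>t - u\<bar> * L) - 1)"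
proof -
  define \<delta> where "\<delta> = exp (\<bar>t - u\<bar> * L) - 1"
  have \<delta>: "0 \<le> \<delta>" using L by (simp add: \<delta>_def)
  have r_le: "\<bar>r t\<bar> \<le> L * s t" for t
    using weighted_mean_bound[of I "\<lambda>i. a i * exp (t * y i)" y L] a y
    by (simp add: r_def s_def mult_ac)
  then show "\<bar>r t\<bar> \<le> L * s t" .
  have s_nonneg: "0 \<le> s t" for t unfolding s_def by (intro sum_nonneg mult_nonneg_nonneg a) auto
  have s_zero: "s t = 0 \<longleftrightarrow> (\<forall>i\<in>I. a i = 0)" for t
    unfolding s_def using a by (subst sum_nonneg_eq_0_iff[OF fin]) auto
  show "\<bar>r t / s t - r u / s u\<bar> \<le> 2 * L * (exp (\<bar>t - u\<bar> * L) - 1)"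
  proof (cases "s t = 0")
    case True
    then have "s u = 0" using s_zero by blast
    then show ?thesis using True L \<delta> by (simp add: \<delta>_def)
  next
    case False
    then have su: "0 < s u" and st: "0 < s t" using s_zero s_nonneg[of u] s_nonneg[of t] by (metis less_le)+
    have ds: "\<bar>s t - s u\<bar> \<le> \<delta> * s t"
    proof -
      have "\<bar>s t - s u\<bar> \<le> (\<Sum>i\<in>I. \<bar>a i * (exp (t * y i) - exp (u * y i))\<bar>)"
        unfolding s_def sum_subtractf[symmetric] right_diff_distrib[symmetric] by (rule sum_abs)
      also have "\<dots> \<le> (\<Sum>i\<in>I. a i * (\<delta> * exp (t * y i)))"
        unfolding \<delta>_def abs_mult using a y by (intro sum_mono mult_mono exp_tilt_bound) auto
      finally show ?thesis by (simp add: s_def sum_distrib_left mult_ac)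
    qed
    have dr: "\<bar>r t - r u\<bar> \<le> L * \<delta> * s t"
    proof -
      have "\<bar>r t - r u\<bar> \<le> (\<Sum>i\<in>I. \<bar>a i * y i * (exp (t * y i) - exp (u * y i))\<bar>)"
        unfolding r_def sum_subtractf[symmetric] right_diff_distrib[symmetric] by (rule sum_abs)
      also have "\<dots> \<le> (\<Sum>i\<in>I. a i * L * (\<delta> * exp (t * y i)))"
        unfolding \<delta>_def abs_mult using a y L by (intro sum_mono mult_mono exp_tilt_bound) auto
      finally show ?thesis by (simp add: s_def sum_distrib_left mult_ac)
    qed
    have q: "\<bar>r u / s u\<bar> \<le> L" using r_le[of u] su by (simp add: abs_divide field_simps)
    have "r t / s t - r u / s u = (r t - r u) / s t + r u / s u * ((s u - s t) / s t)"
      using st su by (simp add: field_simps)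
    also have "\<bar>\<dots>\<bar> \<le> \<bar>(r t - r u) / s t\<bar> + \<bar>r u / s u\<bar> * \<bar>(s u - s t) / s t\<bar>"
      by (rule order_trans[OF abs_triangle_ineq]) (simp add: abs_mult)
    also have "\<dots> \<le> L * \<delta> + L * \<delta>"
    proof (intro add_mono mult_mono q)
      show "\<bar>(r t - r u) / s t\<bar> \<le> L * \<delta>" using dr st by (simp add: abs_divide field_simps)
      show "\<bar>(s u - s t) / s t\<bar> \<le> \<delta>" using ds st by (simp add: abs_divide abs_minus_commute field_simps)
    qed (use L in auto)
    finally show ?thesis by (simp add: \<delta>_def)
  qed
qed

text \<open>
  With \<open>k = r/s\<close>, the identity \<open>s' (k - r'/s') = k (s' - s) + (r - r')\<close> and \<open>\<bar>k\<bar> \<le> L\<close> bound the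
  error of the quotient using the lower bound \<open>c\<close> on the true denominator \<open>s'\<close> only; the
  estimated denominator \<open>s\<close> may be arbitrarily small.
\<close>

lemma plug_in_error_bound:
  fixes e1 e2 s r q :: real and \<eta>1 \<eta>2 s' r' :: real
  assumes c: "0 < c" "c \<le> s'" and L: "0 \<le> L" and B: "\<bar>r'\<bar> \<le> B"
    and e2: "0 \<le> e2" "e2 \<le> 1" and r: "\<bar>r\<bar> \<le> L * s" and q: "\<bar>q - r / s\<bar> \<le> \<theta>"
  shows "\<bar>(e1 + q * (1 - e2)) - (\<eta>1 + r' / s' * (1 - \<eta>2))\<bar>
    \<le> \<theta> + (1 + (1 + L + B) / c) * (\<bar>e1 - \<eta>1\<bar> + \<bar>e2 - \<eta>2\<bar> + \<bar>r - r'\<bar> + \<bar>s - s'\<bar>)"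
proof -
  have s': "0 < s'" using c by linarith
  have s: "0 \<le> s" if "L \<noteq> 0" using r L that by (smt (verit) mult_nonneg_nonneg zero_le_mult_iff)
  define k where "k = r / s"
  have ks: "k * s = r" using r by (cases "s = 0") (auto simp: k_def)
  have kL: "\<bar>k\<bar> \<le> L"
  proof (cases "s = 0 \<or> L = 0")
    case True
    then show ?thesis using L r by (auto simp: k_def)
  next
    case False
    then have "0 < s" using s by simp
    then show ?thesis using r by (simp add: k_def abs_divide field_simps)
  qed
  have "s' * (k - r' / s') = k * (s' - s) + (r - r')"
    using s' ks by (simp add: field_simps)
  then have "s' * \<bar>k - r' / s'\<bar> = \<bar>k * (s' - s) + (r - r')\<bar>"
    using s' by (metis abs_mult abs_of_pos)
  also have "\<dots> \<le> \<bar>k\<bar> * \<bar>s' - s\<bar> + \<bar>r - r'\<bar>"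
    by (rule order_trans[OF abs_triangle_ineq]) (simp add: abs_mult)
  also have "\<dots> \<le> L * \<bar>s - s'\<bar> + \<bar>r - r'\<bar>"
    using kL by (simp add: abs_minus_commute mult_right_mono)
  finally have "c * \<bar>k - r' / s'\<bar> \<le> L * \<bar>s - s'\<bar> + \<bar>r - r'\<bar>"
    using c mult_right_mono[of c s' "\<bar>k - r' / s'\<bar>"] by linarith
  then have kr: "\<bar>k - r' / s'\<bar> \<le> L / c * \<bar>s - s'\<bar> + 1 / c * \<bar>r - r'\<bar>"
    using c by (simp add: field_simps)
  have rB: "\<bar>r' / s'\<bar> \<le> B / c"
    unfolding abs_divide using B c s' by (intro frac_le) auto
  have "(e1 + q * (1 - e2)) - (\<eta>1 + R * (1 - \<eta>2))
     = (e1 - \<eta>1) + (q - k) * (1 - e2) + (k - R) * (1 - e2) + R * (\<eta>2 - e2)" for R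
    by (simp add: algebra_simps)
  from this[of "r' / s'"] have "(e1 + q * (1 - e2)) - (\<eta>1 + r' / s' * (1 - \<eta>2))
     = (e1 - \<eta>1) + (q - k) * (1 - e2) + (k - r' / s') * (1 - e2) + r' / s' * (\<eta>2 - e2)" .
  also have "\<bar>\<dots>\<bar> \<le> \<bar>e1 - \<eta>1\<bar> + \<bar>q - k\<bar> * \<bar>1 - e2\<bar> + \<bar>k - r' / s'\<bar> * \<bar>1 - e2\<bar> + \<bar>r' / s'\<bar> * \<bar>\<eta>2 - e2\<bar>"
  proof -
    have "\<bar>a1 + a2 + a3 + a4\<bar> \<le> \<bar>a1\<bar> + \<bar>a2\<bar> + \<bar>a3\<bar> + \<bar>a4\<bar>" for a1 a2 a3 a4 :: real by linarith
    then show ?thesis unfolding abs_mult[symmetric] .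
  qed
  also have "\<dots> \<le> \<bar>e1 - \<eta>1\<bar> + \<theta> * 1 + (L / c * \<bar>s - s'\<bar> + 1 / c * \<bar>r - r'\<bar>) * 1 + B / c * \<bar>e2 - \<eta>2\<bar>"
  proof -
    have "\<bar>q - k\<bar> * \<bar>1 - e2\<bar> \<le> \<theta> * 1" using q e2 by (intro mult_mono) (auto simp: k_def)
    moreover have "\<bar>k - r' / s'\<bar> * \<bar>1 - e2\<bar> \<le> (L / c * \<bar>s - s'\<bar> + 1 / c * \<bar>r - r'\<bar>) * 1"
      using e2 kr by (intro mult_mono) auto
    moreover have "\<bar>r' / s'\<bar> * \<bar>\<eta>2 - e2\<bar> \<le> B / c * \<bar>e2 - \<eta>2\<bar>"
      unfolding abs_minus_commute[of \<eta>2 e2] by (rule mult_right_mono[OF rB]) simp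
    ultimately show ?thesis by linarith
  qed
  also have "\<dots> \<le> \<theta> + (1 + (1 + L + B) / c) * (\<bar>e1 - \<eta>1\<bar> + \<bar>e2 - \<eta>2\<bar> + \<bar>r - r'\<bar> + \<bar>s - s'\<bar>)"
  proof -
    define D where "D = 1 + (1 + L + B) / c"
    have B0: "0 \<le> B" using B by linarith
    have D: "1 \<le> D" "L / c \<le> D" "1 / c \<le> D" "B / c \<le> D"
      using c L B0 by (auto simp: D_def field_simps)
    have "\<bar>e1 - \<eta>1\<bar> \<le> D * \<bar>e1 - \<eta>1\<bar>" using mult_right_mono[OF D(1), of "\<bar>e1 - \<eta>1\<bar>"] by simp
    moreover have "L / c * \<bar>s - s'\<bar> \<le> D * \<bar>s - s'\<bar>" by (rule mult_right_mono[OF D(2)]) simp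
    moreover have "1 / c * \<bar>r - r'\<bar> \<le> D * \<bar>r - r'\<bar>" by (rule mult_right_mono[OF D(3)]) simp
    moreover have "B / c * \<bar>e2 - \<eta>2\<bar> \<le> D * \<bar>e2 - \<eta>2\<bar>" by (rule mult_right_mono[OF D(4)]) simp
    moreover have "a + \<theta> * 1 + (l + k) * 1 + m \<le> \<theta> + (a' + m' + k' + l')"
      if "a \<le> a'" "l \<le> l'" "k \<le> k'" "m \<le> m'" for a a' l l' k k' m m' :: real
      using that by simp
    ultimately show ?thesis unfolding D_def[symmetric] distrib_left by blast
  qed
  finally show ?thesis .
qed

definition admissible :: "real \<Rightarrow> 'a \<times> real \<times> real \<Rightarrow> bool"
  where "admissible L = (\<lambda>(x, y, d). \<bar>y\<bar> \<le> L \<and> (d = 0 \<or> d = 1))"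

text \<open>
  The response whose regression function on \<open>X\<close> is estimated by \<open>eta_hat\<close>, set to \<open>0\<close> on the null set
  of observations outside the range of the model to make it bounded.
\<close>

definition response :: "real \<Rightarrow> nat \<Rightarrow> real \<Rightarrow> 'a \<times> real \<times> real \<Rightarrow> real"
  where "response L k t z = (if admissible L z then (case z of (x, y, d) \<Rightarrow> d * y ^ (2 - k) * exp (t * y)) else 0)"

lemma admissible_meas [measurable]:
  "Measurable.pred (borel :: ('a::euclidean_space \<times> real \<times> real) measure) (admissible L)"
  unfolding admissible_def borel_prod[symmetric] by measurable

lemma response_meas [measurable]:
  "response L k t \<in> borel_measurable (borel :: ('a::euclidean_space \<times> real \<times> real) measure)"
proof -
  have "(\<lambda>(x, y, d). d * y ^ (2 - k) * exp (t * y)) \<in> borel_measurable (borel :: ('a \<times> real \<times> real) measure)"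
    unfolding borel_prod[symmetric] by measurable
  then show ?thesis unfolding response_def by measurable
qed

lemma response_bound:
  assumes "0 \<le> L" "k = 1 \<or> k = 2" "\<bar>t\<bar> \<le> \<bar>u\<bar>"
  shows "\<bar>response L k t z\<bar> \<le> (L + 1) * exp (\<bar>u\<bar> * L)"
proof (cases z)
  case (fields x y d)
  show ?thesis
  proof (cases "admissible L z")
    case True
    then have y: "\<bar>y\<bar> \<le> L" and d: "\<bar>d\<bar> \<le> 1" by (auto simp: fields admissible_def)
    have "\<bar>y ^ (2 - k)\<bar> \<le> L + 1" using y assms(1,2) by (auto simp: numeral_2_eq_2)
    moreover have "t * y \<le> \<bar>u\<bar> * L"
    proof -
      have "t * y \<le> \<bar>t\<bar> * \<bar>y\<bar>" by (simp add: abs_mult[symmetric])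
      also have "\<dots> \<le> \<bar>u\<bar> * L" using y assms by (intro mult_mono) auto
      finally show ?thesis .
    qed
    ultimately have "\<bar>d\<bar> * \<bar>y ^ (2 - k)\<bar> * exp (t * y) \<le> 1 * (L + 1) * exp (\<bar>u\<bar> * L)"
      using d assms(1) by (intro mult_mono) auto
    then show ?thesis using True by (simp add: response_def fields abs_mult)
  next
    case False
    then show ?thesis using assms(1) by (simp add: response_def)
  qed
qed

context
  fixes K :: "'a::euclidean_space \<Rightarrow> real" and h L :: real and n :: nat and z :: "nat \<Rightarrow> 'a \<times> real \<times> real"
  assumes K_nonneg: "\<And>u. 0 \<le> K u" and L: "0 \<le> L" and good: "\<And>i. i < n \<Longrightarrow> admissible L (z i)"
begin

lemma eta_hat_response:
  "eta_hat K h n z k x t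
    = (\<Sum>i<n. response L k t (z i) * K ((x - fst (z i)) /\<^sub>R h)) / (\<Sum>i<n. K ((x - fst (z i)) /\<^sub>R h))"
  unfolding eta_hat_def
  by (intro arg_cong2[where f = "(/)"] sum.cong refl)
    (use good in \<open>auto simp: response_def split: prod.split\<close>)

text \<open>
  In terms of these weights, \<open>eta_hat\<close> for \<open>k = 1\<close> and \<open>k = 2\<close> are the numerator and the denominator of
  a tilted mean.
\<close>

definition fit_weight :: "'a \<Rightarrow> nat \<Rightarrow> real"
  where "fit_weight x i = snd (snd (z i)) * K ((x - fst (z i)) /\<^sub>R h) / (\<Sum>i<n. K ((x - fst (z i)) /\<^sub>R h))"

lemma fit_weight_nonneg: "i < n \<Longrightarrow> 0 \<le> fit_weight x i"
  using good[of i] K_nonneg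
  by (auto simp: fit_weight_def admissible_def split: prod.splits intro!: divide_nonneg_nonneg sum_nonneg)

lemma value_bound: "i < n \<Longrightarrow> \<bar>fst (snd (z i))\<bar> \<le> L"
  using good[of i] by (auto simp: admissible_def split: prod.splits)

lemma eta_hat_1: "eta_hat K h n z 1 x t
    = (\<Sum>i<n. fit_weight x i * fst (snd (z i)) * exp (t * fst (snd (z i))))"
  unfolding eta_hat_def fit_weight_def
  by (auto simp: sum_divide_distrib split_beta mult_ac intro!: sum.cong)

lemma eta_hat_2: "eta_hat K h n z 2 x t
    = (\<Sum>i<n. fit_weight x i * exp (t * fst (snd (z i))))"
  unfolding eta_hat_def fit_weight_def
  by (auto simp: sum_divide_distrib split_beta mult_ac intro!: sum.cong)

lemma eta_hat_1_le: "\<bar>eta_hat K h n z 1 x t\<bar> \<le> L * eta_hat K h n z 2 x t"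
  unfolding eta_hat_1 eta_hat_2
  by (rule tilted_mean_perturbation(1)) (use fit_weight_nonneg value_bound L in auto)

lemma eta_hat_ratio_perturbation:
  "\<bar>eta_hat K h n z 1 x t / eta_hat K h n z 2 x t - eta_hat K h n z 1 x u / eta_hat K h n z 2 x u\<bar>
    \<le> 2 * L * (exp (\<bar>t - u\<bar> * L) - 1)"
  unfolding eta_hat_1 eta_hat_2
  by (rule tilted_mean_perturbation(2)) (use fit_weight_nonneg value_bound L in auto)

lemma eta_hat_2_0: "0 \<le> eta_hat K h n z 2 x 0" "eta_hat K h n z 2 x 0 \<le> 1"
proof -
  show "0 \<le> eta_hat K h n z 2 x 0"
    unfolding eta_hat_2 by (intro sum_nonneg) (use fit_weight_nonneg in auto)
  let ?S = "\<Sum>i<n. K ((x - fst (z i)) /\<^sub>R h)"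
  have "eta_hat K h n z 2 x 0 \<le> (\<Sum>i<n. K ((x - fst (z i)) /\<^sub>R h) / ?S)"
    unfolding eta_hat_2
  proof (rule sum_mono)
    fix i assume "i \<in> {..<n}"
    then have "snd (snd (z i)) * K ((x - fst (z i)) /\<^sub>R h) \<le> K ((x - fst (z i)) /\<^sub>R h)"
      using good[of i] K_nonneg by (auto simp: admissible_def split: prod.splits)
    then show "fit_weight x i * exp (0 * fst (snd (z i))) \<le> K ((x - fst (z i)) /\<^sub>R h) / ?S"
      unfolding fit_weight_def by (simp add: divide_right_mono sum_nonneg K_nonneg)
  qed
  also have "\<dots> = ?S / ?S" by (rule sum_divide_distrib[symmetric])
  also have "\<dots> \<le> 1" by simp
  finally show "eta_hat K h n z 2 x 0 \<le> 1" .
qed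

lemma m_hat_bound: "\<bar>m_hat K h n z t x\<bar> \<le> 2 * L"
proof -
  have "\<bar>eta_hat K h n z 1 x 0\<bar> \<le> L"
    using eta_hat_1_le[of x 0] mult_left_mono[OF eta_hat_2_0(2) L, of x] by simp
  moreover have "\<bar>eta_hat K h n z 1 x t / eta_hat K h n z 2 x t\<bar> \<le> L"
  proof (cases "eta_hat K h n z 2 x t \<le> 0 \<or> L = 0")
    case True
    then have "L * eta_hat K h n z 2 x t \<le> 0" using L by (auto simp: mult_nonneg_nonpos)
    then have "eta_hat K h n z 1 x t = 0" using eta_hat_1_le[of x t] by simp
    then show ?thesis using L by simp
  next
    case False
    then show ?thesis using eta_hat_1_le[of x t] by (simp add: abs_divide field_simps)
  qed
  then have "\<bar>eta_hat K h n z 1 x t / eta_hat K h n z 2 x t\<bar> * \<bar>1 - eta_hat K h n z 2 x 0\<bar> \<le> L * 1"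
    using eta_hat_2_0[of x] L by (intro mult_mono) auto
  ultimately show ?thesis
    unfolding m_hat_def using abs_triangle_ineq[of "eta_hat K h n z 1 x 0"
      "eta_hat K h n z 1 x t / eta_hat K h n z 2 x t * (1 - eta_hat K h n z 2 x 0)"]
    by (simp only: abs_mult)
qed

end

context kernel_design
begin

text \<open>
  If \<open>S\<close> and \<open>P\<close> are the sums of \<open>K\<close> and \<open>\<psi> K\<close>, the difference equals
  \<open>(P/S) (1 - S/(n \<kappa>))\<close>, where \<open>P/S\<close> is a mean of values in \<open>[-B,B]\<close>. If \<open>S = 0\<close>, then \<open>P = 0\<close> as well
  and the left side is \<open>0\<close>.
\<close>

lemma quotient_vs_normalized:
  fixes \<psi> :: "nat \<Rightarrow> real" and pts :: "nat \<Rightarrow> 'a"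
  assumes \<kappa>: "0 < \<kappa> h x" and n: "0 < n" and \<psi>: "\<And>i. i < n \<Longrightarrow> \<bar>\<psi> i\<bar> \<le> B" and B: "0 \<le> B"
  shows "\<bar>(\<Sum>i<n. \<psi> i * K ((x - pts i) /\<^sub>R h)) / (\<Sum>i<n. K ((x - pts i) /\<^sub>R h)) - (\<Sum>i<n. \<psi> i * weight h (pts i) x) / real n\<bar>
    \<le> B * \<bar>(\<Sum>i<n. weight h (pts i) x) / real n - 1\<bar>"
proof -
  define S where "S = (\<Sum>i<n. K ((x - pts i) /\<^sub>R h))"
  define P where "P = (\<Sum>i<n. \<psi> i * K ((x - pts i) /\<^sub>R h))"
  have PS: "\<bar>P\<bar> \<le> B * S"
    unfolding P_def S_def using weighted_mean_bound[of "{..<n}" "\<lambda>i. K ((x - pts i) /\<^sub>R h)" \<psi> B] K_nonneg \<psi>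
    by (simp add: mult.commute)
  have S0: "0 \<le> S" unfolding S_def by (intro sum_nonneg K_nonneg)
  have w: "(\<Sum>i<n. weight h (pts i) x) / real n = S / (\<kappa> h x * real n)"
    by (simp add: weight_def S_def sum_divide_distrib)
  have \<psi>w: "(\<Sum>i<n. \<psi> i * weight h (pts i) x) / real n = P / (\<kappa> h x * real n)"
    by (simp add: weight_def P_def sum_divide_distrib)
  show ?thesis
    unfolding w \<psi>w S_def[symmetric] P_def[symmetric]
  proof (cases "S = 0")
    case True
    then show "\<bar>P / S - P / (\<kappa> h x * real n)\<bar> \<le> B * \<bar>S / (\<kappa> h x * real n) - 1\<bar>"
      using PS B by simp
  next
    case False
    then have S: "0 < S" using S0 by simp
    have "P / S - P / (\<kappa> h x * real n) = - (P / S) * (S / (\<kappa> h x * real n) - 1)"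
      using S \<kappa> n by (simp add: field_simps)
    then have "\<bar>P / S - P / (\<kappa> h x * real n)\<bar> = \<bar>P / S\<bar> * \<bar>S / (\<kappa> h x * real n) - 1\<bar>"
      by (simp only: abs_mult abs_minus_cancel)
    also have "\<dots> \<le> B * \<bar>S / (\<kappa> h x * real n) - 1\<bar>"
      using PS S by (intro mult_right_mono) (auto simp: abs_divide field_simps)
    finally show "\<bar>P / S - P / (\<kappa> h x * real n)\<bar> \<le> B * \<bar>S / (\<kappa> h x * real n) - 1\<bar>" .
  qed
qed

lemma m_hat_pointwise_error:
  fixes z :: "nat \<Rightarrow> 'a \<times> real \<times> real"
  assumes \<kappa>: "0 < \<kappa> h x" and n: "0 < n" and L: "0 \<le> L" and good: "\<And>i. i < n \<Longrightarrow> admissible L (z i)"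
    and t: "\<bar>t - u\<bar> \<le> C" and c: "0 < c" "c \<le> s" and r: "\<bar>r\<bar> \<le> B"
    and B: "(L + 1) * exp (\<bar>u\<bar> * L) \<le> B"
  defines "avg \<equiv> \<lambda>k v. (\<Sum>i<n. response L k v (z i) * weight h (fst (z i)) x) / real n"
    and "mass \<equiv> (\<Sum>i<n. weight h (fst (z i)) x) / real n"
  shows "\<bar>m_hat K h n z t x - (a1 + r / s * (1 - a2))\<bar> \<le> 2 * L * (exp (C * L) - 1)
    + (1 + (1 + L + B) / c) * ((\<bar>avg 1 0 - a1\<bar> + B * \<bar>mass - 1\<bar>) + (\<bar>avg 2 0 - a2\<bar> + B * \<bar>mass - 1\<bar>)
      + (\<bar>avg 1 u - r\<bar> + B * \<bar>mass - 1\<bar>) + (\<bar>avg 2 u - s\<bar> + B * \<bar>mass - 1\<bar>))"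
proof -
  have B0: "0 \<le> B" using r by linarith
  let ?e = "eta_hat K h n z"
  have nw: "\<bar>?e k x v - avg k v\<bar> \<le> B * \<bar>mass - 1\<bar>" if "k = 1 \<or> k = 2" "\<bar>v\<bar> \<le> \<bar>u\<bar>" for k v
  proof -
    have "?e k x v = (\<Sum>i<n. response L k v (z i) * K ((x - fst (z i)) /\<^sub>R h)) / (\<Sum>i<n. K ((x - fst (z i)) /\<^sub>R h))"
      by (rule eta_hat_response[OF K_nonneg L good])
    then show ?thesis
      unfolding avg_def mass_def
      by (simp only:) (rule quotient_vs_normalized[OF \<kappa> n order_trans[OF response_bound[OF L that] B] B0])
  qed
  have d: "\<bar>?e k x v - y\<bar> \<le> \<bar>avg k v - y\<bar> + B * \<bar>mass - 1\<bar>" if "k = 1 \<or> k = 2" "\<bar>v\<bar> \<le> \<bar>u\<bar>" for k v y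
    using nw[OF that] by linarith
  have "\<bar>?e 1 x t / ?e 2 x t - ?e 1 x u / ?e 2 x u\<bar> \<le> 2 * L * (exp (\<bar>t - u\<bar> * L) - 1)"
    by (rule eta_hat_ratio_perturbation[OF K_nonneg L good])
  also have "\<dots> \<le> 2 * L * (exp (C * L) - 1)"
    using t L by (intro mult_left_mono) (auto intro: mult_right_mono)
  finally have ratio: "\<bar>?e 1 x t / ?e 2 x t - ?e 1 x u / ?e 2 x u\<bar> \<le> 2 * L * (exp (C * L) - 1)" .
  have "\<bar>m_hat K h n z t x - (a1 + r / s * (1 - a2))\<bar> \<le> 2 * L * (exp (C * L) - 1)
    + (1 + (1 + L + B) / c) * (\<bar>?e 1 x 0 - a1\<bar> + \<bar>?e 2 x 0 - a2\<bar> + \<bar>?e 1 x u - r\<bar> + \<bar>?e 2 x u - s\<bar>)"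
    unfolding m_hat_def
    by (rule plug_in_error_bound[OF c L r eta_hat_2_0[OF K_nonneg L good] eta_hat_1_le[OF K_nonneg L good] ratio])
  also have "\<dots> \<le> 2 * L * (exp (C * L) - 1)
    + (1 + (1 + L + B) / c) * ((\<bar>avg 1 0 - a1\<bar> + B * \<bar>mass - 1\<bar>) + (\<bar>avg 2 0 - a2\<bar> + B * \<bar>mass - 1\<bar>)
      + (\<bar>avg 1 u - r\<bar> + B * \<bar>mass - 1\<bar>) + (\<bar>avg 2 u - s\<bar> + B * \<bar>mass - 1\<bar>))"
    using c L B0 by (intro add_left_mono mult_left_mono add_mono d) auto
  finally show ?thesis .
qed

end

section \<open>Identification of the regression function from the observed data\<close>

text \<open>
  The selection mechanism: \<open>\<Delta>\<close> indicates that \<open>Y\<close> is observed, and the selection probability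
  is bounded away from \<open>0\<close> on the range of \<open>Y\<close>.
\<close>

locale selection_model = prob_space M
  for M :: "'w measure" +
  fixes X :: "'w \<Rightarrow> 'a::euclidean_space" and Y \<Delta> :: "'w \<Rightarrow> real" and L \<gamma> :: real and g :: "'a \<Rightarrow> real"
  assumes X_meas [measurable]: "X \<in> borel_measurable M"
    and Y_meas [measurable]: "Y \<in> borel_measurable M"
    and \<Delta>_meas [measurable]: "\<Delta> \<in> borel_measurable M"
    and Y_bounded: "AE w in M. Y w \<in> {-L..L}" and \<Delta>_binary: "AE w in M. \<Delta> w \<in> {0, 1}"
    and selection: "cond_exp_given M \<Delta> (\<lambda>w. (X w, Y w)) (\<lambda>(x, y). selection_prob g \<gamma> x y)"
    and positivity: "(INF (x, y) \<in> UNIV \<times> {-L..L}. selection_prob g \<gamma> x y) > 0"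
begin

definition \<pi>_min :: real
  where "\<pi>_min = (INF (x, y) \<in> UNIV \<times> {-L..L}. selection_prob g \<gamma> x y)"

lemma \<pi>_min_pos: "0 < \<pi>_min"
  using positivity by (simp add: \<pi>_min_def)

lemma selection_prob_bounds: "0 < selection_prob g \<gamma> x y" "selection_prob g \<gamma> x y \<le> 1"
  by (simp_all add: selection_prob_def add_pos_pos inverse_le_1_iff add_increasing2)

lemma \<pi>_min_le:
  assumes "y \<in> {-L..L}"
  shows "\<pi>_min \<le> selection_prob g \<gamma> x y"
proof -
  have "bdd_below ((\<lambda>(x, y). selection_prob g \<gamma> x y) ` (UNIV \<times> {-L..L}))"
    by (rule bdd_belowI[of _ 0]) (auto intro: less_imp_le[OF selection_prob_bounds(1)])
  from cINF_lower[OF this, of "(x, y)"] show ?thesis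
    using assms by (simp add: \<pi>_min_def)
qed

lemma L_nonneg: "0 \<le> L"
proof -
  have "\<exists>w. Y w \<in> {-L..L}"
    using Y_bounded by (metis (no_types, lifting) AE_False eventually_mono)
  then show ?thesis by force
qed

lemma selection_odds: "selection_prob g \<gamma> x y * (exp (\<gamma> * y) * exp (g x)) = 1 - selection_prob g \<gamma> x y"
proof -
  have "1 + exp (g x + \<gamma> * y) \<noteq> 0" using exp_gt_zero[of "g x + \<gamma> * y"] by linarith
  then show ?thesis by (simp add: selection_prob_def exp_add field_simps)
qed

lemma selection_meas [measurable]: "(\<lambda>(x, y). selection_prob g \<gamma> x y) \<in> borel_measurable (borel \<Otimes>\<^sub>M borel)"
  using selection by (simp add: cond_exp_given_def borel_prod)

lemma exp_g_eq: "exp (g x) = 1 / selection_prob g \<gamma> x 0 - 1"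
  by (simp add: selection_prob_def divide_inverse)

lemma exp_g_meas [measurable]: "(\<lambda>x. exp (g x)) \<in> borel_measurable borel"
  unfolding exp_g_eq by measurable

text \<open>
  Positivity of the selection probability at \<open>y = 0\<close> bounds the unknown factor \<open>e\<^bsup>g\<^esup>\<close>; so
  it may be part of a bounded test function.
\<close>

lemma exp_g_le: "exp (g x) \<le> 1 / \<pi>_min"
proof -
  have "1 / selection_prob g \<gamma> x 0 \<le> 1 / \<pi>_min"
    using \<pi>_min_pos \<pi>_min_le[of 0 x] L_nonneg by (intro divide_left_mono) auto
  then show ?thesis unfolding exp_g_eq by linarith
qed

lemma integrable_\<Delta>: "integrable M \<Delta>"
  by (rule integrable_const_bound[where B = 1]) (use \<Delta>_binary in \<open>auto elim!: eventually_mono\<close>)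

lemma integral_\<Delta>:
  assumes [measurable]: "v \<in> borel_measurable (borel \<Otimes>\<^sub>M borel)" and "\<And>p. \<bar>v p\<bar> \<le> C"
  shows "(\<integral>w. \<Delta> w * v (X w, Y w) \<partial>M) = (\<integral>w. selection_prob g \<gamma> (X w) (Y w) * v (X w, Y w) \<partial>M)"
  using cond_exp_given_integral(2)[OF prob_space_axioms selection integrable_\<Delta> _ _ assms(2)]
    assms(1) by (simp add: borel_prod)

text \<open>
  The factor \<open>e\<^bsup>\<gamma>y\<^esup>\<close>, cut off outside the range of \<open>Y\<close> to make test functions bounded.
\<close>

definition tilt :: "real \<Rightarrow> real"
  where "tilt y = (if \<bar>y\<bar> \<le> L then exp (\<gamma> * y) else 0)"

lemma tilt_meas [measurable]: "tilt \<in> borel_measurable borel"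
  unfolding tilt_def by measurable

lemma abs_\<gamma>_le: "\<bar>y\<bar> \<le> L \<Longrightarrow> \<gamma> * y \<le> \<bar>\<gamma>\<bar> * L" "\<bar>y\<bar> \<le> L \<Longrightarrow> - \<bar>\<gamma>\<bar> * L \<le> \<gamma> * y"
  using mult_left_mono[of "\<bar>y\<bar>" L "\<bar>\<gamma>\<bar>"] by (simp_all add: abs_mult[symmetric] abs_le_iff)

lemma tilt_bound: "\<bar>tilt y\<bar> \<le> exp (\<bar>\<gamma>\<bar> * L)"
  using abs_\<gamma>_le(1)[of y] by (auto simp: tilt_def)

lemma tilt_Y: "AE w in M. tilt (Y w) = exp (\<gamma> * Y w)"
  using Y_bounded by eventually_elim (auto simp: tilt_def abs_le_iff)

text \<open>
  Test against the indicator of \<open>X \<in> S\<close> and condition on \<open>(X,Y)\<close>: by \<open>selection_odds\<close>,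
  \<open>E[\<Delta> q(Y) e\<^bsup>\<gamma>Y\<^esup> e\<^bsup>g(X)\<^esup>; S] = E[(1 - \<pi>(X,Y)) q(Y); S] = E[q(Y); S] - E[\<Delta> q(Y); S]\<close>.
  The function \<open>q\<close> stands for the identity, cut off outside \<open>[-L,L]\<close>, and for the constant \<open>1\<close>.
\<close>

lemma odds_identity:
  fixes q :: "real \<Rightarrow> real" and r \<eta> \<eta>\<gamma> :: "'a \<Rightarrow> real"
  assumes [measurable]: "q \<in> borel_measurable borel" "r \<in> borel_measurable borel"
    "\<eta> \<in> borel_measurable borel" "\<eta>\<gamma> \<in> borel_measurable borel"
    and q: "\<And>y. \<bar>q y\<bar> \<le> Q"
    and bounds: "\<And>x. \<bar>\<eta> x\<bar> \<le> B" "\<And>x. \<bar>\<eta>\<gamma> x\<bar> \<le> B"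
    and r_int: "integrable M (\<lambda>w. r (X w))"
    and r: "regression_of M X (\<lambda>w. q (Y w)) r"
    and \<eta>: "regression_of M X (\<lambda>w. \<Delta> w * q (Y w)) \<eta>"
    and \<eta>\<gamma>: "regression_of M X (\<lambda>w. \<Delta> w * q (Y w) * exp (\<gamma> * Y w)) \<eta>\<gamma>"
  shows "AE x in distr M borel X. exp (g x) * \<eta>\<gamma> x = r x - \<eta> x"
proof (rule AE_distr_eq_of_integrals)
  have Q: "0 \<le> Q" using q[of 0] by linarith
  have B: "0 \<le> B" using bounds(1)[of 0] by linarith
  have G: "0 \<le> 1 / \<pi>_min" using \<pi>_min_pos by simp
  show "integrable M (\<lambda>w. exp (g (X w)) * \<eta>\<gamma> (X w))"
  proof (rule integrable_const_bound[where B = "1 / \<pi>_min * B"])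
    show "AE w in M. norm (exp (g (X w)) * \<eta>\<gamma> (X w)) \<le> 1 / \<pi>_min * B"
      unfolding norm_mult by (intro AE_I2 mult_mono) (use exp_g_le bounds G in auto)
  qed measurable
  have i\<eta>: "integrable M (\<lambda>w. \<eta> (X w))"
    by (rule integrable_const_bound[where B = B]) (use bounds in auto)
  then show "integrable M (\<lambda>w. r (X w) - \<eta> (X w))" using r_int by simp
  fix S :: "'a set" assume S [measurable]: "S \<in> sets borel"
  let ?v = "\<lambda>(x, y). q y * tilt y * (exp (g x) * indicator S x) :: real"
  let ?q = "\<lambda>(x :: 'a, y). q y * indicator S x :: real"
  have u_bound: "\<bar>exp (g x) * indicator S x\<bar> \<le> 1 / \<pi>_min" for x
    using exp_g_le[of x] G by (auto simp: indicator_def)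
  have v_bound: "\<bar>?v p\<bar> \<le> Q * exp (\<bar>\<gamma>\<bar> * L) * (1 / \<pi>_min)" for p
  proof (cases p)
    case (Pair x y)
    have "\<bar>q y\<bar> * \<bar>tilt y\<bar> * \<bar>exp (g x) * indicator S x\<bar> \<le> Q * exp (\<bar>\<gamma>\<bar> * L) * (1 / \<pi>_min)"
      by (intro mult_mono q tilt_bound u_bound) (use Q in auto)
    then show ?thesis by (simp add: Pair abs_mult)
  qed
  have v0_bound: "\<bar>?q p\<bar> \<le> Q" for p using q Q by (auto simp: indicator_def split: prod.split)
  have iq: "integrable M (\<lambda>w. q (Y w) * indicator S (X w))"
    by (rule integrable_const_bound[where B = Q]) (use q Q in \<open>auto simp: indicator_def\<close>)
  have i\<pi>q: "integrable M (\<lambda>w. selection_prob g \<gamma> (X w) (Y w) * (q (Y w) * indicator S (X w)))"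
  proof (rule integrable_const_bound[where B = "1 * Q"])
    show "AE w in M. norm (selection_prob g \<gamma> (X w) (Y w) * (q (Y w) * indicator S (X w))) \<le> 1 * Q"
      unfolding norm_mult
      by (intro AE_I2 mult_mono)
        (use selection_prob_bounds q Q in \<open>auto simp: indicator_def abs_of_pos less_imp_le\<close>)
  qed measurable
  have "(\<integral>w. exp (g (X w)) * \<eta>\<gamma> (X w) * indicator S (X w) \<partial>M) = (\<integral>w. \<eta>\<gamma> (X w) * (exp (g (X w)) * indicator S (X w)) \<partial>M)"
    by (simp add: mult_ac)
  also have "\<dots> = (\<integral>w. \<Delta> w * q (Y w) * exp (\<gamma> * Y w) * (exp (g (X w)) * indicator S (X w)) \<partial>M)"
    by (rule regression_ofD[OF \<eta>\<gamma>, symmetric, where C = "1 / \<pi>_min"]) (measurable, rule u_bound)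
  also have "\<dots> = (\<integral>w. \<Delta> w * ?v (X w, Y w) \<partial>M)"
    by (rule integral_cong_AE) (measurable, use tilt_Y in \<open>auto elim!: eventually_mono\<close>)
  also have "\<dots> = (\<integral>w. selection_prob g \<gamma> (X w) (Y w) * ?v (X w, Y w) \<partial>M)"
    by (rule integral_\<Delta>[OF _ v_bound]) measurable
  also have "\<dots> = (\<integral>w. q (Y w) * indicator S (X w) - selection_prob g \<gamma> (X w) (Y w) * (q (Y w) * indicator S (X w)) \<partial>M)"
  proof (rule integral_cong_AE)
    show "AE w in M. selection_prob g \<gamma> (X w) (Y w) * ?v (X w, Y w)
      = q (Y w) * indicator S (X w) - selection_prob g \<gamma> (X w) (Y w) * (q (Y w) * indicator S (X w))"
      using tilt_Y
    proof eventually_elim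
      case (elim w)
      have "selection_prob g \<gamma> (X w) (Y w) * ?v (X w, Y w)
          = selection_prob g \<gamma> (X w) (Y w) * (exp (\<gamma> * Y w) * exp (g (X w))) * (q (Y w) * indicator S (X w))"
        using elim by (simp add: mult_ac)
      then show ?case unfolding selection_odds by (simp add: left_diff_distrib)
    qed
  qed measurable
  also have "\<dots> = (\<integral>w. q (Y w) * indicator S (X w) \<partial>M) - (\<integral>w. selection_prob g \<gamma> (X w) (Y w) * (q (Y w) * indicator S (X w)) \<partial>M)"
    by (rule Bochner_Integration.integral_diff[OF iq i\<pi>q])
  also have "(\<integral>w. selection_prob g \<gamma> (X w) (Y w) * (q (Y w) * indicator S (X w)) \<partial>M) = (\<integral>w. \<Delta> w * ?q (X w, Y w) \<partial>M)"
  proof -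
    have "?q \<in> borel_measurable (borel \<Otimes>\<^sub>M borel)" by measurable
    from integral_\<Delta>[OF this v0_bound] show ?thesis by simp
  qed
  also have "\<dots> = (\<integral>w. \<eta> (X w) * indicator S (X w) \<partial>M)"
    using regression_of_indicator[OF \<eta> S] by (simp add: mult_ac)
  also have "(\<integral>w. q (Y w) * indicator S (X w) \<partial>M) - (\<integral>w. \<eta> (X w) * indicator S (X w) \<partial>M)
      = (\<integral>w. (r (X w) - \<eta> (X w)) * indicator S (X w) \<partial>M)"
  proof -
    have "integrable M (\<lambda>w. k (X w) * indicator S (X w))"
      if "integrable M (\<lambda>w. k (X w))" and [measurable]: "k \<in> borel_measurable borel" for k :: "'a \<Rightarrow> real"
      by (rule Bochner_Integration.integrable_bound[OF that(1)]) (auto simp: indicator_def)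
    from this[OF r_int] this[OF i\<eta>] show ?thesis
      unfolding regression_of_indicator[OF r S] left_diff_distrib by simp
  qed
  finally show "(\<integral>w. exp (g (X w)) * \<eta>\<gamma> (X w) * indicator S (X w) \<partial>M)
    = (\<integral>w. (r (X w) - \<eta> (X w)) * indicator S (X w) \<partial>M)" .
qed (use exp_g_meas assms in measurable)

text \<open>
  The integrand satisfies \<open>\<pi>(X,Y) e\<^bsup>\<gamma>Y\<^esup> \<ge> \<pi>_min e\<^bsup>-\<bar>\<gamma>\<bar>L\<^esup>\<close>, and averages over events pass this on to
  the regression function.
\<close>

lemma tilted_selection_lower_bound:
  fixes \<eta>\<gamma> :: "'a \<Rightarrow> real"
  assumes [measurable]: "\<eta>\<gamma> \<in> borel_measurable borel" and bound: "\<And>x. \<bar>\<eta>\<gamma> x\<bar> \<le> B"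
    and \<eta>\<gamma>: "regression_of M X (\<lambda>w. \<Delta> w * exp (\<gamma> * Y w)) \<eta>\<gamma>"
  shows "AE x in distr M borel X. \<pi>_min * exp (- \<bar>\<gamma>\<bar> * L) \<le> \<eta>\<gamma> x"
proof -
  define c where "c = \<pi>_min * exp (- \<bar>\<gamma>\<bar> * L)"
  have c: "0 < c" using \<pi>_min_pos by (simp add: c_def)
  interpret D: prob_space "distr M borel X" by (rule prob_space_distr) measurable
  have "AE x in distr M borel X. \<eta>\<gamma> x \<in> {c..}"
  proof (rule D.averaging_theorem)
    show "integrable (distr M borel X) \<eta>\<gamma>"
      by (rule D.integrable_const_bound[where B = B]) (use bound in auto)
    fix S assume "S \<in> sets (distr M borel X)" and mS: "0 < measure (distr M borel X) S"
    then have S [measurable]: "S \<in> sets borel" by simp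
    let ?v = "\<lambda>(x :: 'a, y). tilt y * indicator S x :: real"
    have v_bound: "\<bar>?v p\<bar> \<le> exp (\<bar>\<gamma>\<bar> * L)" for p
      using tilt_bound by (auto simp: indicator_def split: prod.split)
    have "c * measure (distr M borel X) S = (\<integral>w. c * indicator S (X w) \<partial>M)"
    proof -
      have "(\<integral>w. indicator S (X w) \<partial>M) = (\<integral>x. (indicator S x :: real) \<partial>distr M borel X)"
        by (subst integral_distr) auto
      then show ?thesis by simp
    qed
    also have "\<dots> \<le> (\<integral>w. selection_prob g \<gamma> (X w) (Y w) * ?v (X w, Y w) \<partial>M)"
    proof (rule integral_mono_AE)
      show "integrable M (\<lambda>w. c * indicator S (X w))"
        by (rule integrable_const_bound[where B = c]) (use c in \<open>auto simp: indicator_def\<close>)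
      show "integrable M (\<lambda>w. selection_prob g \<gamma> (X w) (Y w) * ?v (X w, Y w))"
      proof (rule integrable_const_bound[where B = "1 * exp (\<bar>\<gamma>\<bar> * L)"])
        show "AE w in M. norm (selection_prob g \<gamma> (X w) (Y w) * ?v (X w, Y w)) \<le> 1 * exp (\<bar>\<gamma>\<bar> * L)"
          unfolding norm_mult
          by (intro AE_I2 mult_mono)
            (use selection_prob_bounds v_bound in \<open>auto simp: abs_of_pos simp del: split_conv case_prod_conv\<close>)
      qed measurable
      show "AE w in M. c * indicator S (X w) \<le> selection_prob g \<gamma> (X w) (Y w) * ?v (X w, Y w)"
        using Y_bounded
      proof eventually_elim
        case (elim w)
        then have "\<bar>Y w\<bar> \<le> L" by (auto simp: abs_le_iff)
        then have "exp (- \<bar>\<gamma>\<bar> * L) \<le> tilt (Y w)" using abs_\<gamma>_le[of "Y w"] by (simp add: tilt_def)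
        then have "c \<le> selection_prob g \<gamma> (X w) (Y w) * tilt (Y w)"
          unfolding c_def using \<pi>_min_pos \<pi>_min_le[OF elim, of "X w"] by (intro mult_mono) auto
        then show ?case by (auto simp: indicator_def)
      qed
    qed
    also have "\<dots> = (\<integral>w. \<Delta> w * ?v (X w, Y w) \<partial>M)"
      by (rule integral_\<Delta>[OF _ v_bound, symmetric]) measurable
    also have "\<dots> = (\<integral>w. \<Delta> w * exp (\<gamma> * Y w) * indicator S (X w) \<partial>M)"
      by (rule integral_cong_AE) (measurable, use tilt_Y in \<open>auto elim!: eventually_mono\<close>)
    also have "\<dots> = (\<integral>w. \<eta>\<gamma> (X w) * indicator S (X w) \<partial>M)" by (rule regression_of_indicator[OF \<eta>\<gamma> S])
    also have "\<dots> = (\<integral>x\<in>S. \<eta>\<gamma> x \<partial>distr M borel X)"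
      unfolding set_lebesgue_integral_def by (subst integral_distr) (auto simp: mult.commute)
    finally show "(1 / measure (distr M borel X) S) *\<^sub>R (\<integral>x\<in>S. \<eta>\<gamma> x \<partial>distr M borel X) \<in> {c..}"
      using mS by (simp add: field_simps)
  qed simp
  then show ?thesis by (simp add: c_def)
qed

end

context selection_model
begin

text \<open>
  The odds identity for the identity function and for the constant \<open>1\<close> gives two equations with the
  same factor \<open>e\<^bsup>g\<^esup>\<close>, which cancels in the quotient.
\<close>

lemma regression_representation:
  fixes \<eta> \<eta>\<gamma> :: "nat \<Rightarrow> 'a \<Rightarrow> real"
  assumes m: "cond_exp_given M Y X m"
    and meas [measurable]: "\<And>k. \<eta> k \<in> borel_measurable borel" "\<And>k. \<eta>\<gamma> k \<in> borel_measurable borel"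
    and bounds: "\<And>k x. \<bar>\<eta> k x\<bar> \<le> B" "\<And>k x. \<bar>\<eta>\<gamma> k x\<bar> \<le> B"
    and \<eta>: "\<And>k. k \<in> {1, 2} \<Longrightarrow> regression_of M X (\<lambda>w. response L k 0 (X w, Y w, \<Delta> w)) (\<eta> k)"
    and \<eta>\<gamma>: "\<And>k. k \<in> {1, 2} \<Longrightarrow> regression_of M X (\<lambda>w. response L k \<gamma> (X w, Y w, \<Delta> w)) (\<eta>\<gamma> k)"
  shows "AE x in distr M borel X. \<pi>_min * exp (- \<bar>\<gamma>\<bar> * L) \<le> \<eta>\<gamma> 2 x \<and>
    m x = \<eta> 1 x + \<eta>\<gamma> 1 x / \<eta>\<gamma> 2 x * (1 - \<eta> 2 x)"
proof -
  have [measurable]: "m \<in> borel_measurable borel" using m by (simp add: cond_exp_given_def)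
  have Y_int: "integrable M Y"
    by (rule integrable_const_bound[where B = L]) (use Y_bounded in \<open>auto simp: abs_le_iff elim!: eventually_mono\<close>)
  have resp_meas [measurable]: "(\<lambda>w. response L k t (X w, Y w, \<Delta> w)) \<in> borel_measurable M" for k t
    by (rule measurable_compose[OF _ response_meas]) (simp add: borel_prod[symmetric])
  have resp: "AE w in M. response L k t (X w, Y w, \<Delta> w) = \<Delta> w * Y w ^ (2 - k) * exp (t * Y w)" for k t
    using Y_bounded \<Delta>_binary by eventually_elim (auto simp: response_def admissible_def abs_le_iff)
  define q where "q y = (if \<bar>y\<bar> \<le> L then y else 0)" for y
  have [measurable]: "q \<in> borel_measurable borel" unfolding q_def by measurable
  have qY: "AE w in M. Y w = q (Y w)" using Y_bounded by eventually_elim (auto simp: q_def abs_le_iff)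
  have id1: "AE x in distr M borel X. exp (g x) * \<eta>\<gamma> 1 x = m x - \<eta> 1 x"
  proof (rule odds_identity[where q = q and Q = L and B = B])
    show "\<bar>q y\<bar> \<le> L" for y using L_nonneg by (simp add: q_def)
    show "integrable M (\<lambda>w. m (X w))"
      by (rule cond_exp_given_integral(1)[OF prob_space_axioms m Y_int X_meas, of "\<lambda>_. 0" 0]) auto
    show "regression_of M X (\<lambda>w. q (Y w)) m"
      by (rule regression_of_cong_AE[OF cond_exp_given_regression_of[OF prob_space_axioms m Y_int X_meas]])
        (measurable, rule qY)
    show "regression_of M X (\<lambda>w. \<Delta> w * q (Y w)) (\<eta> 1)"
      by (rule regression_of_cong_AE[OF \<eta>])
        (use resp[of 1 0] qY in \<open>auto elim: eventually_elim2\<close>)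
    show "regression_of M X (\<lambda>w. \<Delta> w * q (Y w) * exp (\<gamma> * Y w)) (\<eta>\<gamma> 1)"
      by (rule regression_of_cong_AE[OF \<eta>\<gamma>])
        (use resp[of 1 \<gamma>] qY in \<open>auto elim: eventually_elim2\<close>)
  qed (use bounds in \<open>auto simp: meas\<close>)
  have id2: "AE x in distr M borel X. exp (g x) * \<eta>\<gamma> 2 x = 1 - \<eta> 2 x"
  proof (rule odds_identity[where q = "\<lambda>_. 1" and Q = 1 and B = B])
    show "regression_of M X (\<lambda>w. \<Delta> w * 1) (\<eta> 2)"
      by (rule regression_of_cong_AE[OF \<eta>]) (use resp[of 2 0] in auto)
    show "regression_of M X (\<lambda>w. \<Delta> w * 1 * exp (\<gamma> * Y w)) (\<eta>\<gamma> 2)"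
      by (rule regression_of_cong_AE[OF \<eta>\<gamma>]) (use resp[of 2 \<gamma>] in auto)
  qed (use bounds in \<open>auto simp: regression_of_def\<close>)
  have low: "AE x in distr M borel X. \<pi>_min * exp (- \<bar>\<gamma>\<bar> * L) \<le> \<eta>\<gamma> 2 x"
  proof (rule tilted_selection_lower_bound[where B = B])
    show "regression_of M X (\<lambda>w. \<Delta> w * exp (\<gamma> * Y w)) (\<eta>\<gamma> 2)"
      by (rule regression_of_cong_AE[OF \<eta>\<gamma>]) (use resp[of 2 \<gamma>] in auto)
  qed (use bounds in auto)
  show ?thesis
    using id1 id2 low
  proof eventually_elim
    case (elim x)
    have "0 < \<pi>_min * exp (- \<bar>\<gamma>\<bar> * L)" using \<pi>_min_pos by simp
    then have "0 < \<eta>\<gamma> 2 x" using elim(3) by linarith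
    then have "\<eta>\<gamma> 1 x / \<eta>\<gamma> 2 x * (1 - \<eta> 2 x) = exp (g x) * \<eta>\<gamma> 1 x"
      unfolding elim(2)[symmetric] by simp
    then show ?case using elim by simp
  qed
qed

end

section \<open>Consistency of the estimator\<close>

lemma fst_borel_measurable: "fst \<in> borel_measurable (borel :: ('a::second_countable_topology \<times> 'b::second_countable_topology) measure)"
  unfolding borel_prod[symmetric] by measurable

lemma powr_le_linear:
  fixes a b p :: real
  assumes "0 \<le> a" "a \<le> b" "1 \<le> p"
  shows "a powr p \<le> b powr (p - 1) * a"
proof (cases "a = 0")
  case False
  then have "a powr p = a powr (p - 1) * a"
    using assms powr_add[of a "p - 1" 1] by simp
  also have "\<dots> \<le> b powr (p - 1) * a"
    using assms by (intro mult_right_mono powr_mono2) auto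
  finally show ?thesis .
qed (use assms in simp)

text \<open>
  The five exceptional events are large errors of the kernel estimates for the four responses and for
  the constant response \<open>1\<close>. Outside of them, and if \<open>\<gamma>_hat\<close> is within \<open>C\<^sub>0\<close> of \<open>\<gamma>\<^sub>0\<close>, the
  integrated error is at most \<open>\<epsilon>\<close> for almost every outcome. So \<open>c\<^sub>1 = 5\<close> and \<open>c\<^sub>3 = 1\<close>
  will do, and only \<open>c\<^sub>2\<close> and \<open>C\<^sub>0\<close> depend on \<open>\<epsilon>\<close>.
\<close>

theorem theorem1:
  fixes M :: "'w measure"
    and X :: "'w \<Rightarrow> 'a::euclidean_space" and Y \<Delta> :: "'w \<Rightarrow> real"
    and Xs :: "nat \<Rightarrow> 'w \<Rightarrow> 'a" and Ys \<Delta>s :: "nat \<Rightarrow> 'w \<Rightarrow> real"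
    and L \<gamma>\<^sub>0 p :: real and g m :: "'a \<Rightarrow> real"
    and K :: "'a \<Rightarrow> real" and h :: "nat \<Rightarrow> real"
    and \<gamma>_hat :: "nat \<Rightarrow> (nat \<Rightarrow> 'a \<times> real \<times> real) \<Rightarrow> real"
  defines "data \<equiv> \<lambda>n w. \<lambda>i\<in>{..<n}. (Xs i w, Ys i w, \<Delta>s i w)"
  assumes "prob_space M"
    and "X \<in> borel_measurable M" "Y \<in> borel_measurable M" "\<Delta> \<in> borel_measurable M"
    and "AE w in M. Y w \<in> {-L..L}" "AE w in M. \<Delta> w \<in> {0, 1}"
    and "cond_exp_given M Y X m"
    and "cond_exp_given M \<Delta> (\<lambda>w. (X w, Y w)) (\<lambda>(x, y). selection_prob g \<gamma>\<^sub>0 x y)"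
    and "(INF (x, y) \<in> UNIV \<times> {-L..L}. selection_prob g \<gamma>\<^sub>0 x y) > 0"
    and "prob_space.indep_vars M (\<lambda>_. borel) (\<lambda>i w. (Xs i w, Ys i w, \<Delta>s i w)) UNIV"
    and "\<And>i. distr M borel (\<lambda>w. (Xs i w, Ys i w, \<Delta>s i w)) = distr M borel (\<lambda>w. (X w, Y w, \<Delta> w))"
    and "\<And>n. \<gamma>_hat n \<in> borel_measurable (PiM {..<n} (\<lambda>_. borel))"
    and "regular_kernel K"
    and "\<And>n. h n > 0" "h \<longlonglongrightarrow> 0" "filterlim (\<lambda>n. real n * h n ^ DIM('a)) at_top sequentially"
    and "1 \<le> p"
  shows "\<exists>c\<^sub>1>0. \<exists>c\<^sub>3>0. \<forall>\<epsilon>>0. \<exists>c\<^sub>2>0. \<exists>C\<^sub>0>0. \<forall>\<^sub>F n in sequentially.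
    measure M {w \<in> space M.
      (\<integral>\<^sup>+ x. ennreal (\<bar>m_hat K (h n) n (data n w) (\<gamma>_hat n (data n w)) x - m x\<bar> powr p)
        \<partial>distr M borel X) > ennreal \<epsilon>}
    \<le> c\<^sub>1 * exp (- c\<^sub>2 * real n) +
      c\<^sub>3 * measure M {w \<in> space M. \<bar>\<gamma>_hat n (data n w) - \<gamma>\<^sub>0\<bar> > C\<^sub>0}"
proof -
  interpret prob_space M by fact
  interpret selection_model M X Y \<Delta> L \<gamma>\<^sub>0 g
    by unfold_locales fact+
  define Zs where "Zs i w = (Xs i w, Ys i w, \<Delta>s i w)" for i w
  define N where "N = distr M borel (\<lambda>w. (X w, Y w, \<Delta> w))"
  have XY\<Delta>_meas [measurable]: "(\<lambda>w. (X w, Y w, \<Delta> w)) \<in> borel_measurable M"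
    by (simp add: borel_prod[symmetric])
  have indep: "indep_vars (\<lambda>_. borel) Zs UNIV"
    using assms(11) by (simp add: Zs_def[abs_def])
  have same: "distr M borel (Zs i) = N" for i
    using assms(12)[of i] by (simp add: Zs_def[abs_def] N_def)
  have Zs_meas [measurable]: "Zs i \<in> borel_measurable M" for i
    using indep by (simp add: indep_vars_def)
  have prob_N: "prob_space N" unfolding N_def by (rule prob_space_distr) measurable
  have sets_N [measurable_cong]: "sets N = sets borel" by (simp add: N_def)
  have fst_meas [measurable]: "fst \<in> borel_measurable N"
    using fst_borel_measurable by (simp cong: measurable_cong_sets add: measurable_cong_sets[OF sets_N refl])
  have resp_meas [measurable]: "response L k t \<in> borel_measurable N" for k t
    using response_meas by (simp add: measurable_cong_sets[OF sets_N refl])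
  have fst_eq: "distr N borel fst = distr M borel X"
    unfolding N_def by (subst distr_distr) (auto simp: comp_def fst_borel_measurable)
  define B where "B = (L + 1) * exp (\<bar>\<gamma>\<^sub>0\<bar> * L)"
  have "1 * 1 \<le> B" unfolding B_def using L_nonneg by (intro mult_mono) auto
  then have B: "1 \<le> B" by simp
  have resp_B: "\<bar>response L k t z\<bar> \<le> B" if "k \<in> {1, 2}" "\<bar>t\<bar> \<le> \<bar>\<gamma>\<^sub>0\<bar>"
    for k t and z :: "'a \<times> real \<times> real"
    unfolding B_def by (rule response_bound[OF L_nonneg _ that(2)]) (use that(1) in auto)
  define reg where "reg t k f \<longleftrightarrow> f \<in> borel_measurable borel \<and> (\<forall>x. \<bar>f x\<bar> \<le> B) \<and>
    (k \<in> {1, 2} \<longrightarrow> regression_of N fst (response L k t) f)" for t k f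
  have "\<exists>f. reg t k f" if "\<bar>t\<bar> \<le> \<bar>\<gamma>\<^sub>0\<bar>" for t k
  proof (cases "k \<in> {1, 2}")
    case True
    show ?thesis
      using regression_function_exists[OF prob_N fst_meas resp_meas resp_B[OF True that]]
      unfolding reg_def by blast
  next
    case False
    then show ?thesis using B by (intro exI[of _ "\<lambda>_. 0"]) (simp add: reg_def)
  qed
  then have choice: "\<exists>f. \<forall>k. reg t k (f k)" if "\<bar>t\<bar> \<le> \<bar>\<gamma>\<^sub>0\<bar>" for t
    using that by (intro choice) blast
  obtain \<eta> :: "nat \<Rightarrow> 'a \<Rightarrow> real" where \<eta>_reg: "\<And>k. reg 0 k (\<eta> k)" using choice[of 0] by auto
  obtain \<eta>\<gamma> :: "nat \<Rightarrow> 'a \<Rightarrow> real" where \<eta>\<gamma>_reg: "\<And>k. reg \<gamma>\<^sub>0 k (\<eta>\<gamma> k)" using choice[of \<gamma>\<^sub>0] by auto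
  have \<eta>_meas [measurable]: "\<eta> k \<in> borel_measurable borel" and \<eta>_bound: "\<bar>\<eta> k x\<bar> \<le> B"
    and \<eta>: "k \<in> {1, 2} \<Longrightarrow> regression_of N fst (response L k 0) (\<eta> k)" for k x
    using \<eta>_reg[of k] by (auto simp: reg_def)
  have \<eta>\<gamma>_meas [measurable]: "\<eta>\<gamma> k \<in> borel_measurable borel" and \<eta>\<gamma>_bound: "\<bar>\<eta>\<gamma> k x\<bar> \<le> B"
    and \<eta>\<gamma>: "k \<in> {1, 2} \<Longrightarrow> regression_of N fst (response L k \<gamma>\<^sub>0) (\<eta>\<gamma> k)" for k x
    using \<eta>\<gamma>_reg[of k] by (auto simp: reg_def)
  define c where "c = \<pi>_min * exp (- \<bar>\<gamma>\<^sub>0\<bar> * L)"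
  have c: "0 < c" using \<pi>_min_pos by (simp add: c_def)
  have rep: "AE x in distr M borel X. c \<le> \<eta>\<gamma> 2 x \<and> m x = \<eta> 1 x + \<eta>\<gamma> 1 x / \<eta>\<gamma> 2 x * (1 - \<eta> 2 x)"
    unfolding c_def
  proof (rule regression_representation[OF assms(8) \<eta>_meas \<eta>\<gamma>_meas \<eta>_bound \<eta>\<gamma>_bound])
    have to_M: "regression_of M X (\<lambda>w. response L k t (X w, Y w, \<Delta> w)) f"
      if "regression_of N fst (response L k t) f" and [measurable]: "f \<in> borel_measurable borel" for k t f
      using that(1) unfolding N_def
      by (subst (asm) regression_of_distr) (auto simp: response_meas fst_borel_measurable)
    show "regression_of M X (\<lambda>w. response L k 0 (X w, Y w, \<Delta> w)) (\<eta> k)" if "k \<in> {1, 2}" for k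
      by (rule to_M[OF \<eta>[OF that]]) measurable
    show "regression_of M X (\<lambda>w. response L k \<gamma>\<^sub>0 (X w, Y w, \<Delta> w)) (\<eta>\<gamma> k)" if "k \<in> {1, 2}" for k
      by (rule to_M[OF \<eta>\<gamma>[OF that]]) measurable
  qed

  obtain b \<rho> W where kd: "kernel_design (distr N borel fst) K b \<rho> W"
    using regular_kernel_design[OF assms(14) prob_space.prob_space_distr[OF prob_N fst_meas]] by auto
  have design: "regression_design N fst K b \<rho> W \<phi> f B"
    if "\<phi> \<in> borel_measurable N" "f \<in> borel_measurable borel" "\<And>z. \<bar>\<phi> z\<bar> \<le> B" "\<And>x. \<bar>f x\<bar> \<le> B"
      "regression_of N fst \<phi> f" for \<phi> f
    by (intro regression_design.intro regression_design_axioms.intro prob_N kd fst_meas that)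
  have design_\<eta>: "regression_design N fst K b \<rho> W (response L k 0) (\<eta> k) B" if "k \<in> {1, 2}" for k
    by (rule design[OF resp_meas \<eta>_meas resp_B[OF that] \<eta>_bound \<eta>[OF that]]) auto
  have design_\<eta>\<gamma>: "regression_design N fst K b \<rho> W (response L k \<gamma>\<^sub>0) (\<eta>\<gamma> k) B" if "k \<in> {1, 2}" for k
    by (rule design[OF resp_meas \<eta>\<gamma>_meas resp_B[OF that] \<eta>\<gamma>_bound \<eta>\<gamma>[OF that]]) auto
  interpret R1: regression_design N fst K b \<rho> W "response L 1 0" "\<eta> 1" B
    by (rule design_\<eta>) simp
  interpret R2: regression_design N fst K b \<rho> W "response L 2 0" "\<eta> 2" B
    by (rule design_\<eta>) simp
  interpret R3: regression_design N fst K b \<rho> W "response L 1 \<gamma>\<^sub>0" "\<eta>\<gamma> 1" B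
    by (rule design_\<eta>\<gamma>) simp
  interpret R4: regression_design N fst K b \<rho> W "response L 2 \<gamma>\<^sub>0" "\<eta>\<gamma> 2" B
    by (rule design_\<eta>\<gamma>) simp
  interpret R5: regression_design N fst K b \<rho> W "\<lambda>_. 1" "\<lambda>_. 1" B
    by (rule design) (use B in \<open>auto simp: regression_of_def\<close>)

  define D where "D = 1 + (1 + L + B) / c"
  have D: "0 < D" using c L_nonneg B by (simp add: D_def add_pos_nonneg)
  \<comment> \<open>A bound for the estimator, \<open>2L\<close>, plus a bound for \<open>m\<close>.\<close>
  define S where "S = 2 * L + (B + B / c * (1 + B))"
  have S: "0 < S" using c L_nonneg B by (simp add: S_def add_nonneg_pos add_pos_nonneg)
  define P where "P = S powr (p - 1)"
  have P: "0 < P" using S by (simp add: P_def)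

  let ?loss = "\<lambda>n z t. \<integral>\<^sup>+ x. ennreal (\<bar>m_hat K (h n) n z t x - m x\<bar> powr p) \<partial>distr M borel X"
  let ?E = "\<lambda>\<epsilon> n. {w \<in> space M. ennreal \<epsilon> < ?loss n (data n w) (\<gamma>_hat n (data n w))}"
  let ?G = "\<lambda>C n. {w \<in> space M. C < \<bar>\<gamma>_hat n (data n w) - \<gamma>\<^sub>0\<bar>}"
  have main: "\<exists>c\<^sub>2>0. \<exists>C\<^sub>0>0. \<forall>\<^sub>F n in sequentially.
    measure M (?E \<epsilon> n) \<le> 5 * exp (- c\<^sub>2 * real n) + 1 * measure M (?G C\<^sub>0 n)" if \<epsilon>: "0 < \<epsilon>" for \<epsilon>
  proof -
    \<comment> \<open>Solves \<open>2 P (L + 1) (e\<^bsup>C\<^sub>0(L+1)\<^esup> - 1) = \<epsilon>/2\<close>; using \<open>L + 1\<close> for \<open>L\<close> covers the case \<open>L = 0\<close>.\<close>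
    define C\<^sub>0 where "C\<^sub>0 = ln (1 + \<epsilon> / (4 * (L + 1) * P)) / (L + 1)"
    have q: "0 < \<epsilon> / (4 * (L + 1) * P)" using \<epsilon> L_nonneg P by simp
    then have C\<^sub>0: "0 < C\<^sub>0" using L_nonneg by (simp add: C\<^sub>0_def)
    have tilt: "P * (2 * L * (exp (C\<^sub>0 * L) - 1)) \<le> \<epsilon> / 2"
    proof -
      have "exp (C\<^sub>0 * L) \<le> exp (C\<^sub>0 * (L + 1))" using C\<^sub>0 by simp
      also have "C\<^sub>0 * (L + 1) = ln (1 + \<epsilon> / (4 * (L + 1) * P))" using L_nonneg by (simp add: C\<^sub>0_def)
      also have "exp \<dots> = 1 + \<epsilon> / (4 * (L + 1) * P)" using q by simp
      finally have "P * (2 * L * (exp (C\<^sub>0 * L) - 1)) \<le> P * (2 * (L + 1) * (\<epsilon> / (4 * (L + 1) * P)))"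
        using P L_nonneg C\<^sub>0 by (intro mult_left_mono mult_mono) auto
      also have "\<dots> = \<epsilon> / 2"
      proof -
        have "P * (2 * l * (\<epsilon> / (4 * l * P))) = \<epsilon> / 2" if "0 < l" for l
          using that P by (simp add: field_simps)
        then show ?thesis by this (use L_nonneg in simp)
      qed
      finally show ?thesis .
    qed
    \<comment> \<open>The error allowed to each of the five kernel estimates, such that they add up to \<open>\<epsilon>/2\<close>.\<close>
    define e where "e = \<epsilon> / (8 * P * D * (1 + B))"
    have e: "0 < e" using \<epsilon> P D B by (simp add: e_def)
    have e_eq: "P * (D * (4 * ((1 + B) * e))) = \<epsilon> / 2"
    proof -
      have "P * (D * (4 * (l * (\<epsilon> / (8 * P * D * l))))) = \<epsilon> / 2" if "0 < l" for l
        using that P D by (simp add: field_simps)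
      then show ?thesis unfolding e_def by this (use B in simp)
    qed

    have small: "?loss n z t \<le> ennreal \<epsilon>"
      if n: "0 < n" and hn: "h n \<le> 1" and good: "\<And>i. i < n \<Longrightarrow> admissible L (z i)" and t: "\<bar>t - \<gamma>\<^sub>0\<bar> \<le> C\<^sub>0"
        and J: "R1.L1_error (h n) n z < e" "R2.L1_error (h n) n z < e" "R3.L1_error (h n) n z < e"
          "R4.L1_error (h n) n z < e" "R5.L1_error (h n) n z < e" for n z t
    proof -
      have hpos: "0 < h n" by fact
      let ?r = "\<lambda>x. (\<bar>R1.fit (h n) n z x - \<eta> 1 x\<bar> + B * \<bar>R5.fit (h n) n z x - 1\<bar>)
        + (\<bar>R2.fit (h n) n z x - \<eta> 2 x\<bar> + B * \<bar>R5.fit (h n) n z x - 1\<bar>)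
        + (\<bar>R3.fit (h n) n z x - \<eta>\<gamma> 1 x\<bar> + B * \<bar>R5.fit (h n) n z x - 1\<bar>)
        + (\<bar>R4.fit (h n) n z x - \<eta>\<gamma> 2 x\<bar> + B * \<bar>R5.fit (h n) n z x - 1\<bar>)"
      let ?b = "\<lambda>x. P * (2 * L * (exp (C\<^sub>0 * L) - 1) + D * ?r x)"
      have pt: "AE x in distr N borel fst. \<bar>m_hat K (h n) n z t x - m x\<bar> powr p \<le> ?b x"
        using rep[folded fst_eq] R1.AE_\<kappa>_pos[OF hpos hn]
      proof eventually_elim
        case (elim x)
        have mx: "m x = \<eta> 1 x + \<eta>\<gamma> 1 x / \<eta>\<gamma> 2 x * (1 - \<eta> 2 x)" and cx: "c \<le> \<eta>\<gamma> 2 x" using elim by auto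
        have err: "\<bar>m_hat K (h n) n z t x - m x\<bar> \<le> 2 * L * (exp (C\<^sub>0 * L) - 1) + D * ?r x"
          using R1.m_hat_pointwise_error[where ?a1.0 = "\<eta> 1 x" and ?a2.0 = "\<eta> 2 x", OF elim(2) n L_nonneg good t c cx \<eta>\<gamma>_bound[of 1 x]]
          unfolding mx D_def R1.fit_def R2.fit_def R3.fit_def R4.fit_def R5.fit_def by (simp add: B_def)
        have "\<bar>\<eta>\<gamma> 1 x / \<eta>\<gamma> 2 x\<bar> \<le> B / c"
          unfolding abs_divide using \<eta>\<gamma>_bound[of 1 x] cx c B by (intro frac_le) auto
        moreover have "\<bar>1 - \<eta> 2 x\<bar> \<le> 1 + B" using \<eta>_bound[of 2 x] by linarith
        ultimately have "\<bar>\<eta>\<gamma> 1 x / \<eta>\<gamma> 2 x * (1 - \<eta> 2 x)\<bar> \<le> B / c * (1 + B)"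
          unfolding abs_mult using B c by (intro mult_mono) auto
        then have "\<bar>m x\<bar> \<le> B + B / c * (1 + B)"
          unfolding mx using \<eta>_bound[of 1 x] by (intro order_trans[OF abs_triangle_ineq] add_mono)
        moreover have "\<bar>m_hat K (h n) n z t x\<bar> \<le> 2 * L"
          by (rule m_hat_bound[OF R1.K_nonneg L_nonneg good])
        ultimately have "\<bar>m_hat K (h n) n z t x - m x\<bar> \<le> S" unfolding S_def by linarith
        then have "\<bar>m_hat K (h n) n z t x - m x\<bar> powr p \<le> P * \<bar>m_hat K (h n) n z t x - m x\<bar>"
          unfolding P_def by (intro powr_le_linear) (use assms(18) in auto)
        also have "\<dots> \<le> ?b x" using err P by (intro mult_left_mono) auto
        finally show ?case .
      qed
      have ints: "integrable (distr N borel fst) (\<lambda>x. \<bar>R1.fit (h n) n z x - \<eta> 1 x\<bar>)"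
        "integrable (distr N borel fst) (\<lambda>x. \<bar>R2.fit (h n) n z x - \<eta> 2 x\<bar>)"
        "integrable (distr N borel fst) (\<lambda>x. \<bar>R3.fit (h n) n z x - \<eta>\<gamma> 1 x\<bar>)"
        "integrable (distr N borel fst) (\<lambda>x. \<bar>R4.fit (h n) n z x - \<eta>\<gamma> 2 x\<bar>)"
        "integrable (distr N borel fst) (\<lambda>x. \<bar>R5.fit (h n) n z x - 1\<bar>)"
        by (intro R1.integrable_error R2.integrable_error R3.integrable_error R4.integrable_error R5.integrable_error hpos)+
      have b0: "0 \<le> ?b x" for x
        using P D B L_nonneg C\<^sub>0 by (intro mult_nonneg_nonneg add_nonneg_nonneg) auto
      have "(\<integral>\<^sup>+ x. ennreal (\<bar>m_hat K (h n) n z t x - m x\<bar> powr p) \<partial>distr N borel fst) \<le> (\<integral>\<^sup>+ x. ennreal (?b x) \<partial>distr N borel fst)"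
        by (rule nn_integral_mono_AE) (use pt in \<open>auto intro: ennreal_leI elim!: eventually_mono\<close>)
      also have "\<dots> = ennreal (\<integral>x. ?b x \<partial>distr N borel fst)"
        by (rule nn_integral_eq_integral) (use ints b0 in auto)
      also have "(\<integral>x. ?b x \<partial>distr N borel fst) = P * (2 * L * (exp (C\<^sub>0 * L) - 1) + D *
        ((R1.L1_error (h n) n z + B * R5.L1_error (h n) n z) + (R2.L1_error (h n) n z + B * R5.L1_error (h n) n z)
         + (R3.L1_error (h n) n z + B * R5.L1_error (h n) n z) + (R4.L1_error (h n) n z + B * R5.L1_error (h n) n z)))"
        unfolding R1.L1_error_def R2.L1_error_def R3.L1_error_def R4.L1_error_def R5.L1_error_def
        using ints by simp
      also have "\<dots> \<le> P * (2 * L * (exp (C\<^sub>0 * L) - 1) + D * ((e + B * e) + (e + B * e) + (e + B * e) + (e + B * e)))"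
        using J P D B by (intro mult_left_mono add_left_mono add_mono) auto
      also have "\<dots> = P * (2 * L * (exp (C\<^sub>0 * L) - 1)) + P * (D * (4 * ((1 + B) * e)))"
        by (simp add: algebra_simps)
      also have "\<dots> \<le> \<epsilon>" using tilt e_eq by linarith
      finally show ?thesis unfolding fst_eq by (simp add: ennreal_leI)
    qed

    let ?bad = "\<lambda>J n. {w \<in> space M. e \<le> J (h n) n (data n w)}"
    let ?rare = "\<lambda>J d n. ?bad J n \<in> sets M \<and> measure M (?bad J n) \<le> exp (- d * real n)"
    have data_eq: "data n = (\<lambda>w. \<lambda>i\<in>{..<n}. Zs i w)" for n unfolding data_def Zs_def ..
    note bound = iid_L1_error_exponential_bound[OF indep same _ assms(15,16,17) e, folded data_eq[THEN fun_cong]]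
    obtain d1 where d1: "0 < d1" "\<forall>\<^sub>F n in sequentially. ?rare R1.L1_error d1 n"
      using bound[OF R1.regression_design_axioms] by blast
    obtain d2 where d2: "0 < d2" "\<forall>\<^sub>F n in sequentially. ?rare R2.L1_error d2 n"
      using bound[OF R2.regression_design_axioms] by blast
    obtain d3 where d3: "0 < d3" "\<forall>\<^sub>F n in sequentially. ?rare R3.L1_error d3 n"
      using bound[OF R3.regression_design_axioms] by blast
    obtain d4 where d4: "0 < d4" "\<forall>\<^sub>F n in sequentially. ?rare R4.L1_error d4 n"
      using bound[OF R4.regression_design_axioms] by blast
    obtain d5 where d5: "0 < d5" "\<forall>\<^sub>F n in sequentially. ?rare R5.L1_error d5 n"
      using bound[OF R5.regression_design_axioms] by blast
    define c2 where "c2 = Min {d1, d2, d3, d4, d5}"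
    have c2: "0 < c2" "c2 \<le> d1" "c2 \<le> d2" "c2 \<le> d3" "c2 \<le> d4" "c2 \<le> d5"
      using d1 d2 d3 d4 d5 by (auto simp: c2_def)
    have rate: "x \<le> exp (- c2 * real n)" if "x \<le> exp (- d * real n)" "c2 \<le> d" for x d n
      using that(1) by (rule order_trans) (use that(2) in \<open>simp add: mult_right_mono\<close>)
    have h1: "\<forall>\<^sub>F n in sequentially. h n < 1" by (rule order_tendstoD(2)[OF assms(16)]) simp
    have "\<forall>\<^sub>F n in sequentially.
      measure M (?E \<epsilon> n) \<le> 5 * exp (- c2 * real n) + 1 * measure M (?G C\<^sub>0 n)"
      using d1(2) d2(2) d3(2) d4(2) d5(2) h1 eventually_gt_at_top[of 0]
    proof eventually_elim
      case (elim n)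
      note n = elim(7)
      have data_meas [measurable]: "data n \<in> measurable M (R1.sample n)"
        unfolding data_eq by (rule iid_sample_distr(1)[OF indep same n])
      note t1 = elim(1) rate[OF conjunct2[OF elim(1)] c2(2)]
      note t2 = elim(2) rate[OF conjunct2[OF elim(2)] c2(3)]
      note t3 = elim(3) rate[OF conjunct2[OF elim(3)] c2(4)]
      note t4 = elim(4) rate[OF conjunct2[OF elim(4)] c2(5)]
      note t5 = elim(5) rate[OF conjunct2[OF elim(5)] c2(6)]
      have sets_sample: "sets (R1.sample n) = sets (PiM {..<n} (\<lambda>_. borel))"
        by (intro sets_PiM_cong) (simp_all add: sets_N)
      have \<gamma>_meas [measurable]: "\<gamma>_hat n \<in> borel_measurable (R1.sample n)"
        using assms(13)[of n] by (simp add: measurable_cong_sets[OF sets_sample refl])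
      let ?U = "?bad R1.L1_error n \<union> ?bad R2.L1_error n \<union> ?bad R3.L1_error n \<union> ?bad R4.L1_error n \<union> ?bad R5.L1_error n \<union> ?G C\<^sub>0 n"
      have G_sets: "?G C\<^sub>0 n \<in> sets M" by measurable
      have good: "AE w in M. \<forall>i\<in>{..<n}. admissible L (Zs i w)"
      proof (rule AE_finite_allI)
        fix i
        have "AE w in M. admissible L (X w, Y w, \<Delta> w)"
          using Y_bounded \<Delta>_binary by eventually_elim (auto simp: admissible_def abs_le_iff)
        then have "AE z in N. admissible L z"
          unfolding N_def by (subst AE_distr_iff) (auto simp: pred_def[symmetric])
        then show "AE w in M. admissible L (Zs i w)"
          unfolding same[of i, symmetric] by (subst (asm) AE_distr_iff) (auto simp: pred_def[symmetric])
      qed simp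
      have "measure M (?E \<epsilon> n) \<le> measure M ?U"
      proof (rule finite_measure_mono_AE)
        show "AE w in M. w \<in> ?E \<epsilon> n \<longrightarrow> w \<in> ?U"
          using good AE_space
        proof eventually_elim
          case elim': (elim w)
          show ?case
          proof (rule impI, rule ccontr)
            assume "w \<in> ?E \<epsilon> n" "w \<notin> ?U"
            then have "?loss n (data n w) (\<gamma>_hat n (data n w)) \<le> ennreal \<epsilon>"
              using elim' n elim(6) by (intro small) (auto simp: not_le not_less data_eq)
            then show False using \<open>w \<in> ?E \<epsilon> n\<close> by (auto dest: leD)
          qed
        qed
        show "?U \<in> sets M" using t1(1) t2(1) t3(1) t4(1) t5(1) G_sets by auto
      qed
      also have "\<dots> \<le> measure M (?bad R1.L1_error n) + measure M (?bad R2.L1_error n) + measure M (?bad R3.L1_error n)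
          + measure M (?bad R4.L1_error n) + measure M (?bad R5.L1_error n) + measure M (?G C\<^sub>0 n)"
        using t1(1) t2(1) t3(1) t4(1) t5(1)
        by (intro order_trans[OF measure_Un_le] add_right_mono order_refl sets.Un G_sets) blast+
      also have "\<dots> \<le> 5 * exp (- c2 * real n) + 1 * measure M (?G C\<^sub>0 n)"
        using t1(2) t2(2) t3(2) t4(2) t5(2) by linarith
      finally show ?case .
    qed
    then show ?thesis using c2(1) C\<^sub>0 by blast
  qed
  show ?thesis
    by (rule exI[of _ 5], simp, rule exI[of _ 1], simp) (use main in simp)
qed

end
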